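(* Let $n\ge 3$ and let $\mathbf{G}=\{G_1,\dots,G_{n-1}\}$ be a collection of not necessarily distinct $n$-vertex graphs with the same vertex set $V$. If $\delta(G_i)\ge \frac{n+1}{2}$ for each $i\in[n-1]$, then either $\mathbf{G}$ is rainbow panconnected or $\mathbf{G}=\mathbf{F_{n-1}}$.
   Context: All graphs are finite and simple; $\delta(G)$ is the minimum degree of $G$; $[m]=\{1,\dots,m\}$. The join $G_1\vee G_2$ of two disjoint graphs $G_1$ and $G_2$ is the graph obtained from $G_1$ and $G_2$ by adding all edges between $V(G_1)$ and $V(G_2)$. For a collection $\mathbf{G}=\{G_1,\dots,G_s\}$ of not necessarily distinct graphs with the same vertex set $V$, a graph $H$ with $V(H)\subseteq V$ and $|E(H)|\le s$ is rainbow in $\mathbf{G}$ if there is an injection $\phi\colon E(H)\to[s]$ such that $e\in E(G_{\phi(e)})$ for each $e\in E(H)$. A $k$-path is a path on $k$ vertices. For $x,y\in V$, $d_{\mathbf{G}}(x,y)$ is the length (number of edges) of a shortest rainbow path between $x$ and $y$ in $\mathbf{G}$. A collection $\mathbf{G}$ of $n$-vertex graphs with the same vertex set $V$ is rainbow panconnected if for every pair of vertices $x,y\in V$ there exists a rainbow $k$-path joining $x$ and $y$ in $\mathbf{G}$ for every integer $k\in[d_{\mathbf{G}}(x,y)+1,n]$. The collection $\mathbf{F_m}$: let $n$ be odd, let $Q_1$ be an empty graph (no edges) with $\frac{n-1}{2}$ vertices, and let $Q_2$ be a graph on $\frac{n+1}{2}$ vertices with $\delta(Q_2)\ge 1$ such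 that one component of $Q_2$ is a single edge. Then $\mathbf{F_m}=\{F_1,\dots,F_m\}$ is defined as a collection of $n$-vertex graphs with the same vertex set such that $F_i=Q_1\vee Q_2$ for each $i\in[m]$.
   Formalization: In F_{n-1} the vertex sets of Q_1 and Q_2 and the single-edge component are common to all F_i, but the rest of Q_2 may vary with i; with one fixed Q_2 the claim fails, e.g. for n=9 with two different 3-vertex paths as the other component of Q_2. *)

theory Defs
  imports Complex_Main "HOL-Library.Extended_Nat"
begin

record 'a ugraph =
  verts :: "'a set"
  edges :: "'a set set"

definition simple_graph :: "'a ugraph \<Rightarrow> bool" where
  "simple_graph G \<longleftrightarrow> finite (verts G) \<and> (\<forall>e\<in>edges G. e \<subseteq> verts G \<and> card e = 2)"

definition degree :: "'a ugraph \<Rightarrow> 'a \<Rightarrow> nat" where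
  "degree G v = card {e \<in> edges G. v \<in> e}"

(* Only meaningful for graphs with a nonempty finite vertex set. *)
definition min_degree :: "'a ugraph \<Rightarrow> nat" where
  "min_degree G = Min (degree G ` verts G)"

(* The join is only used for graphs with disjoint vertex sets. *)
definition graph_join :: "'a ugraph \<Rightarrow> 'a ugraph \<Rightarrow> 'a ugraph" where
  "graph_join G H =
     \<lparr>verts = verts G \<union> verts H,
      edges = edges G \<union> edges H \<union> {{x, y} | x y. x \<in> verts G \<and> y \<in> verts H}\<rparr>"

definition empty_graph :: "'a set \<Rightarrow> 'a ugraph" where
  "empty_graph A = \<lparr>verts = A, edges = {}\<rparr>"

definition induced_subgraph :: "'a ugraph \<Rightarrow> 'a set \<Rightarrow> 'a ugraph" where
  "induced_subgraph G A = \<lparr>verts = verts G \<inter> A, edges = {e \<in> edges G. e \<subseteq> A}\<rparr>"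

definition adj_rel :: "'a ugraph \<Rightarrow> ('a \<times> 'a) set" where
  "adj_rel G = {(x, y). {x, y} \<in> edges G}"

(* The components as subgraphs, one for each class of mutually reachable vertices. *)
definition components :: "'a ugraph \<Rightarrow> 'a ugraph set" where
  "components G = {induced_subgraph G ((adj_rel G)\<^sup>* `` {x}) | x. x \<in> verts G}"

definition single_edge_graph :: "'a \<Rightarrow> 'a \<Rightarrow> 'a ugraph" where
  "single_edge_graph u v = \<lparr>verts = {u, v}, edges = {{u, v}}\<rparr>"

definition path_graph :: "'a list \<Rightarrow> 'a ugraph" where
  "path_graph xs =
     \<lparr>verts = set xs, edges = {{xs ! i, xs ! Suc i} | i. Suc i < length xs}\<rparr>"

(* A path on k vertices, hence of length k - 1, joining x and y. *)
definition k_path :: "nat \<Rightarrow> 'a \<Rightarrow> 'a \<Rightarrow> 'a ugraph \<Rightarrow> bool" where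
  "k_path k x y H \<longleftrightarrow>
     (\<exists>xs. xs \<noteq> [] \<and> distinct xs \<and> length xs = k \<and> hd xs = x \<and> last xs = y \<and> H = path_graph xs)"

(* A collection of s not necessarily distinct graphs is a family G :: nat => 'a ugraph of which
   only the members with index in {1..s} matter; V is the common vertex set. *)

definition rainbow :: "'a set \<Rightarrow> nat \<Rightarrow> (nat \<Rightarrow> 'a ugraph) \<Rightarrow> 'a ugraph \<Rightarrow> bool" where
  "rainbow V s G H \<longleftrightarrow>
     simple_graph H \<and> verts H \<subseteq> V \<and> card (edges H) \<le> s \<and>
     (\<exists>\<phi>. inj_on \<phi> (edges H) \<and> \<phi> ` edges H \<subseteq> {1..s} \<and> (\<forall>e\<in>edges H. e \<in> edges (G (\<phi> e))))"

(* The length of a shortest rainbow path; infinity if there is no rainbow path from x to y. *)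
definition rainbow_dist :: "'a set \<Rightarrow> nat \<Rightarrow> (nat \<Rightarrow> 'a ugraph) \<Rightarrow> 'a \<Rightarrow> 'a \<Rightarrow> enat" where
  "rainbow_dist V s G x y = Inf {enat l | l. \<exists>H. k_path (l + 1) x y H \<and> rainbow V s G H}"

definition rainbow_panconnected :: "'a set \<Rightarrow> nat \<Rightarrow> (nat \<Rightarrow> 'a ugraph) \<Rightarrow> bool" where
  "rainbow_panconnected V s G \<longleftrightarrow>
     (\<forall>x\<in>V. \<forall>y\<in>V. x \<noteq> y \<longrightarrow>
        (\<forall>k::nat. rainbow_dist V s G x y + 1 \<le> enat k \<and> k \<le> card V \<longrightarrow>
           (\<exists>H. k_path k x y H \<and> rainbow V s G H)))"

(* The graph F i is the join of the empty graph on A and a graph Q2 on B having {u, v} as a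
   single-edge component.  The sets A, B and the edge {u, v} are common to the whole collection,
   whereas the rest of Q2 may depend on i: on 9 vertices there are collections of this shape with
   different graphs Q2 that have no rainbow path on 4 vertices from u to v. *)
definition is_F_collection :: "nat \<Rightarrow> 'a set \<Rightarrow> nat \<Rightarrow> (nat \<Rightarrow> 'a ugraph) \<Rightarrow> bool" where
  "is_F_collection n V m F \<longleftrightarrow>
     odd n \<and>
     (\<exists>A B u v.
        finite A \<and> finite B \<and> A \<inter> B = {} \<and> A \<union> B = V \<and>
        card A = (n - 1) div 2 \<and> card B = (n + 1) div 2 \<and> u \<noteq> v \<and>
        (\<forall>i\<in>{1..m}. \<exists>Q2.
           simple_graph Q2 \<and> verts Q2 = B \<and> min_degree Q2 \<ge> 1 \<and>
           single_edge_graph u v \<in> components Q2 \<and>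
           F i = graph_join (empty_graph A) Q2))"

end

theory Submission
  imports Defs
begin

text \<open>Fix distinct vertices \<open>x\<close> and \<open>y\<close>, and call them \<open>k\<close>-joined if a rainbow path on \<open>k\<close> vertices
joins them.  Only \<open>3 \<le> k \<le> n\<close> needs an argument, because a path on two vertices is asked for
exactly when the distance is one.  Write \<open>D = n div 2 + 1\<close> for the degree bound, so that
\<open>2 D \<ge> n + 1\<close>, with equality for odd \<open>n\<close>.  The case \<open>k = 3\<close> is a common neighbour
(\<open>joined_three\<close>), and \<open>k = n\<close> follows from \<open>k = n - 1\<close> (\<open>extend_to_hamilton\<close>).

For \<open>4 \<le> k \<le> n - 1\<close> the idea is to use one long rainbow cycle for all \<open>k\<close> at once.  Suppose that
\<open>V - {x, y}\<close> carries a rainbow cycle \<open>u\<close> of length \<open>n - 3\<close>, so that exactly one vertex \<open>w\<close> and two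
colours \<open>c\<close>, \<open>d\<close> are left over.  If \<open>x\<close> sees \<open>u j\<close> in colour \<open>c\<close> and \<open>y\<close> sees \<open>u (j + s)\<close> in colour \<open>d\<close>,
then the arc between them makes \<open>x\<close> and \<open>y\<close> \<open>(s + 3)\<close>-joined.  Each of the two sets of indices has at
least \<open>D - 2\<close> elements out of \<open>n - 3\<close>.  So for even \<open>n\<close> they meet, and for odd \<open>n\<close> the only way to
avoid a path is that they are complementary and all degrees are tight (\<open>frame_basic\<close>).

Such a cycle exists whenever some \<open>k\<close> fails (\<open>near_cycle_exists\<close>): a longest rainbow path of
\<open>V - {x, y}\<close> is spanning, and closing it up gives a cycle missing one vertex, or a spanning cycle, or a
system of two blocks sharing a vertex.  In the last case all paths are visible, and in the second one
a cycle missing one vertex is obtained by an averaging argument (\<open>hamilton_cycle_shorten\<close>).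

What remains is the rigidity of the tight case.  The difficulty is that tightness is known for the
two spare colours only.  An exchange of two edges of the cycle makes another colour spare
(\<open>frame_exchange\<close>), and a count shows that of any two edges at distance \<open>s\<close> at least one can be made
spare in this way (\<open>spare_one_of_two\<close>).  This is enough to route a path through \<open>w\<close>, which forces the
neighbours of \<open>x\<close>, and those of \<open>y\<close>, to be every second vertex of the cycle
(\<open>frame_alternating\<close>).  Then \<open>s\<close> is odd (\<open>s_odd\<close>), and replacing a neighbour of \<open>x\<close> by \<open>w\<close> transfers the structure
to every colour (\<open>frame_structure\<close>).  If \<open>s \<ge> 3\<close>, a vertex that is not adjacent to \<open>x\<close> has a
neighbour of the same kind, and this edge repairs the parity of the alternating paths (\<open>s_eq_one\<close>).
So \<open>s = 1\<close>, that is \<open>k = 4\<close>, and reading off the neighbourhoods gives the extremal collection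
(\<open>extremal_structure\<close>).

Two averaging arguments use the following device.  Along a rainbow path or cycle \<open>v\<close> with colours \<open>f\<close>,
consider for a vertex \<open>z\<close> the indices \<open>i\<close> such that \<open>z\<close> is adjacent to \<open>v i\<close> in the colour of the edge
leaving \<open>v i\<close>.  The degree bound does not control their number for a given \<open>z\<close>, but it controls the
sum over all \<open>z\<close> (\<open>sum_colour_degrees\<close>), so that some \<open>z\<close> has many of them.\<close>

section \<open>Coloured walks\<close>

text \<open>The second list gives the colours of the consecutive edges of the first, so a walk has one vertex more
than it has colours.\<close>

fun coloured_walk :: "('c \<Rightarrow> 'a \<Rightarrow> 'a \<Rightarrow> bool) \<Rightarrow> 'a list \<Rightarrow> 'c list \<Rightarrow> bool" where
  "coloured_walk E [x] [] = True"
| "coloured_walk E (x # y # xs) (c # cs) = (E c x y \<and> coloured_walk E (y # xs) cs)"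
| "coloured_walk E _ _ = False"

lemma walk_length: "coloured_walk E xs cs \<Longrightarrow> length xs = Suc (length cs)"
  by (induction E xs cs rule: coloured_walk.induct) auto

lemma walk_Cons: "xs \<noteq> [] \<Longrightarrow> coloured_walk E (x # xs) (c # cs) \<longleftrightarrow> E c x (hd xs) \<and> coloured_walk E xs cs"
  by (cases xs) auto

lemma walk_append:
  assumes "coloured_walk E xs cs" "coloured_walk E ys ds" "E c (last xs) (hd ys)"
  shows "coloured_walk E (xs @ ys) (cs @ c # ds)"
  using assms(1,3)
proof (induction xs arbitrary: cs)
  case (Cons x xs)
  have "ys \<noteq> []" using walk_length[OF assms(2)] by auto
  show ?case
  proof (cases xs)
    case Nil
    then have "cs = []" using walk_length[OF Cons.prems(1)] by simp
    then show ?thesis using Nil Cons.prems assms(2) \<open>ys \<noteq> []\<close> by (simp add: walk_Cons)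
  next
    case (Cons y zs)
    then obtain d es where "cs = d # es" using walk_length[OF \<open>coloured_walk E (x # xs) cs\<close>] by (cases cs) auto
    then show ?thesis using Cons \<open>E c (last (x # xs)) (hd ys)\<close> \<open>coloured_walk E (x # xs) cs\<close> Cons.IH[of es]
      by (simp add: walk_Cons)
  qed
qed simp

lemma walk_snoc:
  assumes "coloured_walk E xs cs" "E c (last xs) y"
  shows "coloured_walk E (xs @ [y]) (cs @ [c])"
  using walk_append[of E xs cs "[y]" "[]" c] assms by simp

lemma walk_rev:
  assumes "\<And>c x y. E c x y \<Longrightarrow> E c y x" "coloured_walk E xs cs"
  shows "coloured_walk E (rev xs) (rev cs)"
  using assms(2)
proof (induction xs arbitrary: cs)
  case (Cons x xs)
  show ?case
  proof (cases cs)
    case Nil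
    then show ?thesis using walk_length[OF Cons.prems] by simp
  next
    case (Cons c ds)
    then have "xs \<noteq> []" using walk_length[OF \<open>coloured_walk E (x # xs) cs\<close>] by auto
    moreover have "E c x (hd xs)" "coloured_walk E xs ds"
      using \<open>coloured_walk E (x # xs) cs\<close> Cons \<open>xs \<noteq> []\<close> by (auto simp: walk_Cons)
    ultimately show ?thesis
      using walk_snoc[OF Cons.IH[of ds], of c x] assms(1) Cons by (simp add: last_rev)
  qed
qed simp

lemma walk_map_upto:
  assumes "a \<le> (b::int)" "\<And>i. a \<le> i \<Longrightarrow> i < b \<Longrightarrow> E (f i) (u i) (u (i + 1))"
  shows "coloured_walk E (map u [a..b]) (map f [a..b - 1])"
  using assms
proof (induction "nat (b - a)" arbitrary: a)
  case 0
  then have "a = b" by simp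
  then show ?case by simp
next
  case (Suc k)
  then have ab: "a < b" by simp
  have "coloured_walk E (map u [a+1..b]) (map f [a+1..b-1])"
    using Suc.hyps(1)[of "a+1"] Suc.hyps(2) Suc.prems ab by simp
  moreover have "[a..b] = a # [a+1..b]" "[a..b-1] = a # [a+1..b-1]" "[a+1..b] = (a+1) # [a+1+1..b]"
    using ab by (simp_all add: upto_rec1)
  ultimately show ?case using Suc.prems ab by simp
qed

lemma walk_nth:
  assumes "coloured_walk E xs cs" "i < length cs"
  shows "E (cs ! i) (xs ! i) (xs ! Suc i)"
  using assms
proof (induction E xs cs arbitrary: i rule: coloured_walk.induct)
  case (2 E x y xs c cs)
  then show ?case by (cases i) auto
qed auto

section \<open>Counting\<close>

lemma subsets_meet:
  assumes "finite T" "A \<subseteq> T" "B \<subseteq> T" "card T < card A + card B"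
  shows "\<exists>i. i \<in> A \<and> i \<in> B"
proof (rule ccontr)
  assume "\<not> ?thesis"
  then have "A \<inter> B = {}" by blast
  then have "card A + card B = card (A \<union> B)"
    using assms finite_subset by (metis card_Un_disjoint)
  also have "\<dots> \<le> card T" using assms by (intro card_mono) auto
  finally show False using assms by simp
qed

lemma hd_map_upto: "a \<le> (b::int) \<Longrightarrow> hd (map u [a..b]) = u a"
  by (simp add: upto_rec1)

lemma last_map_upto: "a \<le> (b::int) \<Longrightarrow> last (map u [a..b]) = u b"
  by (simp add: upto_rec2)

lemma upto_Nil_iff: "[a..b] = [] \<longleftrightarrow> b < (a::int)"
  by (simp add: upto.simps)

section \<open>Collections of graphs as coloured adjacency\<close>

text \<open>The relation \<open>E c\<close> is adjacency in the graph of colour \<open>c\<close>, and \<open>D\<close> is the least integer that is at least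
\<open>(n + 1) / 2\<close>.\<close>

locale graph_system =
  fixes V :: "'a set" and K :: "'c set" and E :: "'c \<Rightarrow> 'a \<Rightarrow> 'a \<Rightarrow> bool" and n D :: nat
  assumes finV: "finite V" and cardV: "card V = n" and finK: "finite K" and cardK: "Suc (card K) = n"
    and Esym: "E c a b \<Longrightarrow> E c b a" and Eirr: "\<not> E c a a" and EV: "E c a b \<Longrightarrow> a \<in> V"
    and deg: "c \<in> K \<Longrightarrow> a \<in> V \<Longrightarrow> D \<le> card {b. E c a b}"
    and D_def: "D = n div 2 + 1"
begin

lemma Esym_iff: "E c a b \<longleftrightarrow> E c b a" using Esym by blast

lemma walk_reverse: "coloured_walk E xs cs \<Longrightarrow> coloured_walk E (rev xs) (rev cs)"
  by (rule walk_rev) (rule Esym)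

lemma EV2: "E c a b \<Longrightarrow> b \<in> V" using EV Esym by blast

lemma finite_neighbours [simp]: "finite {b. E c a b}"
  using finV EV2 by (metis (mono_tags, lifting) finite_subset mem_Collect_eq subsetI)

definition joined :: "nat \<Rightarrow> 'a \<Rightarrow> 'a \<Rightarrow> bool" where
  "joined k x y \<longleftrightarrow> (\<exists>xs cs. coloured_walk E xs cs \<and> distinct xs \<and> distinct cs \<and> set xs \<subseteq> V \<and> set cs \<subseteq> K
     \<and> length xs = k \<and> hd xs = x \<and> last xs = y)"

lemma joinedI:
  assumes "coloured_walk E xs cs" "distinct xs" "distinct cs" "set xs \<subseteq> V" "set cs \<subseteq> K"
    "length xs = k" "hd xs = x" "last xs = y"
  shows "joined k x y"
  using assms unfolding joined_def by blast

lemma joined_sym: "joined k x y \<Longrightarrow> joined k y x"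
  unfolding joined_def
proof (elim exE conjE)
  fix xs cs
  assume *: "coloured_walk E xs cs" "distinct xs" "distinct cs" "set xs \<subseteq> V" "set cs \<subseteq> K"
     "length xs = k" "hd xs = x" "last xs = y"
  have "xs \<noteq> []" using walk_length[OF *(1)] by auto
  then show "\<exists>xs cs. coloured_walk E xs cs \<and> distinct xs \<and> distinct cs \<and> set xs \<subseteq> V \<and> set cs \<subseteq> K
     \<and> length xs = k \<and> hd xs = y \<and> last xs = x"
    using * by (intro exI[of _ "rev xs"] exI[of _ "rev cs"]) (auto simp: walk_reverse hd_rev last_rev)
qed

text \<open>Neighbours are counted by their index on a path or cycle; \<open>Z\<close> collects the vertices off the path.\<close>

lemma degree_via_index:
  assumes "c \<in> K" "v \<in> V" "inj_on u I" "finite I" "V \<subseteq> u ` I \<union> Z" "finite Z"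
  shows "D \<le> card {i \<in> I. E c v (u i)} + card {z \<in> Z. E c v z}"
proof -
  have "{b. E c v b} \<subseteq> u ` {i \<in> I. E c v (u i)} \<union> {z \<in> Z. E c v z}"
    using assms(5) EV2 by fastforce
  then have "card {b. E c v b} \<le> card (u ` {i \<in> I. E c v (u i)} \<union> {z \<in> Z. E c v z})"
    using assms by (intro card_mono) auto
  also have "\<dots> \<le> card (u ` {i \<in> I. E c v (u i)}) + card {z \<in> Z. E c v z}"
    by (rule card_Un_le)
  also have "card (u ` {i \<in> I. E c v (u i)}) \<le> card {i \<in> I. E c v (u i)}"
    using assms by (intro card_image_le) auto
  finally show ?thesis using deg[OF assms(1,2)] by linarith
qed

lemma degree_via_index_list:
  assumes "c \<in> K" "v \<in> V" "inj_on u I" "finite I" "V \<subseteq> u ` I \<union> set zs"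
  shows "D \<le> card {i \<in> I. E c v (u i)} + (\<Sum>z\<leftarrow>zs. of_bool (E c v z))"
proof -
  have "card {z \<in> set zs. E c v z} \<le> (\<Sum>z\<leftarrow>zs. of_bool (E c v z))"
  proof (induction zs)
    case (Cons a zs)
    have "{z \<in> set (a # zs). E c v z} \<subseteq> (if E c v a then insert a {z \<in> set zs. E c v z} else {z \<in> set zs. E c v z})"
      by auto
    then have "card {z \<in> set (a # zs). E c v z} \<le> card (if E c v a then insert a {z \<in> set zs. E c v z} else {z \<in> set zs. E c v z})"
      by (intro card_mono) auto
    also have "\<dots> \<le> of_bool (E c v a) + card {z \<in> set zs. E c v z}"
      by (auto simp: card_insert_if)
    finally show ?case using Cons by simp
  qed simp
  then show ?thesis using degree_via_index[OF assms(1-5)] by fastforce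
qed

lemma degree_bounds: "n + 1 \<le> 2 * D" "2 * D \<le> n + 2"
  unfolding D_def by auto

text \<open>Double counting of the pairs \<open>(i, z)\<close> for which \<open>z\<close> is adjacent to \<open>u i\<close> in the \<open>i\<close>-th colour: for fixed
\<open>i\<close> this is a degree in a single graph.\<close>

lemma sum_colour_degrees:
  fixes u :: "int \<Rightarrow> 'a" and f :: "int \<Rightarrow> 'c"
  assumes "finite I" "\<And>i. i \<in> I \<Longrightarrow> u i \<in> V \<and> f i \<in> K"
  shows "card I * D \<le> (\<Sum>z\<in>V. card {i \<in> I. E (f i) z (u i)})"
proof -
  have "card I * D \<le> (\<Sum>i\<in>I. card {z. E (f i) (u i) z})"
    using sum_bounded_below[of I D "\<lambda>i. card {z. E (f i) (u i) z}"] assms deg by auto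
  also have "\<dots> = (\<Sum>i\<in>I. card {z \<in> V. E (f i) z (u i)})"
  proof (rule sum.cong[OF refl])
    fix i
    have "{z. E (f i) (u i) z} = {z \<in> V. E (f i) z (u i)}" using EV2 Esym by blast
    then show "card {z. E (f i) (u i) z} = card {z \<in> V. E (f i) z (u i)}" by simp
  qed
  also have "\<dots> = (\<Sum>z\<in>V. card {i \<in> I. E (f i) z (u i)})"
    using sum_multicount_gen[of V I "\<lambda>i j. E (f j) i (u j)" "\<lambda>j. card {z \<in> V. E (f j) z (u j)}"] finV assms
    by simp
  finally show ?thesis .
qed

text \<open>Two edges of a path are exchanged: the segment between them is reversed, and both chords take the
place of the edges.  Nothing is assumed about the edges that are removed.\<close>

lemma two_exchange_less:
  fixes M a b :: int
  assumes inj: "inj_on v {1..M}" and vV: "v ` {1..M} \<subseteq> V" and ab: "1 \<le> a" "a < b" "b < M"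
    and injf: "inj_on f ({1..<M} - {a,b})" and fK: "f ` ({1..<M} - {a,b}) \<subseteq> K"
    and Ef: "\<And>i. i \<in> {1..<M} - {a,b} \<Longrightarrow> E (f i) (v i) (v (i + 1))"
    and g: "g \<in> K" "h \<in> K" "g \<noteq> h" "g \<notin> f ` ({1..<M} - {a,b})" "h \<notin> f ` ({1..<M} - {a,b})"
    and Eg: "E g (v a) (v b)" and Eh: "E h (v (a + 1)) (v (b + 1))"
  shows "joined (nat M) (v 1) (v M)"
proof (rule joinedI)
  let ?A = "map v [1..a]" and ?B = "rev (map v [a+1..b])" and ?C = "map v [b+1..M]"
  let ?fA = "map f [1..a-1]" and ?fB = "rev (map f [a+1..b-1])" and ?fC = "map f [b+1..M-1]"
  let ?xs = "?A @ ?B @ ?C" and ?cs = "?fA @ g # ?fB @ h # ?fC"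
  have hdC: "hd ?C = v (b+1)" and lastC: "last ?C = v M" and lastA: "last ?A = v a" and hdA: "hd ?A = v 1"
    and hdB: "hd ?B = v b" and lastB: "last ?B = v (a+1)"
    using ab by (simp_all only: hd_map_upto last_map_upto hd_rev last_rev)
  have nA: "?A \<noteq> []" and nB: "?B \<noteq> []" and nC: "?C \<noteq> []"
    using ab by (simp_all add: upto_Nil_iff)
  have cA: "coloured_walk E ?A ?fA" by (rule walk_map_upto; (rule Ef)?) (use ab in simp_all)
  have "coloured_walk E (map v [a+1..b]) (map f [a+1..b-1])"
    by (rule walk_map_upto; (rule Ef)?) (use ab in simp_all)
  then have cB: "coloured_walk E ?B ?fB" by (rule walk_reverse)
  have cC: "coloured_walk E ?C ?fC" by (rule walk_map_upto; (rule Ef)?) (use ab in simp_all)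
  have "coloured_walk E (?B @ ?C) (?fB @ h # ?fC)"
    by (rule walk_append[OF cB cC]) (simp only: lastB hdC Eh)
  then show "coloured_walk E ?xs ?cs"
    by (rule walk_append[OF cA]) (simp only: hd_append2[OF nB] lastA hdB Eg)
  have "?xs = map v ([1..a] @ rev [a+1..b] @ [b+1..M])" by (simp add: rev_map)
  moreover have "distinct ([1..a] @ rev [a+1..b] @ [b+1..M])" using ab by (simp, force)
  moreover have "set ([1..a] @ rev [a+1..b] @ [b+1..M]) = {1..M}" using ab by auto
  ultimately show "distinct ?xs" "set ?xs \<subseteq> V"
    using inj vV by (simp_all only: distinct_map set_map)
  let ?I = "[1..a-1] @ rev [a+1..b-1] @ [b+1..M-1]"
  have I: "set ?I = {1..<M} - {a,b}" using ab by auto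
  have "distinct ?I" using ab by (simp, force)
  then have dI: "distinct (map f ?I)" using injf I by (simp only: distinct_map)
  have sI: "set (map f ?I) = f ` ({1..<M} - {a,b})" by (simp only: set_map I)
  have mI: "map f ?I = ?fA @ ?fB @ ?fC" by (simp add: rev_map)
  have "set ?cs = {g,h} \<union> set (map f ?I)" unfolding mI by auto
  then show "set ?cs \<subseteq> K" using g fK sI by simp
  have "distinct (g # h # map f ?I)" using dI g by (simp only: distinct.simps sI set_simps) simp
  then show "distinct ?cs" unfolding mI by auto
  show "length ?xs = nat M" using ab by simp
  show "hd ?xs = v 1" by (simp only: hd_append2[OF nA] hdA)
  show "last ?xs = v M" using nC by (simp only: last_appendR nC lastC append_is_Nil_conv simp_thms)
qed

lemma two_exchange:
  fixes M a b :: int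
  assumes inj: "inj_on v {1..M}" and vV: "v ` {1..M} \<subseteq> V" and ab: "a \<in> {1..<M}" "b \<in> {1..<M}" "a \<noteq> b"
    and injf: "inj_on f ({1..<M} - {a,b})" and fK: "f ` ({1..<M} - {a,b}) \<subseteq> K"
    and Ef: "\<And>i. i \<in> {1..<M} - {a,b} \<Longrightarrow> E (f i) (v i) (v (i + 1))"
    and g: "g \<in> K" "h \<in> K" "g \<noteq> h" "g \<notin> f ` ({1..<M} - {a,b})" "h \<notin> f ` ({1..<M} - {a,b})"
    and Eg: "E g (v a) (v b)" and Eh: "E h (v (a + 1)) (v (b + 1))"
  shows "joined (nat M) (v 1) (v M)"
proof (cases "a < b")
  case True
  show ?thesis
    by (rule two_exchange_less[OF inj vV _ True _ injf fK Ef g Eg Eh]) (use ab in simp_all)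
next
  case False
  have c: "{1..<M} - {a,b} = {1..<M} - {b,a}" by auto
  show ?thesis
    by (rule two_exchange_less[OF inj vV _ _ _ injf[unfolded c] fK[unfolded c] Ef[unfolded c]
        g[unfolded c] Esym[OF Eg] Esym[OF Eh]]) (use ab False in simp_all)
qed

end

section \<open>From n - 1 to n vertices\<close>

text \<open>A sequence indexed by \<open>1, 2, \<dots>\<close> with a new entry in position \<open>l + 1\<close>.\<close>

definition insert_at :: "int \<Rightarrow> 'b \<Rightarrow> (int \<Rightarrow> 'b) \<Rightarrow> int \<Rightarrow> 'b" where
  "insert_at l w v i = (if i \<le> l then v i else if i = l + 1 then w else v (i - 1))"

lemma insert_at_inj:
  assumes "inj_on v {1..M}" "w \<notin> v ` {1..M}" "0 \<le> l" "l \<le> M"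
  shows "inj_on (insert_at l w v) {1..M + 1}"
proof (rule inj_onI)
  fix i j assume *: "i \<in> {1..M + 1}" "j \<in> {1..M + 1}" "insert_at l w v i = insert_at l w v j"
  have e: "\<And>i j. i \<in> {1..M} \<Longrightarrow> j \<in> {1..M} \<Longrightarrow> v i = v j \<Longrightarrow> i = j"
    using assms(1) by (auto dest: inj_onD)
  have w: "\<And>i. i \<in> {1..M} \<Longrightarrow> v i \<noteq> w" using assms(2) by blast
  consider "i \<le> l" | "i = l + 1" | "i > l + 1" by linarith
  then show "i = j"
  proof cases
    case 1
    then show ?thesis using * e[of i j] e[of i "j - 1"] w[of i] assms(3,4) by (auto simp: insert_at_def split: if_splits)
  next
    case 2
    then show ?thesis using * w[of j] w[of "j - 1"] assms(3,4) by (auto simp: insert_at_def split: if_splits)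
  next
    case 3
    then show ?thesis using * e[of "i - 1" j] e[of "i - 1" "j - 1"] w[of "i - 1"] assms(3,4)
      by (auto simp: insert_at_def split: if_splits)
  qed
qed

lemma insert_at_image:
  assumes "0 \<le> l" "l \<le> M" "w \<in> S" "v ` {1..M} \<subseteq> S"
  shows "insert_at l w v ` {1..M + 1} \<subseteq> S"
proof
  fix z assume "z \<in> insert_at l w v ` {1..M + 1}"
  then obtain i where i: "i \<in> {1..M + 1}" "z = insert_at l w v i" by blast
  have m: "v j \<in> S" if "j \<in> {1..M}" for j using assms(4) that by blast
  show "z \<in> S"
    using m[of i] m[of "i - 1"] i assms(1-3) by (auto simp: insert_at_def)
qed

context graph_system
begin

lemma joined_of_fun:
  assumes "1 \<le> M" "inj_on v {1..M}" "v ` {1..M} \<subseteq> V" "inj_on f {1..<M}" "f ` {1..<M} \<subseteq> K"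
    "\<And>i. i \<in> {1..<M} \<Longrightarrow> E (f i) (v i) (v (i + 1))"
  shows "joined (nat M) (v 1) (v M)"
proof (rule joinedI)
  show "coloured_walk E (map v [1..M]) (map f [1..M - 1])"
    by (rule walk_map_upto; (rule assms(6))?) (use assms(1) in simp_all)
  have e: "{1..M - 1} = {1..<M}" by auto
  show "distinct (map v [1..M])" "distinct (map f [1..M - 1])"
    using assms(2,4) e by (simp_all add: distinct_map)
  show "set (map v [1..M]) \<subseteq> V" "set (map f [1..M - 1]) \<subseteq> K" "length (map v [1..M]) = nat M"
    using assms(1,3,5) e by simp_all
  show "hd (map v [1..M]) = v 1" "last (map v [1..M]) = v M"
    using assms(1) by (simp_all only: hd_map_upto last_map_upto)
qed

lemma joined_indexed:
  assumes "joined k x y"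
  obtains v f where "inj_on v {1..int k}" "v ` {1..int k} \<subseteq> V" "inj_on f {1..<int k}" "f ` {1..<int k} \<subseteq> K"
    "\<And>i. i \<in> {1..<int k} \<Longrightarrow> E (f i) (v i) (v (i + 1))" "v 1 = x" "v (int k) = y" "1 \<le> k"
proof -
  obtain xs cs where *: "coloured_walk E xs cs" "distinct xs" "distinct cs" "set xs \<subseteq> V" "set cs \<subseteq> K"
    "length xs = k" "hd xs = x" "last xs = y" using assms unfolding joined_def by blast
  have l: "k = Suc (length cs)" using walk_length[OF *(1)] *(6) by simp
  show thesis
  proof (rule that[of "\<lambda>i. xs ! nat (i - 1)" "\<lambda>i. cs ! nat (i - 1)"])
    show "inj_on (\<lambda>i. xs ! nat (i - 1)) {1..int k}" "inj_on (\<lambda>i. cs ! nat (i - 1)) {1..<int k}"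
      using *(2,3,6) l by (auto intro!: inj_onI simp: nth_eq_iff_index_eq)
    have "xs ! nat (i - 1) \<in> V" if "i \<in> {1..int k}" for i
      using *(4) that *(6) by (intro subsetD[OF *(4)] nth_mem) auto
    then show "(\<lambda>i. xs ! nat (i - 1)) ` {1..int k} \<subseteq> V" by blast
    have "cs ! nat (i - 1) \<in> K" if "i \<in> {1..<int k}" for i
      using that l by (intro subsetD[OF *(5)] nth_mem) auto
    then show "(\<lambda>i. cs ! nat (i - 1)) ` {1..<int k} \<subseteq> K" by blast
    show "E (cs ! nat (i - 1)) (xs ! nat (i - 1)) (xs ! nat (i + 1 - 1))" if "i \<in> {1..<int k}" for i
    proof -
      have "nat (i + 1 - 1) = Suc (nat (i - 1))" using that by auto
      then show ?thesis using walk_nth[OF *(1), of "nat (i - 1)"] that l by auto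
    qed
    have "xs \<noteq> []" using l *(6) by auto
    moreover have "nat (int k - 1) = k - 1" using l by simp
    ultimately show "xs ! nat (1 - 1) = x" "xs ! nat (int k - 1) = y"
      using *(6,7,8) by (simp_all add: hd_conv_nth last_conv_nth)
    show "1 \<le> k" using l by simp
  qed
qed

text \<open>Here \<open>f\<close> colours all places of the sequence, and the two exchanged places lend their colours to the two
chords, in either order.\<close>

lemma two_exchange_colouring:
  fixes M a b :: int
  assumes inj: "inj_on v {1..M}" and vV: "v ` {1..M} \<subseteq> V" and ab: "a \<in> {1..<M}" "b \<in> {1..<M}" "a \<noteq> b"
    and injf: "inj_on f {1..<M}" and fK: "f ` {1..<M} \<subseteq> K"
    and Ef: "\<And>i. i \<in> {1..<M} \<Longrightarrow> i \<noteq> a \<Longrightarrow> i \<noteq> b \<Longrightarrow> E (f i) (v i) (v (i + 1))"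
    and Eg: "E (f a) (v a) (v b) \<and> E (f b) (v (a + 1)) (v (b + 1)) \<or> E (f b) (v a) (v b) \<and> E (f a) (v (a + 1)) (v (b + 1))"
  shows "joined (nat M) (v 1) (v M)"
proof -
  have s: "{1..<M} - {a,b} \<subseteq> {1..<M}" by auto
  have i: "inj_on f ({1..<M} - {a,b})" using inj_on_subset[OF injf s] .
  have k: "f ` ({1..<M} - {a,b}) \<subseteq> K" "f a \<in> K" "f b \<in> K" using fK ab by auto
  have n: "f a \<noteq> f b" using injf ab by (auto dest: inj_onD)
  have o: "f a \<notin> f ` ({1..<M} - {a,b})" "f b \<notin> f ` ({1..<M} - {a,b})"
    using injf ab by (auto dest: inj_onD)
  have E': "\<And>i. i \<in> {1..<M} - {a,b} \<Longrightarrow> E (f i) (v i) (v (i + 1))" using Ef by simp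
  from Eg show ?thesis
  proof
    assume "E (f a) (v a) (v b) \<and> E (f b) (v (a + 1)) (v (b + 1))"
    then show ?thesis
      using two_exchange[OF inj vV ab i k(1) E' k(2,3) n o] by blast
  next
    assume "E (f b) (v a) (v b) \<and> E (f a) (v (a + 1)) (v (b + 1))"
    then show ?thesis
      using two_exchange[OF inj vV ab i k(1) E' k(3,2) n[symmetric] o(2,1)] by blast
  qed
qed

text \<open>Insertion of a missing vertex after position \<open>l\<close> together with an exchange of the places \<open>a\<close> and \<open>b\<close>
of the longer sequence.\<close>

lemma insert_two_exchange:
  fixes N l a b :: int
  assumes inj: "inj_on v {1..N + 1}" and vV: "v ` {1..N + 1} \<subseteq> V" and w: "w \<in> V" "w \<notin> v ` {1..N + 1}"
    and lab: "l \<in> {1..N}" "a \<in> {1..N + 1}" "b \<in> {1..N + 1}" "a \<noteq> b"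
    and G: "inj_on G {1..N}" "G ` {1..N} \<subseteq> K" "d \<in> K" "d \<notin> G ` {1..N}"
    and EG: "\<And>i. i \<in> {1..N + 1} \<Longrightarrow> i \<noteq> a \<Longrightarrow> i \<noteq> b \<Longrightarrow> E (insert_at l d G i) (insert_at l w v i) (insert_at l w v (i + 1))"
    and Eab: "E (insert_at l d G a) (insert_at l w v a) (insert_at l w v b) \<and> E (insert_at l d G b) (insert_at l w v (a + 1)) (insert_at l w v (b + 1))
       \<or> E (insert_at l d G b) (insert_at l w v a) (insert_at l w v b) \<and> E (insert_at l d G a) (insert_at l w v (a + 1)) (insert_at l w v (b + 1))"
  shows "joined (nat (N + 2)) (v 1) (v (N + 1))"
proof -
  have e: "{1..<N + 2} = {1..N + 1}" "{1..N + 2} = {1..(N + 1) + 1}" by auto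
  have l: "0 \<le> l" "l \<le> N + 1" "l \<le> N" using lab by auto
  have v': "inj_on (insert_at l w v) {1..N + 2}" "insert_at l w v ` {1..N + 2} \<subseteq> V"
    unfolding e by (rule insert_at_inj[OF inj w(2) l(1,2)], rule insert_at_image[OF l(1,2) w(1) vV])
  have G': "inj_on (insert_at l d G) {1..<N + 2}" "insert_at l d G ` {1..<N + 2} \<subseteq> K"
    unfolding e by (rule insert_at_inj[OF G(1,4) l(1,3)], rule insert_at_image[OF l(1,3) G(3,2)])
  have 1: "insert_at l w v 1 = v 1" "insert_at l w v (N + 2) = v (N + 1)" using lab by (auto simp: insert_at_def add.commute)
  have "joined (nat (N + 2)) (insert_at l w v 1) (insert_at l w v (N + 2))"
    by (rule two_exchange_colouring[OF v' _ _ lab(4) G' EG Eab]) (use lab in \<open>auto simp: e\<close>)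
  then show ?thesis unfolding 1 .
qed

text \<open>Let \<open>v\<close> be the path, \<open>w\<close> the missing vertex and \<open>c\<close> the missing colour, and let \<open>R z\<close> be the set of indices \<open>i\<close>
such that \<open>z\<close> is adjacent to \<open>v i\<close> in the colour of the edge leaving \<open>v i\<close>.  If there is no path on \<open>n\<close>
vertices, then \<open>R z\<close> is small for \<open>z = w\<close>, and also for the predecessor on the path of every neighbour
of \<open>w\<close> in colour \<open>c\<close>.  Since the sum of all \<open>R z\<close> is large, some other \<open>v j\<close> has a large \<open>R (v j)\<close>.
Now \<open>w\<close> is inserted elsewhere at the price of the colour of the edge leaving \<open>v j\<close>.  This leaves a
sequence through all vertices that is broken only after \<open>v j\<close>, and the many chords at \<open>v j\<close> repair it.\<close>

lemma extend_to_hamilton: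
  assumes n: "4 \<le> n" and j: "joined (n - 1) x y"
  shows "joined n x y"
proof (rule ccontr)
  assume nj: "\<not> joined n x y"
  define N where "N = int n - 2"
  have k: "int (n - 1) = N + 1" and N: "2 \<le> N" and nN: "nat (N + 2) = n" "nat N = n - 2" using n by (auto simp: N_def)
  have e: "{1..<N + 1} = {1..N}" by auto
  obtain v f where v: "inj_on v {1..N + 1}" "v ` {1..N + 1} \<subseteq> V" and f: "inj_on f {1..N}" "f ` {1..N} \<subseteq> K"
    and Ef: "\<And>i. i \<in> {1..N} \<Longrightarrow> E (f i) (v i) (v (i + 1))" and xy: "v 1 = x" "v (N + 1) = y"
    using joined_indexed[OF j] unfolding k e by metis
  have cv: "card (v ` {1..N + 1}) = n - 1" and cf: "card (f ` {1..N}) = n - 2"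
    using card_image[OF v(1)] card_image[OF f(1)] k nN by auto
  have "card (V - v ` {1..N + 1}) = 1"
    using card_Diff_subset[of "v ` {1..N + 1}" V] v(2) finV cv cardV n by simp
  then obtain w where w: "V - v ` {1..N + 1} = {w}" by (auto simp: card_1_singleton_iff)
  have "card (K - f ` {1..N}) = 1"
    using card_Diff_subset[of "f ` {1..N}" K] f(2) finK cf cardK n by simp
  then obtain c where c: "K - f ` {1..N} = {c}" by (auto simp: card_1_singleton_iff)
  have wV: "w \<in> V" "w \<notin> v ` {1..N + 1}" and cK: "c \<in> K" "c \<notin> f ` {1..N}" using w c by auto
  have Vw: "V = insert w (v ` {1..N + 1})" using w v by auto
  have vV: "v i \<in> V" if "i \<in> {1..N + 1}" for i using v(2) that by auto
  have fK: "f i \<in> K" if "i \<in> {1..N}" for i using f(2) that by auto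
  have finj: "f i = f j \<longleftrightarrow> i = j" if "i \<in> {1..N}" "j \<in> {1..N}" for i j
    using f(1) that by (auto dest: inj_onD)
  have fc: "f i \<noteq> c" if "i \<in> {1..N}" for i using cK that by auto
  have d2: "D \<le> card {i \<in> {1..N}. E q z (v (i + 1))} + of_bool (E q z (v 1)) + of_bool (E q z w)"
    if "q \<in> K" "z \<in> V" for q z
  proof -
    have "V \<subseteq> (\<lambda>i. v (i + 1)) ` {1..N} \<union> set [v 1, w]"
    proof
      fix z assume "z \<in> V"
      then consider "z = w" | i where "i \<in> {1..N + 1}" "z = v i" unfolding Vw by blast
      then show "z \<in> (\<lambda>i. v (i + 1)) ` {1..N} \<union> set [v 1, w]"
      proof cases
        case (2 i)
        then show ?thesis by (cases "i = 1") (auto intro!: image_eqI[of _ _ "i - 1"])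
      qed simp
    qed
    moreover have "inj_on (\<lambda>i. v (i + 1)) {1..N}"
      using v(1) by (intro inj_onI) (drule inj_onD, assumption, auto)
    ultimately show ?thesis using degree_via_index_list[OF that, of "\<lambda>i. v (i + 1)" "{1..N}" "[v 1, w]"] by simp
  qed
  have d1: "D \<le> card {i \<in> {1..N}. E q z (v i)} + of_bool (E q z (v (N + 1))) + of_bool (E q z w)"
    if "q \<in> K" "z \<in> V" for q z
  proof -
    have "{1..N + 1} = insert (N + 1) {1..N}" using N by auto
    then have "V \<subseteq> v ` {1..N} \<union> set [v (N + 1), w]" unfolding Vw by auto
    moreover have "inj_on v {1..N}" using inj_on_subset[OF v(1), of "{1..N}"] by auto
    ultimately show ?thesis using degree_via_index_list[OF that, of v "{1..N}" "[v (N + 1), w]"] by simp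
  qed
  define R where "R z = {l \<in> {1..N}. E (f l) z (v l)}" for z
  have Rsub: "R z \<subseteq> {1..N}" for z unfolding R_def by auto
  have cR: "card (R z) \<le> n - 2" for z using card_mono[OF _ Rsub[of z]] nN by simp
  define C where "C q = {i \<in> {1..N}. E q w (v (i + 1))}" for q
  have Csub: "C q \<subseteq> {1..N}" for q unfolding C_def by auto
  have cC: "D \<le> card (C q) + 1" if "q \<in> K" for q
    using d2[OF that wV(1)] Eirr[of q w] unfolding C_def by (auto simp: of_bool_def split: if_splits)
  \<comment> \<open>Otherwise \<open>w\<close> could be inserted into a single edge of the path.\<close>
  have Rw: "card (R w) + card (C c) \<le> n - 2"
  proof (rule ccontr)
    assume "\<not> ?thesis"
    then obtain l where l: "l \<in> R w" "l \<in> C c"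
      using subsets_meet[of "{1..N}" "R w" "C c"] Rsub Csub nN by force
    then have lN: "l \<in> {1..N}" and El: "E (f l) w (v l)" "E c w (v (l + 1))" unfolding R_def C_def by auto
    have "joined (nat (N + 2)) (insert_at l w v 1) (insert_at l w v (N + 2))"
    proof (rule joined_of_fun)
      have l': "0 \<le> l" "l \<le> N + 1" "l \<le> N" using lN by auto
      have e2: "{1..N + 2} = {1..(N + 1) + 1}" "{1..<N + 2} = {1..N + 1}" by auto
      show "inj_on (insert_at l w v) {1..N + 2}" "insert_at l w v ` {1..N + 2} \<subseteq> V"
        unfolding e2 by (rule insert_at_inj[OF v(1) wV(2) l'(1,2)], rule insert_at_image[OF l'(1,2) wV(1) v(2)])
      show "inj_on (insert_at l c f) {1..<N + 2}" "insert_at l c f ` {1..<N + 2} \<subseteq> K"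
        unfolding e2 by (rule insert_at_inj[OF f(1) cK(2) l'(1,3)], rule insert_at_image[OF l'(1,3) cK(1) f(2)])
      show "E (insert_at l c f i) (insert_at l w v i) (insert_at l w v (i + 1))" if "i \<in> {1..<N + 2}" for i
        using that lN El Ef[of i] Ef[of "i - 1"] Esym[OF El(1)] by (auto simp: insert_at_def)
    qed (use N in simp)
    then show False using nj lN nN xy by (auto simp: insert_at_def add.commute)
  qed
  \<comment> \<open>A chord at \<open>v j\<close> reverses a segment of the path, and \<open>w\<close> then fits between its end and \<open>v (j + 1)\<close>.\<close>
  have RB: "card (R (v j)) + card (C q') \<le> n - 2"
    if j: "j \<in> {1..N}" and q: "{q, q'} = {c, f j}" and Eq: "E q w (v (j + 1))" for j q q'
  proof (rule ccontr)
    assume "\<not> ?thesis"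
    then obtain i where i: "i \<in> R (v j)" "i \<in> C q'"
      using subsets_meet[of "{1..N}" "R (v j)" "C q'"] Rsub Csub nN by force
    then have iN: "i \<in> {1..N}" and Ei: "E (f i) (v j) (v i)" "E q' w (v (i + 1))" unfolding R_def C_def by auto
    have ij: "i \<noteq> j" using Ei(1) Eirr by blast
    \<comment> \<open>In the new path, the edge entering \<open>w\<close> has colour \<open>h\<close> and the edge leaving it has colour \<open>d\<close>.\<close>
    define l where "l = max i j"
    define h where "h = (if i < j then q' else q)"
    define d where "d = (if i < j then q else q')"
    have hd: "{h, d} = {c, f j}" using q unfolding h_def d_def by auto
    have fjc: "f j \<noteq> c" using fc j by blast
    have hdn: "h \<noteq> d" using hd fjc by (auto simp: doubleton_eq_iff)
    have hK: "h \<in> K" "d \<in> K" using hd cK fK[OF j] by (auto simp: doubleton_eq_iff)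
    have hd_out: "k \<in> {1..N} \<Longrightarrow> k \<noteq> j \<Longrightarrow> f k \<noteq> h \<and> f k \<noteq> d" for k
      using hd fc[of k] finj[of k j] j by (auto simp: doubleton_eq_iff)
    have "joined (nat (N + 2)) (v 1) (v (N + 1))"
    proof (rule insert_two_exchange[OF v wV, where l = l and a = i and b = j and G = "f(j := h)" and d = d])
      show "l \<in> {1..N}" "i \<in> {1..N + 1}" "j \<in> {1..N + 1}" "i \<noteq> j" using iN j ij by (auto simp: l_def)
      show "inj_on (f(j := h)) {1..N}"
      proof (rule inj_onI)
        fix a b assume "a \<in> {1..N}" "b \<in> {1..N}" "(f(j := h)) a = (f(j := h)) b"
        then show "a = b" using hd_out[of a] hd_out[of b] finj[of a b] by (auto split: if_splits)
      qed
      show "(f(j := h)) ` {1..N} \<subseteq> K" using f(2) hK(1) by auto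
      show "d \<in> K" by fact
      show "d \<notin> (f(j := h)) ` {1..N}" 
      proof
        assume "d \<in> (f(j := h)) ` {1..N}"
        then obtain a where "a \<in> {1..N}" "d = (f(j := h)) a" by blast
        then show False using hd_out[of a] hdn by (auto split: if_splits)
      qed
      show "E (insert_at l d (f(j := h)) k) (insert_at l w v k) (insert_at l w v (k + 1))"
        if "k \<in> {1..N + 1}" "k \<noteq> i" "k \<noteq> j" for k
      proof -
        have "k \<noteq> l" using \<open>k \<noteq> i\<close> \<open>k \<noteq> j\<close> by (auto simp: l_def max_def)
        then consider "k < l" | "k = l + 1" | "k > l + 1" by linarith
        then show ?thesis
        proof cases
          case 1
          then show ?thesis using that Ef[of k] iN j unfolding insert_at_def l_def by auto
        next
          case 2
          have "insert_at l d (f(j := h)) k = d" "insert_at l w v k = w" using 2 by (simp_all add: insert_at_def)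
          moreover have "insert_at l w v (k + 1) = v (l + 1)" using 2 by (simp add: insert_at_def add.commute)
          moreover have "E d w (v (l + 1))"
            using Ei(2) Eq ij unfolding d_def l_def by (cases "i < j") simp_all
          ultimately show ?thesis by simp
        next
          case 3
          then show ?thesis using that Ef[of "k - 1"] iN j by (auto simp: insert_at_def l_def)
        qed
      qed
      have "E (f i) (v i) (v j)" using Esym[OF Ei(1)] .
      moreover have "i < j \<Longrightarrow> E h (v (i + 1)) w" "j < i \<Longrightarrow> E h w (v (j + 1))"
        using Esym[OF Ei(2)] Eq by (auto simp: h_def)
      ultimately show "E (insert_at l d (f(j := h)) i) (insert_at l w v i) (insert_at l w v j) \<and>
          E (insert_at l d (f(j := h)) j) (insert_at l w v (i + 1)) (insert_at l w v (j + 1)) \<or>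
          E (insert_at l d (f(j := h)) j) (insert_at l w v i) (insert_at l w v j) \<and>
          E (insert_at l d (f(j := h)) i) (insert_at l w v (i + 1)) (insert_at l w v (j + 1))"
        using ij by (cases "i < j") (auto simp: insert_at_def l_def)
    qed
    then show False using nj xy nN by simp
  qed
  \<comment> \<open>By averaging, since \<open>w\<close> and the predecessors of its neighbours lie below the average.\<close>
  have "\<exists>j\<in>{1..N}. n - D + 1 \<le> card (R (v j))"
  proof (rule ccontr)
    assume "\<not> ?thesis"
    then have small: "card (R (v j)) \<le> n - D" if "j \<in> {1..N}" for j using that by force
    have b: "card (R (v j)) + of_bool (E c w (v (j + 1))) \<le> n - D" if "j \<in> {1..N}" for j
    proof (cases "E c w (v (j + 1))")
      case True
      have "card (R (v j)) + card (C (f j)) \<le> n - 2" by (rule RB[OF that _ True]) auto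
      then show ?thesis using True cC[OF fK[OF that]] degree_bounds n by simp
    qed (use small[OF that] in simp)
    have "(\<Sum>j\<in>{1..N}. card (R (v j)) + of_bool (E c w (v (j + 1)))) \<le> (n - 2) * (n - D)"
      using sum_bounded_above[of "{1..N}" "\<lambda>j. card (R (v j)) + of_bool (E c w (v (j + 1)))" "n - D"] b nN by simp
    moreover have "(\<Sum>j\<in>{1..N}. of_bool (E c w (v (j + 1)))) = card (C c)"
      unfolding C_def by (subst sum_of_bool_eq) (auto intro!: arg_cong[of _ _ card])
    ultimately have 1: "(\<Sum>j\<in>{1..N}. card (R (v j))) + card (C c) \<le> (n - 2) * (n - D)"
      by (simp add: sum.distrib)
    have "(n - 2) * D \<le> (\<Sum>z\<in>V. card (R z))"
      using sum_colour_degrees[of "{1..N}" v f] vV fK nN unfolding R_def by auto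
    also have "V = insert w (insert (v (N + 1)) (v ` {1..N}))"
    proof -
      have "{1..N + 1} = insert (N + 1) {1..N}" using N by auto
      then show ?thesis unfolding Vw by simp
    qed
    also have "(\<Sum>z\<in>\<dots>. card (R z)) = card (R w) + (card (R (v (N + 1))) + (\<Sum>z\<in>v ` {1..N}. card (R z)))"
    proof -
      have "w \<notin> insert (v (N + 1)) (v ` {1..N})" using wV N by auto
      moreover have "v (N + 1) \<notin> v ` {1..N}" using v(1) N by (auto dest: inj_onD)
      ultimately show ?thesis by simp
    qed
    also have "(\<Sum>z\<in>v ` {1..N}. card (R z)) = (\<Sum>j\<in>{1..N}. card (R (v j)))"
      using sum.reindex[of v "{1..N}" "\<lambda>z. card (R z)"] inj_on_subset[OF v(1), of "{1..N}"] by auto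
    finally have 2: "(n - 2) * D \<le> card (R w) + (card (R (v (N + 1))) + (\<Sum>j\<in>{1..N}. card (R (v j))))" .
    have "(n - 2) * (n - D + 1) \<le> (n - 2) * D" using degree_bounds n by (intro mult_le_mono2) auto
    then have "(n - 2) * (n - D) + (n - 2) \<le> (n - 2) * D" by (simp only: add_mult_distrib2 mult_1_right)
    then show False using 1 2 Rw cR[of "v (N + 1)"] cC[OF cK(1)] degree_bounds n by linarith
  qed
  then obtain j where j: "j \<in> {1..N}" and Rj: "n - D + 1 \<le> card (R (v j))" by blast
  have "\<not> E c w (v (j + 1))"
    using RB[OF j, of c "f j"] cC[OF fK[OF j]] Rj degree_bounds n by auto
  moreover have "\<not> E (f j) w (v (j + 1))"
    using RB[OF j, of "f j" c] cC[OF cK(1)] Rj degree_bounds n by (auto simp: insert_commute)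
  ultimately have nE: "\<not> E c w (v (j + 1))" "\<not> E (f j) w (v (j + 1))" .
  \<comment> \<open>Insert \<open>w\<close> after \<open>v l\<close>, with the colour of the edge leaving \<open>v j\<close> on its second edge.\<close>
  obtain l where l: "l \<in> {1..N}" "l \<noteq> j" and El: "E c w (v l)" "E (f j) w (v (l + 1))"
  proof -
    let ?A = "{l \<in> {1..N}. E c w (v l)} - {j}"
    have "D \<le> card {l \<in> {1..N}. E c w (v l)} + 1"
      using d1[OF cK(1) wV(1)] Eirr[of c w] by (auto simp: of_bool_def split: if_splits)
    then have "D \<le> card ?A + 2" using card_Diff1_le[of "{l \<in> {1..N}. E c w (v l)}" j]
      by (cases "j \<in> {l \<in> {1..N}. E c w (v l)}") (auto simp: card_Diff_singleton_if)
    moreover have "C (f j) \<subseteq> {1..N} - {j}" using nE unfolding C_def by auto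
    moreover have "card ({1..N} - {j}) = n - 3" using j nN by simp
    ultimately have "\<exists>l. l \<in> ?A \<and> l \<in> C (f j)"
      using subsets_meet[of "{1..N} - {j}" ?A "C (f j)"] cC[OF fK[OF j]] degree_bounds n by force
    then show thesis using that unfolding C_def by auto
  qed
  have fl: "f l \<in> K" "v (j + 1) \<in> V" using l j fK vV by auto
  \<comment> \<open>The colour of the edge leaving \<open>v l\<close> is free now, and the edge leaving \<open>v j\<close> is to be exchanged.\<close>
  obtain i where i: "i \<in> {1..N}" "i \<noteq> j" "i \<noteq> l" and Ei: "E (f i) (v j) (v i)" "E (f l) (v (j + 1)) (v (i + 1))"
  proof -
    have "j \<notin> R (v j)" using Eirr by (auto simp: R_def)
    then have 1: "n - D \<le> card (R (v j) - {l})" "R (v j) - {l} \<subseteq> {1..N} - {j, l}"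
      using Rj Rsub[of "v j"] by (auto simp: card_Diff_singleton_if)
    let ?B = "{i \<in> {1..N}. E (f l) (v (j + 1)) (v (i + 1))}"
    have "D \<le> card ?B + 2" using d2[OF fl] by (auto simp: of_bool_def split: if_splits)
    then have "D \<le> card (?B - {l}) + 3"
      by (cases "l \<in> ?B") (auto simp: card_Diff_singleton_if)
    moreover have "?B - {l} \<subseteq> {1..N} - {j, l}" using Eirr by auto
    moreover have "card ({1..N} - {j, l}) = n - 4"
      using j l nN card_Diff_subset[of "{j,l}" "{1..N}"] by simp
    moreover have "n - 4 < card (R (v j) - {l}) + card (?B - {l})"
      using 1 calculation(1) degree_bounds n by linarith
    ultimately have "\<exists>i. i \<in> R (v j) - {l} \<and> i \<in> ?B - {l}"
      using subsets_meet[of "{1..N} - {j, l}" "R (v j) - {l}" "?B - {l}"] 1 by simp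
    then show thesis using that \<open>j \<notin> R (v j)\<close> Rsub unfolding R_def by auto
  qed
  define s where "s k = (if k \<le> l then k else k + 1)" for k
  have "joined (nat (N + 2)) (v 1) (v (N + 1))"
  proof (rule insert_two_exchange[OF v wV, where l = l and a = "s i" and b = "s j" and G = "f(l := c, j := f l)" and d = "f j"])
    show "l \<in> {1..N}" "s i \<in> {1..N + 1}" "s j \<in> {1..N + 1}" "s i \<noteq> s j" using i j l by (auto simp: s_def)
    show "inj_on (f(l := c, j := f l)) {1..N}"
    proof (rule inj_onI)
      fix a b assume "a \<in> {1..N}" "b \<in> {1..N}" "(f(l := c, j := f l)) a = (f(l := c, j := f l)) b"
      then show "a = b"
        using fc[of a] fc[of b] fc[OF l(1)] finj[of a b] finj[of l a] finj[of l b] l by (auto split: if_splits)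
    qed
    show "(f(l := c, j := f l)) ` {1..N} \<subseteq> K" using fK cK l by auto
    show "f j \<in> K" using fK j .
    show "f j \<notin> (f(l := c, j := f l)) ` {1..N}"
    proof
      assume "f j \<in> (f(l := c, j := f l)) ` {1..N}"
      then obtain a where "a \<in> {1..N}" "f j = (f(l := c, j := f l)) a" by blast
      then show False using fc[OF j] finj[of j a] finj[of j l] l j by (auto split: if_splits)
    qed
    have ss: "insert_at l w v (s k) = v k" "insert_at l w v (s k + 1) = v (k + 1)" "insert_at l (f j) (f(l := c, j := f l)) (s k) = (f(l := c, j := f l)) k" if "k \<noteq> l" for k
      using that by (auto simp: insert_at_def s_def)
    have "E (f i) (v i) (v j)" "E (f l) (v (i + 1)) (v (j + 1))" using Esym Ei by blast+
    then show "E (insert_at l (f j) (f(l := c, j := f l)) (s i)) (insert_at l w v (s i)) (insert_at l w v (s j)) \<and>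
        E (insert_at l (f j) (f(l := c, j := f l)) (s j)) (insert_at l w v (s i + 1)) (insert_at l w v (s j + 1)) \<or>
        E (insert_at l (f j) (f(l := c, j := f l)) (s j)) (insert_at l w v (s i)) (insert_at l w v (s j)) \<and>
        E (insert_at l (f j) (f(l := c, j := f l)) (s i)) (insert_at l w v (s i + 1)) (insert_at l w v (s j + 1))"
      unfolding ss[OF i(3)] ss[OF l(2)[symmetric]] using i l by auto
    show "E (insert_at l (f j) (f(l := c, j := f l)) k) (insert_at l w v k) (insert_at l w v (k + 1))"
      if k: "k \<in> {1..N + 1}" "k \<noteq> s i" "k \<noteq> s j" for k
    proof -
      consider "k < l" | "k = l" | "k = l + 1" | "k > l + 1" by linarith
      then show ?thesis
      proof cases
        case 1
        then show ?thesis using k Ef[of k] l by (auto simp: insert_at_def s_def)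
      next
        case 2
        then show ?thesis using Esym[OF El(1)] l(2) by (auto simp: insert_at_def)
      next
        case 3
        then show ?thesis using El(2) by (auto simp: insert_at_def add.commute)
      next
        case 4
        then show ?thesis using k Ef[of "k - 1"] l by (auto simp: insert_at_def s_def)
      qed
    qed
  qed
  then show False using nj xy nN by simp
qed

end

section \<open>Rainbow paths and cycles as periodic sequences\<close>

lemma down_closed_interval:
  fixes M :: int
  assumes "A \<subseteq> {1..M}" "\<And>i. i \<in> A \<Longrightarrow> 2 \<le> i \<Longrightarrow> i - 1 \<in> A"
  shows "A = {1..int (card A)}"
proof (cases "A = {}")
  case False
  have fin: "finite A" using assms(1) finite_subset by blast
  define b where "b = Max A"
  have b: "b \<in> A" "\<And>i. i \<in> A \<Longrightarrow> i \<le> b" using Max_in[OF fin False] Max_ge[OF fin] by (auto simp: b_def)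
  have down: "b - int k \<in> A" if "int k < b" for k
    using that
  proof (induction k)
    case (Suc k)
    then show ?case using assms(2)[of "b - int k"] by (auto simp: algebra_simps)
  qed (use b in simp)
  have "i \<in> A" if "i \<in> {1..b}" for i
  proof -
    have "int (nat (b - i)) = b - i" using that by simp
    then show ?thesis using down[of "nat (b - i)"] that by simp
  qed
  then have "A = {1..b}" using b assms(1) by auto
  moreover have "1 \<le> b" using b assms(1) by auto
  ultimately show ?thesis by auto
qed simp

context graph_system
begin

text \<open>The path \<open>v 1, \<dots>, v M\<close> in \<open>S\<close>.  Sequences instead of lists make reversal and the choice of segments mere
reindexing.\<close>

definition rainbow_path :: "int \<Rightarrow> (int \<Rightarrow> 'a) \<Rightarrow> (int \<Rightarrow> 'c) \<Rightarrow> 'a set \<Rightarrow> bool" where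
  "rainbow_path M v f S \<longleftrightarrow> 1 \<le> M \<and> inj_on v {1..M} \<and> v ` {1..M} \<subseteq> S \<and> S \<subseteq> V \<and> inj_on f {1..<M} \<and> f ` {1..<M} \<subseteq> K
     \<and> (\<forall>i\<in>{1..<M}. E (f i) (v i) (v (i + 1)))"

lemma rainbow_path_rev:
  assumes "rainbow_path M v f S"
  shows "rainbow_path M (\<lambda>i. v (M + 1 - i)) (\<lambda>i. f (M - i)) S"
  unfolding rainbow_path_def
proof (intro conjI ballI)
  have *: "inj_on v {1..M}" "v ` {1..M} \<subseteq> S" "inj_on f {1..<M}" "f ` {1..<M} \<subseteq> K"
    "\<And>i. i \<in> {1..<M} \<Longrightarrow> E (f i) (v i) (v (i + 1))" and M: "1 \<le> M" and "S \<subseteq> V"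
    using assms unfolding rainbow_path_def by auto
  show "1 \<le> M" "S \<subseteq> V" by fact+
  show "inj_on (\<lambda>i. v (M + 1 - i)) {1..M}"
    using * by (intro inj_onI) (drule inj_onD[OF *(1)], auto)
  show "inj_on (\<lambda>i. f (M - i)) {1..<M}"
    using * by (intro inj_onI) (drule inj_onD[OF *(3)], auto)
  have "v (M + 1 - i) \<in> S" if "i \<in> {1..M}" for i by (rule subsetD[OF *(2)], rule imageI) (use that in auto)
  then show "(\<lambda>i. v (M + 1 - i)) ` {1..M} \<subseteq> S" by blast
  have "f (M - i) \<in> K" if "i \<in> {1..<M}" for i by (rule subsetD[OF *(4)], rule imageI) (use that in auto)
  then show "(\<lambda>i. f (M - i)) ` {1..<M} \<subseteq> K" by blast
  show "E (f (M - i)) (v (M + 1 - i)) (v (M + 1 - (i + 1)))" if "i \<in> {1..<M}" for i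
    using Esym[OF *(5)[of "M - i"]] that by (simp add: algebra_simps)
qed

lemma rainbow_path_cons:
  assumes "rainbow_path M v f S" "w \<in> S" "w \<notin> v ` {1..M}" "q \<in> K" "q \<notin> f ` {1..<M}" "E q w (v 1)"
  shows "rainbow_path (M + 1) (insert_at 0 w v) (insert_at 0 q f) S"
proof -
  have *: "1 \<le> M" "inj_on v {1..M}" "v ` {1..M} \<subseteq> S" "S \<subseteq> V" "inj_on f {1..<M}" "f ` {1..<M} \<subseteq> K"
    "\<And>i. i \<in> {1..<M} \<Longrightarrow> E (f i) (v i) (v (i + 1))" using assms(1) unfolding rainbow_path_def by auto
  have e: "{1..<M} = {1..M - 1}" "{1..<M + 1} = {1..(M - 1) + 1}" by auto
  note f = *(5)[unfolded e] *(6)[unfolded e] assms(5)[unfolded e]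
  show ?thesis
    unfolding rainbow_path_def
  proof (intro conjI ballI)
    show "1 \<le> M + 1" "S \<subseteq> V" using * by auto
    show "inj_on (insert_at 0 w v) {1..M + 1}" by (rule insert_at_inj[OF *(2) assms(3)]) (use * in auto)
    show "insert_at 0 w v ` {1..M + 1} \<subseteq> S" by (rule insert_at_image[OF _ _ assms(2) *(3)]) (use * in auto)
    show "inj_on (insert_at 0 q f) {1..<M + 1}" unfolding e by (rule insert_at_inj[OF f(1,3)]) (use * in auto)
    show "insert_at 0 q f ` {1..<M + 1} \<subseteq> K" unfolding e by (rule insert_at_image[OF _ _ assms(4) f(2)]) (use * in auto)
    show "E (insert_at 0 q f i) (insert_at 0 w v i) (insert_at 0 w v (i + 1))" if "i \<in> {1..<M + 1}" for i
      using that *(7)[of "i - 1"] assms(6) by (auto simp: insert_at_def)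
  qed
qed

lemma rainbow_path_joined:
  assumes p: "rainbow_path M v f (V - {x, y})" and xy: "x \<in> V" "y \<in> V" "x \<noteq> y" and ab: "1 \<le> a" "a \<le> b" "b \<le> M"
    and c: "c \<in> K" "d \<in> K" "c \<noteq> d" "c \<notin> f ` {a..<b}" "d \<notin> f ` {a..<b}"
    and E: "E c x (v a)" "E d y (v b)"
  shows "joined (nat (b - a) + 3) x y"
proof (rule joinedI)
  have *: "inj_on v {1..M}" "v ` {1..M} \<subseteq> V - {x, y}" "inj_on f {1..<M}" "f ` {1..<M} \<subseteq> K"
    "\<And>i. i \<in> {1..<M} \<Longrightarrow> E (f i) (v i) (v (i + 1))" using p unfolding rainbow_path_def by auto
  let ?xs = "map v [a..b]" and ?cs = "map f [a..b - 1]"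
  have e: "{a..b - 1} = {a..<b}" "{a..<b} \<subseteq> {1..<M}" "{a..b} \<subseteq> {1..M}" using ab by auto
  have ne: "?xs \<noteq> []" using ab by (simp add: upto_Nil_iff)
  have "coloured_walk E ?xs ?cs" by (rule walk_map_upto; (rule *(5))?) (use ab in simp_all)
  then have "coloured_walk E (?xs @ [y]) (?cs @ [d])"
    by (rule walk_snoc) (simp only: last_map_upto[OF ab(2)] Esym[OF E(2)])
  then show "coloured_walk E (x # ?xs @ [y]) (c # ?cs @ [d])"
    using E(1) ne by (subst walk_Cons) (simp_all only: hd_append2[OF ne] hd_map_upto[OF ab(2)] append_is_Nil_conv simp_thms)
  have s: "set ?xs = v ` {a..b}" "set ?cs = f ` {a..<b}" using e by simp_all
  have sub: "v ` {a..b} \<subseteq> V - {x, y}" "f ` {a..<b} \<subseteq> K" using *(2,4) e by blast+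
  have "distinct ?xs" "distinct ?cs"
    using inj_on_subset[OF *(1) e(3)] inj_on_subset[OF *(3) e(2)] e(1) by (simp_all add: distinct_map)
  then show "distinct (x # ?xs @ [y])" "distinct (c # ?cs @ [d])"
    using s sub c xy by auto
  show "set (x # ?xs @ [y]) \<subseteq> V" "set (c # ?cs @ [d]) \<subseteq> K" using s sub xy c by auto
  show "length (x # ?xs @ [y]) = nat (b - a) + 3" using ab by (simp add: nat_diff_distrib' algebra_simps nat_add_distrib)
qed simp_all

text \<open>Vertices and colours are indexed by all integers with period \<open>L\<close>, so that shifts and reflections need no
modular arithmetic.  A cycle of length two is a pair of vertices with two edges of different colours.\<close>

definition rainbow_cycle :: "int \<Rightarrow> (int \<Rightarrow> 'a) \<Rightarrow> (int \<Rightarrow> 'c) \<Rightarrow> bool" where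
  "rainbow_cycle L u f \<longleftrightarrow> 1 \<le> L \<and> (\<forall>i j. u i = u j \<longleftrightarrow> L dvd i - j) \<and> (\<forall>i j. f i = f j \<longleftrightarrow> L dvd i - j)
     \<and> (\<forall>i. u i \<in> V) \<and> (\<forall>i. f i \<in> K) \<and> (\<forall>i. E (f i) (u i) (u (i + 1)))"

lemma rainbow_cycleD:
  assumes "rainbow_cycle L u f"
  shows "1 \<le> L" "u i = u j \<longleftrightarrow> L dvd i - j" "f i = f j \<longleftrightarrow> L dvd i - j" "u i \<in> V" "f i \<in> K"
    "E (f i) (u i) (u (i + 1))"
  using assms unfolding rainbow_cycle_def by blast+

lemma rainbow_cycle_shift:
  assumes "rainbow_cycle L u f" shows "rainbow_cycle L (\<lambda>i. u (i + a)) (\<lambda>i. f (i + a))"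
proof -
  have "E (f (i + a)) (u (i + a)) (u (i + 1 + a))" for i
    using rainbow_cycleD(6)[OF assms, of "i + a"] by (simp add: algebra_simps)
  then show ?thesis unfolding rainbow_cycle_def using rainbow_cycleD[OF assms] by simp
qed

lemma rainbow_cycle_rev:
  assumes "rainbow_cycle L u f" shows "rainbow_cycle L (\<lambda>i. u (- i)) (\<lambda>i. f (- i - 1))"
proof -
  have "E (f (- i - 1)) (u (- i)) (u (- (i + 1)))" for i
    using Esym[OF rainbow_cycleD(6)[OF assms, of "- i - 1"]] by (simp add: minus_add_distrib)
  moreover have "L dvd (j - i) \<longleftrightarrow> L dvd (i - j)" for i j by (metis dvd_diff_commute)
  ultimately show ?thesis unfolding rainbow_cycle_def using rainbow_cycleD[OF assms] by simp
qed

lemma dvd_window: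
  fixes L :: int
  assumes "i \<in> {a..<a + L}" "j \<in> {a..<a + L}" shows "L dvd i - j \<longleftrightarrow> i = j"
proof
  assume "L dvd i - j"
  moreover have "\<bar>i - j\<bar> < L" using assms by auto
  ultimately show "i = j" using zdvd_imp_le[of L "\<bar>i - j\<bar>"] by (cases "i = j") auto
qed simp

lemma rainbow_cycle_inj:
  assumes "rainbow_cycle L u f"
  shows "inj_on u {a..<a + L}" "inj_on f {a..<a + L}"
  using rainbow_cycleD(2,3)[OF assms] dvd_window[of _ a L] by (auto intro!: inj_onI)

lemma mod_window:
  fixes L :: int assumes "1 \<le> L"
  shows "\<exists>j\<in>{a..<a + L}. L dvd i - j"
proof
  show "L dvd i - (a + (i - a) mod L)" by (metis diff_diff_add dvd_minus_mod)
  show "a + (i - a) mod L \<in> {a..<a + L}" using assms by auto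
qed

lemma rainbow_cycle_range:
  assumes "rainbow_cycle L u f"
  shows "range u = u ` {a..<a + L}" "range f = f ` {a..<a + L}" "card (range u) = nat L" "card (range f) = nat L"
proof -
  show *: "range u = u ` {a..<a + L}" for a
  proof
    show "range u \<subseteq> u ` {a..<a + L}"
    proof
      fix z assume "z \<in> range u"
      then obtain i where "z = u i" by blast
      then show "z \<in> u ` {a..<a + L}" using mod_window[OF rainbow_cycleD(1)[OF assms], of a i] rainbow_cycleD(2)[OF assms, of i]
        by blast
    qed
  qed blast
  show **: "range f = f ` {a..<a + L}" for a
  proof
    show "range f \<subseteq> f ` {a..<a + L}"
    proof
      fix z assume "z \<in> range f"
      then obtain i where "z = f i" by blast
      then show "z \<in> f ` {a..<a + L}" using mod_window[OF rainbow_cycleD(1)[OF assms], of a i] rainbow_cycleD(3)[OF assms, of i]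
        by blast
    qed
  qed blast
  show "card (range u) = nat L" "card (range f) = nat L"
    unfolding *[of 0] **[of 0] using rainbow_cycle_inj[OF assms, of 0] by (simp_all add: card_image)
qed

lemma rainbow_cycle_fpath:
  assumes "rainbow_cycle L u f" "range u \<subseteq> S" "S \<subseteq> V"
  shows "rainbow_path L (\<lambda>i. u (i + a)) (\<lambda>i. f (i + a)) S"
proof -
  have r: "rainbow_cycle L (\<lambda>i. u (i + a)) (\<lambda>i. f (i + a))" by (rule rainbow_cycle_shift[OF assms(1)])
  have e: "{1..L} = {1..<1 + L}" "{1..<L} \<subseteq> {1..<1 + L}" by auto
  show ?thesis unfolding rainbow_path_def
    using rainbow_cycleD[OF r] rainbow_cycle_inj[OF r, of 1] assms(2,3) inj_on_subset[OF rainbow_cycle_inj(2)[OF r, of 1] e(2)]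
    unfolding e(1) by auto
qed

text \<open>The arc may use all colours of the cycle except those of the edges left out, so these are
available at the two ends, too.\<close>

lemma joined_by_arc:
  assumes r: "rainbow_cycle L u f" "range u \<subseteq> V - {x, y}" and xy: "x \<in> V" "y \<in> V" "x \<noteq> y" and s: "0 \<le> s" "s < L"
    and c: "c \<in> K" "d \<in> K" "c \<noteq> d" "c \<notin> f ` {p..<p + s}" "d \<notin> f ` {p..<p + s}"
    and E: "E c x (u p)" "E d y (u (p + s))"
  shows "joined (nat s + 3) x y"
proof -
  have f: "rainbow_path L (\<lambda>i. u (i + (p - 1))) (\<lambda>i. f (i + (p - 1))) (V - {x, y})" by (rule rainbow_cycle_fpath[OF r]) auto
  have e: "(\<lambda>i. f (i + (p - 1))) ` {1..<1 + s} = f ` {p..<p + s}"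
  proof -
    have "(\<lambda>i. i + (p - 1)) ` {1..<1 + s} = {p..<p + s}" by (simp add: add.commute)
    then show ?thesis by (metis image_image)
  qed
  have "joined (nat (1 + s - 1) + 3) x y"
    by (rule rainbow_path_joined[OF f xy, where a = 1 and b = "1 + s"])
      (use s c E e in \<open>simp_all add: algebra_simps\<close>)
  then show ?thesis by simp
qed

lemma rainbow_cycle_of_list:
  assumes "coloured_walk E xs cs" "distinct xs" "distinct (cs @ [c])" "set xs \<subseteq> V" "set (cs @ [c]) \<subseteq> K" "E c (last xs) (hd xs)"
  shows "\<exists>u f. rainbow_cycle (int (length xs)) u f \<and> range u = set xs \<and> range f = set (cs @ [c])
    \<and> (\<forall>i. i < length xs \<longrightarrow> u (int i) = xs ! i)"
proof -
  define L where "L = int (length xs)"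
  have ne: "xs \<noteq> []" using walk_length[OF assms(1)] by auto
  define ds where "ds = cs @ [c]"
  have len: "length xs = Suc (length cs)" by (rule walk_length[OF assms(1)])
  have ld: "length ds = length xs" using len by (simp add: ds_def)
  have L: "1 \<le> L" using len by (simp add: L_def)
  define g where "g zs i = zs ! nat (i mod L)" for zs :: "'z list" and i
  have idx: "nat (i mod L) < length xs" for i 
    using L pos_mod_bound[of L i] pos_mod_sign[of L i] unfolding L_def by linarith
  define u where "u i = xs ! nat (i mod L)" for i
  define f where "f i = ds ! nat (i mod L)" for i
  have eq: "nat (i mod L) = nat (j mod L) \<longleftrightarrow> L dvd i - j" for i j
    using L by (simp add: mod_eq_dvd_iff nat_eq_iff)
  have r: "rainbow_cycle L u f"
    unfolding rainbow_cycle_def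
  proof (intro conjI allI)
    show "1 \<le> L" by fact
    show "u i = u j \<longleftrightarrow> L dvd i - j" for i j
      unfolding u_def eq[symmetric] using idx assms(2) by (simp add: nth_eq_iff_index_eq)
    show "f i = f j \<longleftrightarrow> L dvd i - j" for i j
      unfolding f_def eq[symmetric] using idx assms(3) ld by (simp add: nth_eq_iff_index_eq ds_def)
    show "u i \<in> V" for i unfolding u_def using assms(4) idx by (meson nth_mem subsetD)
    show "f i \<in> K" for i unfolding f_def using assms(5) idx ld by (metis ds_def nth_mem subsetD)
    show "E (f i) (u i) (u (i + 1))" for i
    proof (cases "nat (i mod L) < length cs")
      case True
      then have b: "0 \<le> i mod L" "i mod L + 1 < L" using L len pos_mod_sign[of L i] by (auto simp: L_def)
      have "(i + 1) mod L = (i mod L + 1) mod L" by (simp add: mod_add_left_eq)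
      then have "(i + 1) mod L = i mod L + 1" using b by simp
      then have "nat ((i + 1) mod L) = Suc (nat (i mod L))" using L by (simp add: nat_add_distrib)
      then show ?thesis using walk_nth[OF assms(1) True] True unfolding u_def f_def ds_def by (simp add: nth_append)
    next
      case False
      then have il: "i mod L = L - 1" using idx[of i] len pos_mod_sign[of L i] L unfolding L_def by linarith
      have "(i + 1) mod L = (i mod L + 1) mod L" by (simp add: mod_add_left_eq)
      also have "\<dots> = 0" unfolding il by simp
      finally have "(i + 1) mod L = 0" "nat (i mod L) = length cs"
        using il len by (simp_all add: L_def)
      moreover have "last xs = xs ! length cs" "hd xs = xs ! 0"
        using len ne by (simp_all add: last_conv_nth hd_conv_nth)
      ultimately show ?thesis using assms(6) unfolding u_def f_def ds_def by (simp add: nth_append)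
    qed
  qed
  have nn: "u (int i) = xs ! i" "f (int i) = ds ! i" if "i < length xs" for i
    using that unfolding u_def f_def L_def by simp_all
  have "range u = set xs"
  proof (rule set_eqI, rule iffI)
    fix z assume "z \<in> set xs"
    then obtain i where "i < length xs" "xs ! i = z" unfolding in_set_conv_nth by blast
    then show "z \<in> range u" using nn(1)[of i] by (metis rangeI)
  qed (use idx in \<open>auto simp: u_def\<close>)
  moreover have "range f = set (cs @ [c])"
    unfolding ds_def[symmetric]
  proof (rule set_eqI, rule iffI)
    fix z assume "z \<in> set ds"
    then obtain i where "i < length ds" "ds ! i = z" unfolding in_set_conv_nth by blast
    then show "z \<in> range f" using nn(2)[of i] ld by (metis rangeI)
  qed (use idx ld in \<open>auto simp: f_def\<close>)
  ultimately show ?thesis using r nn unfolding L_def by blast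
qed

text \<open>The crossing chords from the first vertex to the \<open>b\<close>-th and from the last to the \<open>a\<close>-th close a path into a
cycle that skips the vertices between \<open>a\<close> and \<open>b\<close>: follow the path up to \<open>a\<close>, jump to the last vertex and go back
to \<open>b\<close>.\<close>

lemma close_path:
  assumes p: "rainbow_path M v f S" and ab: "1 \<le> a" "a < b" "b \<le> M"
    and c: "c \<in> K" "d \<in> K" "c \<noteq> d" "c \<notin> f ` ({1..<a} \<union> {b..<M})" "d \<notin> f ` ({1..<a} \<union> {b..<M})"
    and E: "E c (v 1) (v b)" "E d (v a) (v M)"
  shows "\<exists>u g. rainbow_cycle (M - (b - a - 1)) u g \<and> range u = v ` ({1..a} \<union> {b..M})
     \<and> range g = f ` ({1..<a} \<union> {b..<M}) \<union> {c, d} \<and> (\<forall>k\<in>{1..a}. u (k - 1) = v k) \<and> u a = v M"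
proof -
  have *: "inj_on v {1..M}" "v ` {1..M} \<subseteq> V" "inj_on f {1..<M}" "f ` {1..<M} \<subseteq> K"
    "\<And>i. i \<in> {1..<M} \<Longrightarrow> E (f i) (v i) (v (i + 1))" using p unfolding rainbow_path_def by auto
  let ?I = "[1..a] @ rev [b..M]" and ?J = "[1..a - 1] @ rev [b..M - 1]"
  let ?xs = "map v [1..a] @ rev (map v [b..M])" and ?cs = "map f [1..a - 1] @ d # rev (map f [b..M - 1])"
  have xs: "?xs = map v ?I" by (simp add: rev_map)
  have I: "distinct ?I" "set ?I = {1..a} \<union> {b..M}" "set ?I \<subseteq> {1..M}" using ab by auto
  have J: "distinct ?J" "set ?J = {1..<a} \<union> {b..<M}" "set ?J \<subseteq> {1..<M}" using ab by auto
  have hdA: "hd (map v [1..a]) = v 1" "last (map v [1..a]) = v a" "hd (rev (map v [b..M])) = v M"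
    "last (rev (map v [b..M])) = v b" using ab by (simp_all only: hd_map_upto last_map_upto hd_rev last_rev)
  have ne: "map v [1..a] \<noteq> []" "rev (map v [b..M]) \<noteq> []" using ab by (simp_all add: upto_Nil_iff)
  have c1: "coloured_walk E (map v [1..a]) (map f [1..a - 1])"
    by (rule walk_map_upto; (rule *(5))?) (use ab in simp_all)
  have "coloured_walk E (map v [b..M]) (map f [b..M - 1])"
    by (rule walk_map_upto; (rule *(5))?) (use ab in simp_all)
  then have c2: "coloured_walk E (rev (map v [b..M])) (rev (map f [b..M - 1]))" by (rule walk_reverse)
  have ch: "coloured_walk E ?xs ?cs" by (rule walk_append[OF c1 c2]) (simp only: hdA E)
  have dx: "distinct ?xs" unfolding xs using I inj_on_subset[OF *(1)] by (simp only: distinct_map)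
  have sx: "set ?xs = v ` ({1..a} \<union> {b..M})" unfolding xs by (simp only: set_map I)
  have mJ: "map f ?J = map f [1..a - 1] @ rev (map f [b..M - 1])" by (simp add: rev_map)
  have dJ: "distinct (map f ?J)" "set (map f ?J) = f ` ({1..<a} \<union> {b..<M})"
    using J inj_on_subset[OF *(3)] by (simp_all only: distinct_map set_map)
  have sc: "set (?cs @ [c]) = f ` ({1..<a} \<union> {b..<M}) \<union> {c, d}" unfolding dJ(2)[symmetric] mJ by auto
  have "distinct (c # d # map f ?J)" using dJ c by (simp only: distinct.simps dJ(2) set_simps) simp
  then have dc: "distinct (?cs @ [c])" unfolding mJ by auto
  have "v ` ({1..a} \<union> {b..M}) \<subseteq> V" using *(2) ab by auto
  moreover have "f ` ({1..<a} \<union> {b..<M}) \<subseteq> K" using *(4) ab by auto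
  ultimately have sV: "set ?xs \<subseteq> V" "set (?cs @ [c]) \<subseteq> K" unfolding sx sc using c by auto
  have Ec: "E c (last ?xs) (hd ?xs)"
    using Esym[OF E(1)] by (simp only: hd_append2[OF ne(1)] last_appendR[OF ne(2)] hdA)
  obtain u g where ug: "rainbow_cycle (int (length ?xs)) u g" "range u = set ?xs" "range g = set (?cs @ [c])"
    "\<And>i. i < length ?xs \<Longrightarrow> u (int i) = ?xs ! i"
    using rainbow_cycle_of_list[OF ch dx dc sV Ec] by blast
  have len: "int (length ?xs) = M - (b - a - 1)" using ab by simp
  have "u (k - 1) = v k" if "k \<in> {1..a}" for k
  proof -
    have "u (int (nat (k - 1))) = ?xs ! nat (k - 1)" using that ab by (intro ug(4)) auto
    also have "\<dots> = v k" using that by (auto simp: nth_append)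
    finally show ?thesis using that by simp
  qed
  moreover have "u a = v M"
  proof -
    have "u (int (nat a)) = ?xs ! nat a" using ab by (intro ug(4)) auto
    also have "\<dots> = hd (rev (map v [b..M]))" using ab ne by (simp add: nth_append hd_conv_nth del: hd_rev)
    finally show ?thesis using ab hdA by simp
  qed
  ultimately show ?thesis using ug unfolding len sx sc by blast
qed

end

section \<open>A spanning rainbow path on the remaining vertices\<close>

lemma periodic_card_le:
  fixes L :: int
  assumes "1 \<le> L" "\<And>i j. L dvd i - j \<Longrightarrow> P i \<Longrightarrow> P j"
  shows "card {i \<in> {0..<L}. P (i + a)} \<le> card {i \<in> {0..<L}. P i}"
proof (rule card_inj_on_le)
  show "inj_on (\<lambda>i. (i + a) mod L) {i \<in> {0..<L}. P (i + a)}"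
  proof (rule inj_onI)
    fix i j assume *: "i \<in> {i \<in> {0..<L}. P (i + a)}" "j \<in> {i \<in> {0..<L}. P (i + a)}" "(i + a) mod L = (j + a) mod L"
    then have "L dvd i - j" by (simp add: mod_eq_dvd_iff)
    moreover have "\<bar>i - j\<bar> < L" using * by auto
    ultimately show "i = j" using zdvd_imp_le[of L "\<bar>i - j\<bar>"] by (cases "i = j") auto
  qed
  show "(\<lambda>i. (i + a) mod L) ` {i \<in> {0..<L}. P (i + a)} \<subseteq> {i \<in> {0..<L}. P i}"
  proof
    fix k assume "k \<in> (\<lambda>i. (i + a) mod L) ` {i \<in> {0..<L}. P (i + a)}"
    then obtain i where i: "P (i + a)" "k = (i + a) mod L" by blast
    then show "k \<in> {i \<in> {0..<L}. P i}"
      using assms(1) assms(2)[of "i + a" k] by (simp add: dvd_minus_mod)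
  qed
  show "finite {i \<in> {0..<L}. P i}" by (rule finite_subset[of _ "{0..<L}"]) auto
qed

lemma periodic_card:
  fixes L :: int
  assumes "1 \<le> L" "\<And>i j. L dvd i - j \<Longrightarrow> P i \<Longrightarrow> P j"
  shows "card {i \<in> {0..<L}. P (i + a)} = card {i \<in> {0..<L}. P i}"
proof (rule antisym)
  show "card {i \<in> {0..<L}. P (i + a)} \<le> card {i \<in> {0..<L}. P i}"
    by (rule periodic_card_le[of L P]) (use assms in blast)+
  have "card {i \<in> {0..<L}. P (i + - a + a)} \<le> card {i \<in> {0..<L}. P (i + a)}"
    by (rule periodic_card_le[of L "\<lambda>i. P (i + a)" "- a"])
      (use assms(1) in simp, rule assms(2)[of "_ + a" "_ + a"], simp_all)
  then show "card {i \<in> {0..<L}. P i} \<le> card {i \<in> {0..<L}. P (i + a)}" by simp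
qed

lemma element_outside:
  assumes "finite A" "card A < card B" shows "\<exists>z. z \<in> B \<and> z \<notin> A"
proof (rule ccontr)
  assume "\<not> ?thesis"
  then have "card B \<le> card A" using assms(1) by (intro card_mono) auto
  then show False using assms(2) by simp
qed

lemma two_elements:
  assumes "2 \<le> card S" shows "\<exists>c d. c \<in> S \<and> d \<in> S \<and> c \<noteq> d"
proof -
  have "finite S" using assms card.infinite by force
  then show ?thesis using assms card_le_Suc0_iff_eq[of S] by auto
qed

context graph_system
begin

lemma card_minus_pair: "x \<in> V \<Longrightarrow> y \<in> V \<Longrightarrow> x \<noteq> y \<Longrightarrow> card (V - {x, y}) = n - 2"
  using cardV finV card_Diff_subset[of "{x, y}" V] by simp

lemma rainbow_path_card:
  assumes "rainbow_path M v f S" shows "card (v ` {1..M}) = nat M" "card (f ` {1..<M}) = nat (M - 1)"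
  using assms card_image[of v "{1..M}"] card_image[of f "{1..<M}"] unfolding rainbow_path_def by simp_all

lemma close_path_spare:
  assumes p: "rainbow_path M v f S" and ab: "1 \<le> a" "a < b" "b \<le> M"
    and c: "c \<in> K" "d \<in> K" "c \<noteq> d" "c \<notin> f ` {1..<M}" "d \<notin> f ` {1..<M}"
    and E: "E c (v 1) (v b)" "E d (v M) (v a)"
  shows "\<exists>u g. rainbow_cycle (M - (b - a - 1)) u g \<and> range u = v ` ({1..a} \<union> {b..M})"
proof -
  have "{1..<a} \<union> {b..<M} \<subseteq> {1..<M}" using ab by auto
  then have "c \<notin> f ` ({1..<a} \<union> {b..<M})" "d \<notin> f ` ({1..<a} \<union> {b..<M})" using c by blast+
  from close_path[OF p ab c(1-3) this E(1) Esym[OF E(2)]] show ?thesis by blast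
qed

text \<open>A longest rainbow path in \<open>V - {x, y}\<close>.  If it misses a vertex, at least three colours are spare.
All neighbours of both ends in spare colours lie on it, so two crossing chords turn it into a cycle.
A vertex outside has a neighbour on this cycle in a colour that is still spare, and the path gets longer.\<close>

lemma spanning_path:
  assumes xy: "x \<in> V" "y \<in> V" "x \<noteq> y" and n: "3 \<le> n"
  shows "\<exists>v f. rainbow_path (int n - 2) v f (V - {x, y})"
proof -
  define U where "U = V - {x, y}"
  have cU: "card U = n - 2" unfolding U_def by (rule card_minus_pair[OF xy])
  have finU: "finite U" "U \<subseteq> V" using finV by (auto simp: U_def)
  define P where "P p \<longleftrightarrow> (\<exists>v f. rainbow_path (int p) v f U)" for p
  obtain z where "z \<in> U" using cU n by (metis One_nat_def card.empty diff_is_0_eq equals0I not_less_eq_eq numeral_2_eq_2 numeral_3_eq_3)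
  then have P1: "P 1" unfolding P_def rainbow_path_def using finU by (intro exI[of _ "\<lambda>_. z"]) auto
  have Pb: "p \<le> n - 2" if Pp: "P p" for p
  proof -
    from Pp obtain v f where vf: "rainbow_path (int p) v f U" unfolding P_def by blast
    then have "card (v ` {1..int p}) \<le> card U" using finU by (intro card_mono) (auto simp: rainbow_path_def)
    then show ?thesis using rainbow_path_card[OF vf] cU by simp
  qed
  obtain p where p: "P p" and pmax: "\<And>q. P q \<Longrightarrow> q \<le> p"
    using Greatest_le_nat[of P _ "n - 2"] GreatestI_nat[of P 1 "n - 2"] P1 Pb by metis
  have "p = n - 2"
  proof (rule ccontr)
    assume "p \<noteq> n - 2"
    then have pn: "p + 3 \<le> n" using Pb[OF p] by simp
    define M where "M = int p"
    obtain v f where vf: "rainbow_path M v f U" using p unfolding P_def M_def by blast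
    have noext: False if "rainbow_path M v f U" "w \<in> U" "w \<notin> v ` {1..M}" "q \<in> K" "q \<notin> f ` {1..<M}" "E q w (v 1)"
      for v f w q
      using rainbow_path_cons[OF that] pmax[of "Suc p"] unfolding P_def M_def by (auto simp: add.commute)
    have *: "1 \<le> M" "inj_on v {1..M}" "v ` {1..M} \<subseteq> U" "inj_on f {1..<M}" "f ` {1..<M} \<subseteq> K"
      using vf unfolding rainbow_path_def by auto
    have vV: "v i \<in> V" if "i \<in> {1..M}" for i using *(3) finU(2) that by blast
    have "card (K - f ` {1..<M}) = n - 1 - (p - 1)"
      using card_Diff_subset[of "f ` {1..<M}" K] *(5) rainbow_path_card(2)[OF vf] cardK M_def by simp
    then have "2 \<le> card (K - f ` {1..<M})" using pn by simp
    then obtain c d where cd: "c \<in> K" "d \<in> K" "c \<noteq> d" "c \<notin> f ` {1..<M}" "d \<notin> f ` {1..<M}"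
      using two_elements by blast
    have A: "D \<le> card {i \<in> {1..M - 1}. E c (v 1) (v (i + 1))} + 2"
    proof -
      let ?Z = "V - (\<lambda>i. v (i + 1)) ` {1..M - 1}"
      have "{z \<in> ?Z. E c (v 1) z} \<subseteq> {x, y}"
      proof
        fix z assume z: "z \<in> {z \<in> ?Z. E c (v 1) z}"
        have "z \<noteq> v i" if "i \<in> {1..M}" for i
        proof (cases "i = 1")
          case True then show ?thesis using z Eirr by auto
        next
          case False
          then have "i - 1 \<in> {1..M - 1}" using that by auto
          then have "v (i - 1 + 1) \<in> (\<lambda>i. v (i + 1)) ` {1..M - 1}" by (rule imageI)
          then show ?thesis using z by auto
        qed
        then have "z \<notin> v ` {1..M}" by blast
        then show "z \<in> {x, y}"
          using noext[OF vf _ _ cd(1,4), of z] Esym[of c "v 1" z] z unfolding U_def by blast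
      qed
      then have "card {z \<in> ?Z. E c (v 1) z} \<le> card {x, y}" by (intro card_mono) auto
      also have "\<dots> \<le> 2" by (simp add: card_insert_if)
      finally have le: "card {z \<in> ?Z. E c (v 1) z} \<le> 2" .
      have inj: "inj_on (\<lambda>i. v (i + 1)) {1..M - 1}" 
        by (intro inj_onI) (drule inj_onD[OF *(2)], auto)
      have "D \<le> card {i \<in> {1..M - 1}. E c (v 1) (v (i + 1))} + card {z \<in> ?Z. E c (v 1) z}"
        by (rule degree_via_index[OF cd(1) _ inj]) (use vV[of 1] *(1) finV in auto)
      then show ?thesis using le by linarith
    qed
    have B: "D \<le> card {i \<in> {1..M - 1}. E d (v M) (v i)} + 2"
    proof -
      let ?Z = "V - v ` {1..M - 1}"
      note r = rainbow_path_rev[OF vf]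
      have im: "(\<lambda>i. v (M + 1 - i)) ` {1..M} = v ` {1..M}" "(\<lambda>i. f (M - i)) ` {1..<M} = f ` {1..<M}"
      proof -
        have "(\<lambda>i. M + 1 - i) ` {1..M} = {1..M}" "(\<lambda>i. M - i) ` {1..<M} = {1..<M}"
          by (auto intro!: image_eqI[of _ _ "M + 1 - _"] image_eqI[of _ _ "M - _"])
        then show "(\<lambda>i. v (M + 1 - i)) ` {1..M} = v ` {1..M}" "(\<lambda>i. f (M - i)) ` {1..<M} = f ` {1..<M}"
          by (metis image_image)+
      qed
      have "{z \<in> ?Z. E d (v M) z} \<subseteq> {x, y}"
      proof
        fix z assume z: "z \<in> {z \<in> ?Z. E d (v M) z}"
        have "z \<noteq> v i" if "i \<in> {1..M}" for i
        proof (cases "i = M")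
          case True then show ?thesis using z Eirr by auto
        next
          case False
          then have "i \<in> {1..M - 1}" using that by auto
          then have "v i \<in> v ` {1..M - 1}" by (rule imageI)
          then show ?thesis using z by auto
        qed
        then have "z \<notin> v ` {1..M}" by blast
        then show "z \<in> {x, y}"
          using noext[OF r _ _ cd(2), of z] im cd(5) Esym[of d "v M" z] z unfolding U_def by auto
      qed
      then have "card {z \<in> ?Z. E d (v M) z} \<le> card {x, y}" by (intro card_mono) auto
      also have "\<dots> \<le> 2" by (simp add: card_insert_if)
      finally have le: "card {z \<in> ?Z. E d (v M) z} \<le> 2" .
      have inj: "inj_on v {1..M - 1}" using inj_on_subset[OF *(2), of "{1..M - 1}"] by auto
      have "D \<le> card {i \<in> {1..M - 1}. E d (v M) (v i)} + card {z \<in> ?Z. E d (v M) z}"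
        by (rule degree_via_index[OF cd(2) _ inj]) (use vV[of M] *(1) finV in auto)
      then show ?thesis using le by linarith
    qed
    have cM: "card {1..M - 1} = p - 1" and p1: "1 \<le> p" using M_def *(1) by simp_all
    have "\<exists>i. i \<in> {i \<in> {1..M - 1}. E c (v 1) (v (i + 1))} \<and> i \<in> {i \<in> {1..M - 1}. E d (v M) (v i)}"
      by (rule subsets_meet[of "{1..M - 1}"]) (use A B cM degree_bounds pn p1 in auto)+
    then obtain i where i: "i \<in> {1..M - 1}" "E c (v 1) (v (i + 1))" "E d (v M) (v i)" by blast
    have s: "{1..<i} \<union> {i + 1..<M} \<subseteq> {1..<M}" "{1..i} \<union> {i + 1..M} = {1..M}" using i(1) by auto
    obtain u g where ug: "rainbow_cycle (M - (i + 1 - i - 1)) u g" "range u = v ` ({1..i} \<union> {i + 1..M})"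
      using close_path_spare[OF vf _ _ _ cd i(2,3)] i(1) by auto
    then have ug: "rainbow_cycle M u g" "range u = v ` {1..M}" unfolding s by simp_all
    have cg: "card (range g) = p" "card (range u) = p" using rainbow_cycle_range[OF ug(1)] M_def by simp_all
    have gK: "range g \<subseteq> K" "range u \<subseteq> U" using rainbow_cycleD(5)[OF ug(1)] ug(2) *(3) by auto
    have fin: "finite (range g)" "finite (range u)" using gK finK finU finite_subset by blast+
    have lt: "card (range g) < card K" "card (range u) < card U" using cg cU cardK pn by linarith+
    obtain q where q: "q \<in> K" "q \<notin> range g"
      using element_outside[OF fin(1) lt(1)] by blast
    obtain w where w: "w \<in> U" "w \<notin> range u"
      using element_outside[OF fin(2) lt(2)] by blast
    have "\<not> E q w (u l)" for l
    proof
      assume El: "E q w (u l)"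
      have fp: "rainbow_path M (\<lambda>i. u (i + (l - 1))) (\<lambda>i. g (i + (l - 1))) U"
        by (rule rainbow_cycle_fpath[OF ug(1) gK(2) finU(2)])
      show False by (rule noext[OF fp w(1) _ q(1)]) (use w q El in auto)
    qed
    then have "{b. E q w b} \<subseteq> V - range u - {w}" using EV2 Eirr by blast
    then have "card {b. E q w b} \<le> card (V - range u - {w})" using finV by (intro card_mono) auto
    also have "\<dots> = n - p - 1"
    proof -
      have "range u \<subseteq> V" "finite (range u)" using gK finU finite_subset by blast+
      then have "card (V - range u) = n - p" using card_Diff_subset[of "range u" V] cardV cg by simp
      moreover have "w \<in> V - range u" using w finU by auto
      ultimately show ?thesis by simp
    qed
    finally have "D \<le> n - p - 1" using deg[OF q(1), of w] w finU(2) by force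
    moreover have "card {i \<in> {1..M - 1}. E c (v 1) (v (i + 1))} \<le> card {1..M - 1}" by (intro card_mono) auto
    then have "D \<le> p + 1" using A cM *(1) M_def by simp
    ultimately show False using degree_bounds pn by linarith
  qed
  then show ?thesis using p n unfolding P_def U_def by (auto simp: of_nat_diff)
qed


section \<open>A rainbow cycle missing one vertex\<close>

text \<open>If no two chords close the spanning path to a cycle, with or without skipping a vertex, then
the neighbours of its first vertex on the path form an initial segment and the degree bound is attained
there, so that \<open>x\<close> and \<open>y\<close> are adjacent to the first vertex.  By symmetry the path falls into two
blocks that share their middle vertex.\<close>

lemma block_neighbours:
  assumes xy: "x \<in> V" "y \<in> V" "x \<noteq> y" and n: "5 \<le> n" and p: "rainbow_path (int n - 2) v f (V - {x, y})"
    and cd: "c \<in> K" "d \<in> K" "c \<noteq> d" "c \<notin> f ` {1..<int n - 2}" "d \<notin> f ` {1..<int n - 2}"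
    and nocyc: "\<And>u g. rainbow_cycle (int n - 2) u g \<Longrightarrow> range u \<subseteq> V - {x, y} \<Longrightarrow> False"
      "\<And>u g. rainbow_cycle (int n - 3) u g \<Longrightarrow> range u \<subseteq> V - {x, y} \<Longrightarrow> False"
  shows "int n + 1 = 2 * int D" "\<And>i. i \<in> {1..int n - 3} \<Longrightarrow> E c (v 1) (v (i + 1)) \<longleftrightarrow> i \<le> int D - 2"
    "E c (v 1) x" "E c (v 1) y"
proof -
  define M where "M = int n - 2"
  note p = p[folded M_def] and cd = cd[folded M_def]
  have *: "1 \<le> M" "inj_on v {1..M}" "v ` {1..M} \<subseteq> V - {x, y}"
    using p unfolding rainbow_path_def by auto
  have im: "v ` {1..M} = V - {x, y}"
    by (rule card_subset_eq) (use finV * rainbow_path_card(1)[OF p] card_minus_pair[OF xy] n M_def in auto)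
  have vV: "v i \<in> V" if "i \<in> {1..M}" for i using *(3) that by blast
  define A where "A = {i \<in> {1..M - 1}. E c (v 1) (v (i + 1))}"
  define B where "B = {i \<in> {1..M - 1}. E d (v M) (v i)}"
  have cA: "D \<le> card A + of_bool (E c (v 1) x) + of_bool (E c (v 1) y)"
  proof -
    have "V \<subseteq> (\<lambda>i. v (i + 1)) ` {1..M - 1} \<union> set [v 1, x, y]"
    proof
      fix z assume "z \<in> V"
      then consider "z = x" | "z = y" | i where "i \<in> {1..M}" "z = v i" using im by blast
      then show "z \<in> (\<lambda>i. v (i + 1)) ` {1..M - 1} \<union> set [v 1, x, y]"
      proof cases
        case (3 i)
        then show ?thesis by (cases "i = 1") (auto intro!: image_eqI[of _ _ "i - 1"])
      qed simp_all
    qed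
    moreover have "inj_on (\<lambda>i. v (i + 1)) {1..M - 1}"
      by (intro inj_onI) (drule inj_onD[OF *(2)], auto)
    ultimately show ?thesis
      using degree_via_index_list[OF cd(1) vV[of 1], of "\<lambda>i. v (i + 1)" "{1..M - 1}" "[v 1, x, y]"] *(1) Eirr[of c "v 1"]
      unfolding A_def by simp
  qed
  have cB: "D \<le> card B + of_bool (E d (v M) x) + of_bool (E d (v M) y)"
  proof -
    have e: "{1..M} = insert M {1..M - 1}" using *(1) by auto
    have "V \<subseteq> v ` {1..M - 1} \<union> set [v M, x, y]"
      using im unfolding e by auto
    moreover have "inj_on v {1..M - 1}" using inj_on_subset[OF *(2), of "{1..M - 1}"] by auto
    ultimately show ?thesis
      using degree_via_index_list[OF cd(2) vV[of M], of v "{1..M - 1}" "[v M, x, y]"] *(1) Eirr[of d "v M"]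
      unfolding B_def by simp
  qed
  have fin: "finite A" "finite B" and sub: "A \<subseteq> {1..M - 1}" "B \<subseteq> {1..M - 1}"
    unfolding A_def B_def by (auto intro: finite_subset[of _ "{1..M - 1}"])
  have disj: "A \<inter> B = {}"
  proof (rule ccontr)
    assume "A \<inter> B \<noteq> {}"
    then obtain i where i: "i \<in> {1..M - 1}" "E c (v 1) (v (i + 1))" "E d (v M) (v i)"
      unfolding A_def B_def by blast
    then obtain u g where "rainbow_cycle (M - (i + 1 - i - 1)) u g" "range u = v ` ({1..i} \<union> {i + 1..M})"
      using close_path_spare[OF p _ _ _ cd i(2,3)] by auto
    moreover have "{1..i} \<union> {i + 1..M} = {1..M}" using i(1) by auto
    ultimately show False using nocyc(1)[of u g] *(3) by (simp add: M_def)
  qed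
  have cAB: "card A + card B = card (A \<union> B)" using fin disj by (simp add: card_Un_disjoint)
  also have "\<dots> \<le> card {1..M - 1}" using sub by (intro card_mono) auto
  also have "\<dots> = n - 3" using n by (simp add: M_def)
  finally have le: "card A + card B \<le> n - 3" .
  have b: "of_bool P \<le> (1::nat)" for P by simp
  have cA2: "D \<le> card A + 2" and cB2: "D \<le> card B + 2"
    using cA cB b[of "E c (v 1) x"] b[of "E c (v 1) y"] b[of "E d (v M) x"] b[of "E d (v M) y"] by linarith+
  have eq: "card A + 2 = D" "card B + 2 = D" "n + 1 = 2 * D" using le cA2 cB2 degree_bounds n by linarith+
  show "int n + 1 = 2 * int D" using eq(3) by linarith
  show "E c (v 1) x" "E c (v 1) y" using cA eq(1) by (auto simp: of_bool_def split: if_splits)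
  have "A \<union> B = {1..M - 1}"
    by (rule card_subset_eq) (use sub cAB eq n M_def in auto)
  have "A = {1..int (card A)}"
  proof (rule down_closed_interval[OF sub(1)])
    fix i assume i: "i \<in> A" "2 \<le> i"
    show "i - 1 \<in> A"
    proof (rule ccontr)
      assume "i - 1 \<notin> A"
      moreover have "i - 1 \<in> {1..M - 1}" using i sub by auto
      ultimately have "i - 1 \<in> B" using \<open>A \<union> B = {1..M - 1}\<close> by blast
      then have E: "E c (v 1) (v (i + 1))" "E d (v M) (v (i - 1))" "i \<le> M - 1" using i sub unfolding A_def B_def by auto
      then obtain u g where "rainbow_cycle (M - (i + 1 - (i - 1) - 1)) u g" "range u = v ` ({1..i - 1} \<union> {i + 1..M})"
        using close_path_spare[OF p _ _ _ cd E(1,2)] i by auto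
      moreover have "v ` ({1..i - 1} \<union> {i + 1..M}) \<subseteq> V - {x, y}"
        using *(3) E(3) i(2) by (auto simp: image_subset_iff)
      ultimately show False using nocyc(2)[of u g] by (simp add: M_def)
    qed
  qed
  moreover have "int (card A) = int D - 2" using eq(1) by linarith
  ultimately have "A = {1..int D - 2}" by (simp only:)
  then have Aeq: "i \<in> A \<longleftrightarrow> i \<in> {1..int D - 2}" for i by blast
  show "E c (v 1) (v (i + 1)) \<longleftrightarrow> i \<le> int D - 2" if "i \<in> {1..int n - 3}" for i
    using Aeq[of i] that unfolding A_def M_def by auto
qed

text \<open>Each vertex of the first block becomes the first vertex of a spanning path after reversing an initial
segment, so the previous lemma applies to all of them.\<close>

lemma block_ends:
  assumes xy: "x \<in> V" "y \<in> V" "x \<noteq> y" and n: "5 \<le> n" and p: "rainbow_path (int n - 2) v f (V - {x, y})"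
    and cd: "c \<in> K" "d \<in> K" "c \<noteq> d" "c \<notin> f ` {1..<int n - 2}" "d \<notin> f ` {1..<int n - 2}"
    and nocyc: "\<And>u g. rainbow_cycle (int n - 2) u g \<Longrightarrow> range u \<subseteq> V - {x, y} \<Longrightarrow> False"
      "\<And>u g. rainbow_cycle (int n - 3) u g \<Longrightarrow> range u \<subseteq> V - {x, y} \<Longrightarrow> False"
    and i: "i \<in> {1..int D - 2}"
  shows "E d (v i) x" "E d (v i) y"
proof -
  define M where "M = int n - 2"
  have *: "inj_on v {1..M}" "v ` {1..M} \<subseteq> V - {x, y}" "inj_on f {1..<M}" "f ` {1..<M} \<subseteq> K"
    "\<And>i. i \<in> {1..<M} \<Longrightarrow> E (f i) (v i) (v (i + 1))"
    using p unfolding rainbow_path_def M_def by auto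
  note cd = cd[folded M_def]
  have nD2: "int n + 1 = 2 * int D" by (rule block_neighbours(1)[OF assms(1-12)])
  have iM: "1 \<le> i" "i < M" using i nD2 n unfolding M_def by auto
  have Ei: "E c (v 1) (v (i + 1))"
    using block_neighbours(2)[OF assms(1-12), where i = i] i iM unfolding M_def by auto
  define w where "w k = (if k \<le> i then v (i + 1 - k) else v k)" for k
  define g where "g k = (if k < i then f (i - k) else if k = i then c else f k)" for k
  have vinj: "v a = v b \<longleftrightarrow> a = b" if "a \<in> {1..M}" "b \<in> {1..M}" for a b
    using *(1) that by (auto dest: inj_onD)
  have finj: "f a = f b \<longleftrightarrow> a = b" if "a \<in> {1..<M}" "b \<in> {1..<M}" for a b
    using *(3) that by (auto dest: inj_onD)
  have fc: "f a \<noteq> c" "f a \<noteq> d" if "a \<in> {1..<M}" for a using cd that by auto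
  have "rainbow_path M w g (V - {x, y})"
    unfolding rainbow_path_def
  proof (intro conjI ballI)
    show "1 \<le> M" "V - {x, y} \<subseteq> V" using iM by auto
    show "inj_on w {1..M}"
    proof (rule inj_onI)
      fix a b assume ab: "a \<in> {1..M}" "b \<in> {1..M}" "w a = w b"
      define r where "r k = (if k \<le> i then i + 1 - k else k)" for k
      have "w k = v (r k)" for k by (simp add: w_def r_def)
      moreover have "r a \<in> {1..M}" "r b \<in> {1..M}" using ab iM by (auto simp: r_def)
      ultimately have "r a = r b" using ab(3) vinj by simp
      then show "a = b" using ab by (auto simp: r_def split: if_splits)
    qed
    show "w ` {1..M} \<subseteq> V - {x, y}"
    proof
      fix z assume "z \<in> w ` {1..M}"
      then obtain k where k: "k \<in> {1..M}" "z = w k" by blast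
      then have "z \<in> v ` {1..M}" using iM by (auto simp: w_def)
      then show "z \<in> V - {x, y}" using *(2) by blast
    qed
    show "inj_on g {1..<M}"
    proof (rule inj_onI)
      fix a b assume ab: "a \<in> {1..<M}" "b \<in> {1..<M}" "g a = g b"
      then show "a = b"
        using iM finj[of "i - a" "i - b"] finj[of "i - a" b] finj[of a "i - b"] finj[of a b]
          fc[of "i - a"] fc[of "i - b"] fc[of a] fc[of b]
        by (auto simp: g_def split: if_splits)
    qed
    show "g ` {1..<M} \<subseteq> K"
    proof
      fix z assume "z \<in> g ` {1..<M}"
      then obtain k where k: "k \<in> {1..<M}" "z = g k" by blast
      then have "z \<in> insert c (f ` {1..<M})" using iM by (auto simp: g_def)
      then show "z \<in> K" using *(4) cd(1) by blast
    qed
    show "E (g k) (w k) (w (k + 1))" if "k \<in> {1..<M}" for k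
    proof -
      consider "k < i" | "k = i" | "i < k" by linarith
      then show ?thesis
      proof cases
        case 1
        have "E (f (i - k)) (v (i - k + 1)) (v (i - k))" by (rule Esym[OF *(5)]) (use 1 that iM in auto)
        then show ?thesis using 1 by (simp add: g_def w_def algebra_simps)
      next
        case 2
        then show ?thesis using Ei by (simp add: g_def w_def)
      next
        case 3
        then show ?thesis using *(5)[OF that] by (simp add: g_def w_def)
      qed
    qed
  qed
  then have q: "rainbow_path (int n - 2) w g (V - {x, y})" by (simp add: M_def)
  have fiK: "f i \<in> K" "d \<noteq> f i" using *(4) iM fc[of i] by auto
  have gd: "d \<notin> g ` {1..<int n - 2}"
  proof
    assume "d \<in> g ` {1..<int n - 2}"
    then obtain k where "k \<in> {1..<M}" "d = g k" unfolding M_def by blast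
    then show False using iM fc(2)[of "i - k"] fc(2)[of k] cd(3) by (auto simp: g_def split: if_splits)
  qed
  have gf: "f i \<notin> g ` {1..<int n - 2}"
  proof
    assume "f i \<in> g ` {1..<int n - 2}"
    then obtain k where "k \<in> {1..<M}" "f i = g k" unfolding M_def by blast
    then show False using iM finj[of i "i - k"] finj[of i k] fc(1)[of i] by (auto simp: g_def split: if_splits)
  qed
  have "w 1 = v i" using iM by (simp add: w_def)
  then show "E d (v i) x" "E d (v i) y"
    using block_neighbours(3,4)[OF xy n q cd(2) fiK(1,2) gd gf nocyc] by simp_all
qed

text \<open>Every vertex but the middle one is adjacent to \<open>x\<close> and \<open>y\<close> in both spare colours, so almost every segment
of the path gives a path from \<open>x\<close> to \<open>y\<close>.\<close>

lemma block_joined: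
  assumes xy: "x \<in> V" "y \<in> V" "x \<noteq> y" and n: "5 \<le> n" and p: "rainbow_path (int n - 2) v f (V - {x, y})"
    and nocyc: "\<And>u g. rainbow_cycle (int n - 2) u g \<Longrightarrow> range u \<subseteq> V - {x, y} \<Longrightarrow> False"
      "\<And>u g. rainbow_cycle (int n - 3) u g \<Longrightarrow> range u \<subseteq> V - {x, y} \<Longrightarrow> False"
    and k: "4 \<le> k" "k \<le> n - 1"
  shows "joined k x y"
proof -
  define M where "M = int n - 2"
  have *: "inj_on v {1..M}" "v ` {1..M} \<subseteq> V - {x, y}" "inj_on f {1..<M}" "f ` {1..<M} \<subseteq> K"
    using p unfolding rainbow_path_def M_def by auto
  have "card (K - f ` {1..<M}) = n - 1 - (n - 3)"
    using card_Diff_subset[of "f ` {1..<M}" K] *(4) rainbow_path_card(2)[OF p] cardK M_def by simp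
  then have "2 \<le> card (K - f ` {1..<M})" using n by simp
  then obtain c d where cd: "c \<in> K" "d \<in> K" "c \<noteq> d" "c \<notin> f ` {1..<M}" "d \<notin> f ` {1..<M}"
    using two_elements by blast
  note cd' = cd[unfolded M_def]
  have nD2: "int n + 1 = 2 * int D" by (rule block_neighbours(1)[OF xy n p cd' nocyc])
  have p': "rainbow_path M v f (V - {x, y})" using p by (simp add: M_def)
  have r: "rainbow_path (int n - 2) (\<lambda>i. v (M + 1 - i)) (\<lambda>i. f (M - i)) (V - {x, y})" using rainbow_path_rev[OF p'] by (simp add: M_def)
  have imr: "(\<lambda>i. f (M - i)) ` {1..<int n - 2} = f ` {1..<M}"
  proof -
    have "(\<lambda>i. M - i) ` {1..<M} = {1..<M}" by (auto intro!: image_eqI[of _ _ "M - _"])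
    then show ?thesis unfolding M_def by (metis image_image)
  qed
  have adj: "E q (v i) x" "E q (v i) y" if that': "i \<in> {1..M}" "i \<noteq> int D - 1" "q = c \<or> q = d" for i q
  proof -
    obtain q' where q': "q' \<in> K" "q \<in> K" "q' \<noteq> q" "q' \<notin> f ` {1..<int n - 2}" "q \<notin> f ` {1..<int n - 2}"
      using that'(3) cd' by blast
    note r' = q'(4,5)[folded M_def, folded imr]
    have "E q (v i) x \<and> E q (v i) y"
    proof (cases "i < int D - 1")
      case True
      then show ?thesis using block_ends[OF xy n p q' nocyc, where i = i] that' by auto
    next
      case False
      then have "M + 1 - i \<in> {1..int D - 2}" using that' nD2 unfolding M_def by auto
      from block_ends[OF xy n r q'(1-3) r' nocyc this] show ?thesis by simp
    qed
    then show "E q (v i) x" "E q (v i) y" by auto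
  qed
  define t where "t = int k - 2"
  have t: "2 \<le> t" "t \<le> M - 1" using k n unfolding t_def M_def by auto
  have use: "joined k x y" if "1 \<le> a" "a + t - 1 \<le> M" "{q, q'} = {c, d}" "E q x (v a)" "E q' y (v (a + t - 1))" for a q q'
  proof -
    have "q \<in> K" "q' \<in> K" "q \<noteq> q'" "q \<notin> f ` {1..<M}" "q' \<notin> f ` {1..<M}"
      using that(3) cd by (auto simp: doubleton_eq_iff)
    moreover have "f ` {a..<a + t - 1} \<subseteq> f ` {1..<M}" using that by (intro image_mono) auto
    ultimately have "joined (nat (a + t - 1 - a) + 3) x y"
      by (intro rainbow_path_joined[OF p' xy, of a "a + t - 1" q q']) (use that t in auto)
    then show ?thesis using t by (simp add: t_def nat_diff_distrib' nat_add_distrib)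
  qed
  have cdc: "{c, d} = {c, d}" "{d, c} = {c, d}" by auto
  show ?thesis
  \<comment> \<open>The segment \<open>v 1, \<dots>, v t\<close> serves unless it ends in the middle vertex \<open>v (D - 1)\<close>; then it is shifted by one.\<close>
  proof (cases "t = int D - 1")
    case False
    then show ?thesis
      using use[OF _ _ cdc(1), of 1] Esym[OF adj(1)[of 1 c]] Esym[OF adj(2)[of t d]] t nD2 n unfolding M_def by auto
  next
    case tD: True
    show ?thesis
    proof (cases "3 \<le> int D - 1")
      case True
      then have b: "2 \<in> {1..M}" "2 \<noteq> int D - 1" "2 + t - 1 \<in> {1..M}" "2 + t - 1 \<noteq> int D - 1"
        using t nD2 tD by auto
      show ?thesis
        by (rule use[OF _ _ cdc(1) Esym[OF adj(1)[OF b(1,2)]] Esym[OF adj(2)[OF b(3,4)]]]) (use b in auto)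
    next
      case False
      then have D3: "D = 3" "n = 5" "M = 3" "t = 2" using tD t nD2 unfolding M_def by linarith+
      \<comment> \<open>With three vertices every segment of two contains the middle one, but this is adjacent to \<open>x\<close> or \<open>y\<close>.\<close>
      have e: "{1..M} = {1,2,3}" using D3 by auto
      have im: "v ` {1,2,3} = V - {x, y}"
        using card_subset_eq[OF _ *(2)] finV rainbow_path_card(1)[OF p'] card_minus_pair[OF xy] D3 unfolding e by simp
      have v2: "v 2 \<in> V" using im by auto
      have V3: "V \<subseteq> v ` {1, 3} \<union> set [v 2, x, y]" using im by auto
      have "{1, 3} \<subseteq> {1..M}" unfolding e by simp
      then have inj3: "inj_on v {1, 3}" by (rule inj_on_subset[OF *(1)])
      have "D \<le> card {i \<in> {1, 3}. E c (v 2) (v i)} + of_bool (E c (v 2) x) + of_bool (E c (v 2) y)"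
        using degree_via_index_list[OF cd(1) v2 inj3 _ V3] Eirr[of c "v 2"] by simp
      moreover have "card {i \<in> {1, 3::int}. E c (v 2) (v i)} \<le> card {1, 3::int}" by (intro card_mono) auto
      ultimately consider "E c (v 2) x" | "E c (v 2) y" using D3 by (auto simp: of_bool_def split: if_splits)
      then show ?thesis
      proof cases
        case 1
        have b: "3 \<in> {1..M}" "3 \<noteq> int D - 1" using D3 by auto
        show ?thesis
          by (rule use[OF _ _ cdc(1) Esym[OF 1]]) (use D3 Esym[OF adj(2)[OF b]] in simp_all)
      next
        case 2
        have b: "1 \<in> {1..M}" "1 \<noteq> int D - 1" using D3 by auto
        show ?thesis
          by (rule use[OF _ _ cdc(2) Esym[OF adj(1)[OF b]]]) (use D3 Esym[OF 2] in simp_all)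
      qed
    qed
  qed
qed


text \<open>Let \<open>R z\<close> be the set of indices \<open>i\<close> such that \<open>z\<close> is adjacent to \<open>u i\<close> in the colour of the edge leaving \<open>u i\<close>.
Without a path on \<open>k\<close> vertices, \<open>R x\<close> and \<open>R y\<close> are small: that colour is always free for the arc
ending in \<open>u i\<close>.  Hence by averaging some vertex \<open>z\<close> of the cycle has a large \<open>R z\<close>.  Then the cycle is
cut open after \<open>z\<close>, and one of the chords at \<open>z\<close> closes it again, skipping one vertex.\<close>

lemma hamilton_cycle_shorten:
  assumes xy: "x \<in> V" "y \<in> V" "x \<noteq> y" and n: "5 \<le> n" and r: "rainbow_cycle (int n - 2) u f" "range u \<subseteq> V - {x, y}"
    and k: "3 \<le> k" "k \<le> n" and nj: "\<not> joined k x y"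
  shows "\<exists>u g. rainbow_cycle (int n - 3) u g \<and> range u \<subseteq> V - {x, y}"
proof -
  define m where "m = int n - 2"
  define s where "s = int k - 3"
  have s: "0 \<le> s" "s < m" "nat s + 3 = k" using k n by (auto simp: s_def m_def)
  note r1 = r(1)[folded m_def]
  have m: "1 \<le> m" "nat m = n - 2" using n by (auto simp: m_def)
  have fin: "finite (V - {x, y})" using finV by simp
  have ru: "range u = V - {x, y}"
    by (rule card_subset_eq[OF fin r(2)]) (use rainbow_cycle_range(3)[OF r1] card_minus_pair[OF xy] m in simp)
  have fK: "range f \<subseteq> K" using rainbow_cycleD(5)[OF r1] by auto
  have "card (range f) < card K" using rainbow_cycle_range(4)[OF r1] m cardK n by linarith
  then obtain c where c: "c \<in> K" "c \<notin> range f"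
    using element_outside[of "range f" K] finite_subset[OF fK finK] by blast
  define R where "R z = {i \<in> {0..<m}. E (f i) z (u i)}" for z
  have Rb: "card (R z) + D \<le> n - 1" if z: "z \<in> V" "z' \<in> V" "z' \<noteq> z" "\<not> joined k z' z" "range u = V - {z', z}" for z z'
  proof -
    define B where "B = {i \<in> {0..<m}. E c z' (u (i + - s))}"
    have r2: "rainbow_cycle m (\<lambda>i. u (i + - s)) (\<lambda>i. f (i + - s))" by (rule rainbow_cycle_shift[OF r1])
    have "range (\<lambda>i. u (i + - s)) = range u"
    proof (rule set_eqI, rule iffI)
      fix b assume "b \<in> range u"
      then obtain i where "b = u i" by blast
      then have "b = u (i + s + - s)" by simp
      then show "b \<in> range (\<lambda>i. u (i + - s))" by blast
    qed auto
    then have "V \<subseteq> (\<lambda>i. u (i + - s)) ` {0..<m} \<union> set [z', z]"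
      using rainbow_cycle_range(1)[OF r2, of 0] z(5) by auto
    moreover have "inj_on (\<lambda>i. u (i + - s)) {0..<m}" using rainbow_cycle_inj(1)[OF r2, of 0] by simp
    ultimately have "D \<le> card B + of_bool (E c z' z)"
      using degree_via_index_list[OF c(1) z(2), of "\<lambda>i. u (i + - s)" "{0..<m}" "[z', z]"] Eirr[of c z'] unfolding B_def by simp
    then have cB: "D \<le> card B + 1" by (auto simp: of_bool_def split: if_splits)
    have "card (R z) + card B \<le> card {0..<m}"
    proof (rule ccontr)
      assume "\<not> ?thesis"
      moreover have "R z \<subseteq> {0..<m}" "B \<subseteq> {0..<m}" unfolding R_def B_def by auto
      ultimately obtain i where i: "i \<in> R z" "i \<in> B"
        using subsets_meet[of "{0..<m}" "R z" B] by (auto simp: not_le)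
      then have Ei: "E (f i) z (u i)" "E c z' (u (i - s))" unfolding R_def B_def by auto
      have "f i \<notin> f ` {i - s..<i - s + s}"
      proof
        assume "f i \<in> f ` {i - s..<i - s + s}"
        then obtain l where "l \<in> {i - s..<i}" "f i = f l" by auto
        then show False using inj_onD[OF rainbow_cycle_inj(2)[OF r1, of "i - s"], of i l] s by auto
      qed
      moreover have "c \<notin> f ` {i - s..<i - s + s}" "c \<noteq> f i" using c by auto
      ultimately have "joined (nat s + 3) z' z"
        using joined_by_arc[OF r1 _ z(2,1,3) s(1,2) c(1), of "f i" "i - s"] z(5) Ei rainbow_cycleD(5)[OF r1, of i] by simp
      then show False using z(4) s(3) by simp
    qed
    then show ?thesis using cB m n by simp
  qed
  have "\<exists>j. n + 1 \<le> card (R (u j)) + D"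
  proof (rule ccontr)
    assume neg: "\<not> ?thesis"
    have small: "card (R z) \<le> n - D" if "z \<in> V - {x, y}" for z
    proof -
      from that obtain j where "z = u j" using ru by blast
      moreover have "\<not> n + 1 \<le> card (R (u j)) + D" using neg by blast
      ultimately show ?thesis by simp
    qed
    have "(n - 2) * D \<le> (\<Sum>z\<in>V. card (R z))"
      using sum_colour_degrees[of "{0..<m}" u f] rainbow_cycleD(4,5)[OF r1] m unfolding R_def by simp
    also have "V = insert x (insert y (V - {x, y}))" using xy by auto
    also have "(\<Sum>z\<in>\<dots>. card (R z)) = card (R x) + (card (R y) + (\<Sum>z\<in>V - {x, y}. card (R z)))"
      using fin xy by simp
    finally have 2: "(n - 2) * D \<le> card (R x) + (card (R y) + (\<Sum>z\<in>V - {x, y}. card (R z)))" .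
    have 1: "(\<Sum>z\<in>V - {x, y}. card (R z)) \<le> (n - 2) * (n - D)"
      using sum_bounded_above[of "V - {x, y}" "\<lambda>z. card (R z)" "n - D"] small card_minus_pair[OF xy] by simp
    have "(n - 2) * (n - D + 1) \<le> (n - 2) * D" using degree_bounds n by (intro mult_le_mono2) auto
    then have 3: "(n - 2) * (n - D) + (n - 2) \<le> (n - 2) * D" by (simp only: add_mult_distrib2 mult_1_right)
    have "card (R x) + D \<le> n - 1" "card (R y) + D \<le> n - 1"
      using Rb[OF xy(1,2) xy(3)[symmetric]] Rb[OF xy(2,1) xy(3)] nj joined_sym ru by (auto simp: insert_commute)
    then show False using 1 2 3 degree_bounds n by linarith
  qed
  then obtain j where j: "n + 1 \<le> card (R (u j)) + D" by blast
  define v where "v i = u (i + j)" for i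
  define h where "h i = f (i + j)" for i
  have r3: "rainbow_cycle m v h" unfolding v_def h_def by (rule rainbow_cycle_shift[OF r1])
  have p: "rainbow_path m v h (V - {x, y})" unfolding v_def h_def by (rule rainbow_cycle_fpath[OF r1 r(2)]) auto
  have v0: "v m = u j" "v 0 = u j" using rainbow_cycleD(2)[OF r1, of "m + j" j] by (simp_all add: v_def)
  have vim: "v ` {1..m} = V - {x, y}"
  proof -
    have "{1..m} = {1..<1 + m}" by auto
    moreover have "range v = range u" unfolding v_def
      using rainbow_cycle_range(3)[OF r3] rainbow_cycle_range(3)[OF r1] finite_subset[OF r(2) fin]
      by (intro card_subset_eq) (auto simp: v_def[abs_def])
    ultimately show ?thesis using rainbow_cycle_range(1)[OF r3, of 1] ru by simp
  qed
  define A where "A = {i \<in> {1..m - 2}. E (h i) (v m) (v i)}"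
  define B where "B = {i \<in> {1..m - 2}. E c (v 1) (v (i + 2))}"
  have "card (R (u j)) = card {i \<in> {0..<m}. E (f (i + j)) (u j) (u (i + j))}"
    unfolding R_def
  proof (rule periodic_card[OF m(1), symmetric])
    fix i l assume "m dvd i - l" "E (f i) (u j) (u i)"
    then show "E (f l) (u j) (u l)" using rainbow_cycleD(2,3)[OF r1, of i l] by simp
  qed
  also have "\<dots> \<le> card (insert (m - 1) A)"
  proof (rule card_mono)
    show "finite (insert (m - 1) A)" unfolding A_def by (auto intro: finite_subset[of _ "{1..m - 2}"])
    show "{i \<in> {0..<m}. E (f (i + j)) (u j) (u (i + j))} \<subseteq> insert (m - 1) A"
    proof
      fix i assume i: "i \<in> {i \<in> {0..<m}. E (f (i + j)) (u j) (u (i + j))}"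
      then have "i \<noteq> 0" using Eirr by auto
      then show "i \<in> insert (m - 1) A" using i unfolding A_def v_def h_def v0(1)[unfolded v_def] by auto
    qed
  qed
  also have "\<dots> \<le> card A + 1"
  proof -
    have "finite A" by (rule finite_subset[of _ "{1..m - 2}"]) (auto simp: A_def)
    then show ?thesis by (simp add: card_insert_if)
  qed
  finally have cA: "n \<le> card A + D" using j by simp
  have v1: "v 1 \<in> V" by (rule rainbow_cycleD(4)[OF r3])
  have "V \<subseteq> (\<lambda>i. v (i + 2)) ` {1..m - 2} \<union> set [v 1, v 2, x, y]"
  proof
    fix z assume "z \<in> V"
    then consider "z = x" | "z = y" | i where "i \<in> {1..m}" "z = v i" using vim by blast
    then show "z \<in> (\<lambda>i. v (i + 2)) ` {1..m - 2} \<union> set [v 1, v 2, x, y]"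
    proof cases
      case (3 i)
      then consider "i = 1" | "i = 2" | "i - 2 \<in> {1..m - 2}" by fastforce
      then show ?thesis using 3 by cases (auto intro!: image_eqI[of _ _ "i - 2"])
    qed simp_all
  qed
  moreover have "inj_on (\<lambda>i. v (i + 2)) {1..m - 2}"
  proof (rule inj_onI)
    fix a b assume "a \<in> {1..m - 2}" "b \<in> {1..m - 2}" "v (a + 2) = v (b + 2)"
    then show "a = b" using inj_onD[OF rainbow_cycle_inj(1)[OF r3, of 1], of "a + 2" "b + 2"] by auto
  qed
  ultimately have "D \<le> card B + of_bool (E c (v 1) (v 2)) + of_bool (E c (v 1) x) + of_bool (E c (v 1) y)"
    using degree_via_index_list[OF c(1) v1, of "\<lambda>i. v (i + 2)" "{1..m - 2}" "[v 1, v 2, x, y]"] Eirr[of c "v 1"]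
    unfolding B_def by simp
  then have cB: "D \<le> card B + 3" by (auto simp: of_bool_def split: if_splits)
  have "card {1..m - 2} = n - 4" using n by (simp add: m_def)
  then have "card {1..m - 2} < card A + card B" using cA cB degree_bounds n by linarith
  then obtain i where i: "i \<in> A" "i \<in> B"
    using subsets_meet[of "{1..m - 2}" A B] unfolding A_def B_def by blast
  then have i: "1 \<le> i" "i + 2 \<le> m" and Ei: "E (h i) (v m) (v i)" "E c (v 1) (v (i + 2))"
    unfolding A_def B_def by auto
  have hi: "h i \<notin> h ` ({1..<i} \<union> {i + 2..<m})"
  proof
    assume "h i \<in> h ` ({1..<i} \<union> {i + 2..<m})"
    then obtain l where "l \<in> {1..<i} \<union> {i + 2..<m}" "h i = h l" by blast
    then show False using inj_onD[OF rainbow_cycle_inj(2)[OF r3, of 1], of i l] i by auto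
  qed
  have cn: "c \<notin> h ` ({1..<i} \<union> {i + 2..<m})" "c \<noteq> h i" using c unfolding h_def by auto
  obtain u' g where u': "rainbow_cycle (m - (i + 2 - i - 1)) u' g" "range u' = v ` ({1..i} \<union> {i + 2..m})"
    using close_path[OF p i(1) _ i(2) c(1) rainbow_cycleD(5)[OF r3] cn(2,1) hi Ei(2) Esym[OF Ei(1)]] by auto
  have "v ` ({1..i} \<union> {i + 2..m}) \<subseteq> v ` {1..m}" using i by (intro image_mono) auto
  then have "range u' \<subseteq> V - {x, y}" using vim u'(2) by simp
  moreover have "m - (i + 2 - i - 1) = int n - 3" by (simp add: m_def)
  ultimately show ?thesis using u'(1) by metis
qed

lemma near_cycle_exists:
  assumes xy: "x \<in> V" "y \<in> V" "x \<noteq> y" and n: "5 \<le> n" and k: "4 \<le> k" "k \<le> n - 1" and nj: "\<not> joined k x y"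
  shows "\<exists>u g. rainbow_cycle (int n - 3) u g \<and> range u \<subseteq> V - {x, y}"
proof (rule ccontr)
  assume no: "\<not> ?thesis"
  have k': "3 \<le> k" "k \<le> n" using k by linarith+
  have no2: False if "rainbow_cycle (int n - 2) u g" "range u \<subseteq> V - {x, y}" for u g
    by (rule notE[OF no hamilton_cycle_shorten[OF xy n that k' nj]])
  have no3: False if "rainbow_cycle (int n - 3) u g" "range u \<subseteq> V - {x, y}" for u g
    by (rule notE[OF no], rule exI[of _ u], rule exI[of _ g], rule conjI[OF that])
  have "3 \<le> n" using n by simp
  then obtain v f where p: "rainbow_path (int n - 2) v f (V - {x, y})" using spanning_path[OF xy] by metis
  show False by (rule notE[OF nj block_joined[OF xy n p no2 no3 k]])
qed

end

section \<open>Two vertices not joined by a path of given length\<close>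

lemma alternating_parity:
  fixes P :: "int \<Rightarrow> bool"
  assumes "\<And>p. P (p + 1) \<longleftrightarrow> \<not> P p"
  shows "P k \<longleftrightarrow> (even (k - i) \<longleftrightarrow> P i)"
proof (induction k rule: int_induct[where k = i])
  case (step1 k)
  have "even (k + 1 - i) \<longleftrightarrow> \<not> even (k - i)" by presburger
  then show ?case using assms[of k] step1.IH by blast
next
  case (step2 k)
  have "even (k - i) \<longleftrightarrow> \<not> even (k - 1 - i)" by presburger
  then show ?case using assms[of "k - 1"] step2.IH by auto
qed simp

text \<open>The missing length is expressed by the number \<open>s\<close> of edges of an arc between a neighbour of \<open>x\<close> and a
neighbour of \<open>y\<close>; the resulting path has \<open>s + 3\<close> vertices.\<close>

locale unjoined_pair = graph_system V K E n D for V :: "'a set" and K :: "'c set" and E and n D +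
  fixes x y :: 'a and s :: int
  assumes xV: "x \<in> V" and yV: "y \<in> V" and xy: "x \<noteq> y" and n5: "5 \<le> n"
    and s1: "1 \<le> s" and sn: "s \<le> int n - 4" and unjoined: "\<not> joined (nat s + 3) x y"
begin

lemma swapped: "unjoined_pair V K E n D y x s"
  by unfold_locales (use xV yV xy n5 s1 sn unjoined joined_sym in blast)+

text \<open>The cycle uses \<open>n - 3\<close> of the \<open>n - 1\<close> colours, so \<open>c\<close> and \<open>d\<close> are the only ones left for the edges at \<open>x\<close>, \<open>y\<close> and
\<open>w\<close>, apart from the colours of edges of the cycle that a path leaves out.\<close>

definition frame :: "(int \<Rightarrow> 'a) \<Rightarrow> (int \<Rightarrow> 'c) \<Rightarrow> 'a \<Rightarrow> 'c \<Rightarrow> 'c \<Rightarrow> bool" where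
  "frame u f w c d \<longleftrightarrow> rainbow_cycle (int n - 3) u f \<and> range u = V - {x, y, w} \<and> w \<in> V \<and> w \<noteq> x \<and> w \<noteq> y
     \<and> c \<in> K \<and> d \<in> K \<and> c \<noteq> d \<and> c \<notin> range f \<and> d \<notin> range f"

text \<open>The situation is symmetric in \<open>x\<close> and \<open>y\<close>, in the two spare colours, and under reversal of the cycle.
These symmetries are used throughout.\<close>

lemma frame_swap_pair: "frame u f w c d \<Longrightarrow> unjoined_pair.frame V K E n y x u f w c d"
  unfolding frame_def unjoined_pair.frame_def[OF swapped] by (auto simp: insert_commute)

lemma frame_swap_colours: "frame u f w c d \<Longrightarrow> frame u f w d c"
  unfolding frame_def by auto

lemma frame_rev: "frame u f w c d \<Longrightarrow> frame (\<lambda>i. u (- i)) (\<lambda>i. f (- i - 1)) w c d"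
proof -
  have r: "range (\<lambda>i. u (- i)) = range u" for u :: "int \<Rightarrow> 'a"
  proof (rule set_eqI, rule iffI)
    fix z assume "z \<in> range u"
    then obtain i where "z = u i" by blast
    then have "z = u (- (- i))" by simp
    then show "z \<in> range (\<lambda>i. u (- i))" by blast
  qed auto
  have f: "z \<notin> range f \<Longrightarrow> z \<notin> range (\<lambda>i. f (- i - 1))" for f :: "int \<Rightarrow> 'c" and z by auto
  show "frame u f w c d \<Longrightarrow> ?thesis"
    unfolding frame_def r by (elim conjE) (intro conjI rainbow_cycle_rev f; assumption)
qed

lemma frameD:
  assumes "frame u f w c d"
  shows "rainbow_cycle (int n - 3) u f" "range u = V - {x, y, w}" "w \<in> V" "w \<noteq> x" "w \<noteq> y"
    "c \<in> K" "d \<in> K" "c \<noteq> d" "c \<notin> range f" "d \<notin> range f" "range u \<subseteq> V - {x, y}" "u i \<in> V" "u i \<noteq> x" "u i \<noteq> y" "u i \<noteq> w"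
proof -
  note F = assms[unfolded frame_def]
  show "rainbow_cycle (int n - 3) u f" "range u = V - {x, y, w}" "w \<in> V" "w \<noteq> x" "w \<noteq> y"
    "c \<in> K" "d \<in> K" "c \<noteq> d" "c \<notin> range f" "d \<notin> range f"
    using F by simp_all
  then show "range u \<subseteq> V - {x, y}" by auto
  have "u i \<in> V - {x, y, w}" using F by blast
  then show "u i \<in> V" "u i \<noteq> x" "u i \<noteq> y" "u i \<noteq> w" by simp_all
qed

lemma frame_count:
  assumes "frame u f w c d" "q \<in> K" "z \<in> V"
  shows "D \<le> card {i \<in> {a..<a + (int n - 3)}. E q z (u i)} + of_bool (E q z x) + of_bool (E q z y) + of_bool (E q z w)"
proof -
  have "V \<subseteq> u ` {a..<a + (int n - 3)} \<union> set [x, y, w]"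
    using rainbow_cycle_range(1)[OF frameD(1)[OF assms(1)], of a] frameD(2)[OF assms(1)] by auto
  from degree_via_index_list[OF assms(2,3) rainbow_cycle_inj(1)[OF frameD(1)[OF assms(1)]] _ this] show ?thesis by simp
qed

lemma frame_exists: "\<exists>u f w c d. frame u f w c d"
proof -
  have k: "4 \<le> nat s + 3" "nat s + 3 \<le> n - 1" using s1 sn n5 by auto
  obtain u g where ug: "rainbow_cycle (int n - 3) u g" "range u \<subseteq> V - {x, y}"
    using near_cycle_exists[OF xV yV xy n5 k unjoined] by metis
  have cg: "card (range u) = n - 3" "card (range g) = n - 3" using rainbow_cycle_range[OF ug(1)] by simp_all
  have fin: "finite (range u)" "finite (range g)"
    using ug(2) finV finK rainbow_cycleD(5)[OF ug(1)] by (auto intro: finite_subset[of _ V] finite_subset[of _ K])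
  obtain w where w: "w \<in> V - {x, y}" "w \<notin> range u"
  proof -
    have "card (range u) < card (V - {x, y})" unfolding cg card_minus_pair[OF xV yV xy] using n5 by simp
    then show thesis using element_outside[OF fin(1)] that by blast
  qed
  have "card (V - {x, y, w}) = n - 3"
    using w(1) xV yV xy cardV finV card_Diff_subset[of "{x, y, w}" V] by auto
  then have "range u = V - {x, y, w}"
    using card_subset_eq[of "V - {x, y, w}" "range u"] cg finV ug(2) w by auto
  moreover have "2 \<le> card (K - range g)"
  proof -
    have "range g \<subseteq> K" using rainbow_cycleD(5)[OF ug(1)] by auto
    then show ?thesis using card_Diff_subset[of "range g" K] fin cg cardK n5 by simp
  qed
  then obtain c d where "c \<in> K - range g" "d \<in> K - range g" "c \<noteq> d" using two_elements by blast
  ultimately have "frame u g w c d" using ug w unfolding frame_def by blast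
  then show ?thesis by blast
qed

text \<open>The indices \<open>j\<close> with \<open>x\<close> adjacent to \<open>u j\<close> in colour \<open>c\<close> and those with \<open>y\<close> adjacent to \<open>u (j + s)\<close> in colour \<open>d\<close> are
disjoint, since otherwise an arc joins \<open>x\<close> and \<open>y\<close>.  Both sets have at least \<open>D - 2\<close> elements, and
\<open>2 * (D - 2) \<ge> n - 3\<close>.  So equality holds everywhere.\<close>

lemma frame_basic:
  assumes F: "frame u f w c d"
  shows "int n + 1 = 2 * int D" "E c x (u j) \<longleftrightarrow> \<not> E d y (u (j + s))" "E c x y" "E c x w"
    "card {i \<in> {0..<int n - 3}. E c x (u i)} = D - 2"
proof -
  define L where "L = int n - 3"
  note fr = frameD[OF F]
  have r: "rainbow_cycle L u f" using fr(1) by (simp add: L_def)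
  have L: "1 \<le> L" "nat L = n - 3" "s < L" using rainbow_cycleD(1)[OF r] sn by (auto simp: L_def)
  define A where "A = {i \<in> {0..<L}. E c x (u i)}"
  define B where "B = {i \<in> {0..<L}. E d y (u (i + s))}"
  have cA: "D \<le> card A + of_bool (E c x y) + of_bool (E c x w)"
    using frame_count[OF F fr(6) xV, of 0] Eirr[of c x] unfolding A_def L_def by simp
  have "D \<le> card {i \<in> {0..<L}. E d y (u i)} + of_bool (E d y x) + of_bool (E d y w)"
    using frame_count[OF F fr(7) yV, of 0] Eirr[of d y] unfolding L_def by simp
  also have "card {i \<in> {0..<L}. E d y (u i)} = card B"
    unfolding B_def
  proof (rule periodic_card[OF L(1), symmetric])
    fix i l assume "L dvd i - l" "E d y (u i)"
    then show "E d y (u l)" using rainbow_cycleD(2)[OF r, of i l] by simp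
  qed
  finally have cB: "D \<le> card B + of_bool (E d y x) + of_bool (E d y w)" .
  have sub: "A \<subseteq> {0..<L}" "B \<subseteq> {0..<L}" unfolding A_def B_def by auto
  then have fin: "finite A" "finite B" using finite_subset by blast+
  have disj: "A \<inter> B = {}"
  proof (rule ccontr)
    assume "A \<inter> B \<noteq> {}"
    then obtain i where i: "E c x (u i)" "E d y (u (i + s))" unfolding A_def B_def by blast
    have "joined (nat s + 3) x y"
      by (rule joined_by_arc[OF r fr(11) xV yV xy _ _ fr(6-8) _ _ i]) (use s1 L fr(9,10) in auto)
    then show False using unjoined by blast
  qed
  have cAB: "card A + card B = card (A \<union> B)" using fin disj by (simp add: card_Un_disjoint)
  also have "\<dots> \<le> card {0..<L}" using sub by (intro card_mono) auto
  finally have le: "card A + card B \<le> n - 3" using L by simp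
  have b: "of_bool P \<le> (1::nat)" for P by simp
  have cA2: "D \<le> card A + 2" and cB2: "D \<le> card B + 2"
    using cA cB b[of "E c x y"] b[of "E c x w"] b[of "E d y x"] b[of "E d y w"] by linarith+
  have eq: "card A + 2 = D" "card B + 2 = D" "n + 1 = 2 * D" using le cA2 cB2 degree_bounds n5 by linarith+
  show "int n + 1 = 2 * int D" using eq(3) by linarith
  show "E c x y" "E c x w" using cA eq(1) by (auto simp: of_bool_def split: if_splits)
  show "card {i \<in> {0..<int n - 3}. E c x (u i)} = D - 2" using eq(1) unfolding A_def L_def by simp
  have AB: "A \<union> B = {0..<L}"
    by (rule card_subset_eq) (use sub cAB eq n5 L in auto)
  obtain i where i: "i \<in> {0..<0 + L}" "L dvd j - i" using mod_window[OF L(1), of 0 j] by blast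
  have "i \<in> A \<longleftrightarrow> i \<notin> B" using AB disj i(1) by auto
  then have "E c x (u i) \<longleftrightarrow> \<not> E d y (u (i + s))" using i(1) unfolding A_def B_def by auto
  moreover have "u j = u i" "u (j + s) = u (i + s)" using rainbow_cycleD(2)[OF r, of j i] rainbow_cycleD(2)[OF r, of "j + s" "i + s"] i(2) by auto
  ultimately show "E c x (u j) \<longleftrightarrow> \<not> E d y (u (j + s))" by simp
qed

lemma frame_spare:
  assumes F: "frame u f w c d"
  shows "E c x y" "E c x w" "E c y w" "E d x y" "E d x w" "E d y w"
  using frame_basic(3,4)[OF F] frame_basic(3,4)[OF frame_swap_colours[OF F]]
    unjoined_pair.frame_basic(4)[OF swapped frame_swap_pair[OF F]]
    unjoined_pair.frame_basic(4)[OF swapped frame_swap_pair[OF frame_swap_colours[OF F]]]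
  by simp_all

text \<open>On a frame that misses \<open>w\<close>, these are the neighbours of \<open>z\<close> off the cycle.\<close>

definition outer :: "'c \<Rightarrow> 'a \<Rightarrow> 'a \<Rightarrow> nat" where
  "outer q w z = of_bool (E q z x) + of_bool (E q z y) + of_bool (E q z w)"

text \<open>The cycle is cut at the edges leaving \<open>u j\<close> and \<open>u i\<close> and closed by the chord between \<open>u j\<close> and \<open>u i\<close> in
colour \<open>c\<close> and the chord between their successors in colour \<open>d\<close>.  If \<open>u j\<close> and its successor have few
neighbours off the cycle, they have enough neighbours on it for a suitable \<open>i\<close> to exist.  The two edges
cut give the new spare colours.  That \<open>u i\<close> and \<open>u (i - 1)\<close> remain neighbours on the new cycle is needed
in the proof that \<open>s\<close> is odd.\<close>

lemma frame_exchange: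
  assumes F: "frame u f w c d" and o: "outer c w (u j) + outer d w (u (j + 1)) \<le> 4"
  shows "\<exists>i u' f' a b. frame u' f' w (f i) (f j) \<and> u' a = u i \<and> u' b = u (i - 1) \<and> \<bar>a - b\<bar> = 1"
proof -
  define L where "L = int n - 3"
  note fr = frameD[OF F]
  have r: "rainbow_cycle L u f" using fr(1) by (simp add: L_def)
  have L: "1 \<le> L" using rainbow_cycleD(1)[OF r] .
  define v where "v i = u (i + j)" for i
  define h where "h i = f (i + j)" for i
  have r3: "rainbow_cycle L v h" unfolding v_def h_def by (rule rainbow_cycle_shift[OF r])
  have p: "rainbow_path L v h (V - {x, y})" unfolding v_def h_def by (rule rainbow_cycle_fpath[OF r fr(11)]) auto
  have vL: "v L = u j" "h L = f j" "v 0 = u j"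
    using rainbow_cycleD(2)[OF r, of "L + j" j] rainbow_cycleD(3)[OF r, of "L + j" j] by (simp_all add: v_def h_def)
  have rv: "range v = range u"
  proof (rule set_eqI, rule iffI)
    fix z assume "z \<in> range u"
    then obtain i where "z = u i" by blast
    then have "z = v (i - j)" by (simp add: v_def)
    then show "z \<in> range v" by blast
  qed (auto simp: v_def)
  have vim: "v ` {1..L} = V - {x, y, w}"
  proof -
    have e: "{1..L} = {1..<1 + L}" by auto
    show ?thesis unfolding e rainbow_cycle_range(1)[OF r3, of 1, symmetric] rv fr(2) ..
  qed
  define A where "A = {a \<in> {1..L - 1}. E c (u j) (v a)}"
  define B where "B = {a \<in> {1..L - 1}. E d (u (j + 1)) (v (a + 1))}"
  have cA: "D \<le> card A + outer c w (u j)"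
  proof -
    have e: "{1..L} = insert L {1..L - 1}" using L by auto
    have "V \<subseteq> v ` {1..L - 1} \<union> set [v L, x, y, w]" using vim unfolding e by auto
    moreover have "inj_on v {1..L - 1}"
      by (rule inj_on_subset[OF rainbow_cycle_inj(1)[OF r3, of 1]]) auto
    ultimately show ?thesis
      using degree_via_index_list[OF fr(6) fr(12)[of j], of v "{1..L - 1}" "[v L, x, y, w]"] Eirr[of c "u j"]
      unfolding A_def outer_def vL by simp
  qed
  have cB: "D \<le> card B + outer d w (u (j + 1))"
  proof -
    have "V \<subseteq> (\<lambda>a. v (a + 1)) ` {1..L - 1} \<union> set [v 1, x, y, w]"
    proof
      fix z assume "z \<in> V"
      then consider "z = x" | "z = y" | "z = w" | i where "i \<in> {1..L}" "z = v i" using vim by blast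
      then show "z \<in> (\<lambda>i. v (i + 1)) ` {1..L - 1} \<union> set [v 1, x, y, w]"
      proof cases
        case (4 i)
        then show ?thesis by (cases "i = 1") (auto intro!: image_eqI[of _ _ "i - 1"])
      qed simp_all
    qed
    moreover have "inj_on (\<lambda>a. v (a + 1)) {1..L - 1}"
    proof (rule inj_onI)
      fix a b assume "a \<in> {1..L - 1}" "b \<in> {1..L - 1}" "v (a + 1) = v (b + 1)"
      then show "a = b" using inj_onD[OF rainbow_cycle_inj(1)[OF r3, of 1], of "a + 1" "b + 1"] by auto
    qed
    moreover have "v 1 = u (j + 1)" by (simp add: v_def add.commute)
    ultimately show ?thesis
      using degree_via_index_list[OF fr(7) fr(12)[of "j + 1"], of "\<lambda>a. v (a + 1)" "{1..L - 1}" "[v 1, x, y, w]"] Eirr[of d "u (j + 1)"]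
      unfolding B_def outer_def by simp
  qed
  have "card {1..L - 1} = n - 4" using n5 by (simp add: L_def)
  then have "card {1..L - 1} < card A + card B" using cA cB o degree_bounds n5 by linarith
  then obtain a where a: "a \<in> A" "a \<in> B"
    using subsets_meet[of "{1..L - 1}" A B] unfolding A_def B_def by blast
  then have a1: "1 \<le> a" "a + 1 \<le> L" and Ea: "E c (v a) (v L)" "E d (v 1) (v (a + 1))"
    using Esym[of c "u j" "v a"] unfolding A_def B_def vL by (auto simp: v_def add.commute)
  have sp: "c \<notin> h ` ({1..<a} \<union> {a + 1..<L})" "d \<notin> h ` ({1..<a} \<union> {a + 1..<L})"
    using fr(9,10) unfolding h_def by auto
  have e: "L - (a + 1 - a - 1) = L" "{1..a} \<union> {a + 1..L} = {1..L}" using a1 by auto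
  obtain u' g where u': "rainbow_cycle L u' g" "range u' = v ` {1..L}" "range g = h ` ({1..<a} \<union> {a + 1..<L}) \<union> {d, c}"
    "\<And>k. k \<in> {1..a} \<Longrightarrow> u' (k - 1) = v k" "u' a = v L"
    using close_path[OF p a1(1) _ a1(2) fr(7,6) fr(8)[symmetric] sp(2,1) Ea(2,1)] unfolding e by auto
  have hn: "h l \<notin> range g" if "l = a \<or> l = L" for l
  proof
    assume "h l \<in> range g"
    then have "h l \<in> h ` ({1..<a} \<union> {a + 1..<L})"
      unfolding u'(3) using fr(9,10) by (auto simp: h_def)
    then obtain l' where "l' \<in> {1..<a} \<union> {a + 1..<L}" "h l = h l'" by blast
    then show False using inj_onD[OF rainbow_cycle_inj(2)[OF r3, of 1], of l l'] a1 that by auto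
  qed
  have "h a \<noteq> h L"
    using inj_onD[OF rainbow_cycle_inj(2)[OF r3, of 1], of a L] a1 by auto
  then have "frame u' g w (h a) (h L)"
    unfolding frame_def using u'(1,2) hn[of a] hn[of L] vim fr(3-5) rainbow_cycleD(5)[OF r3] by (simp add: L_def)
  then have fr': "frame u' g w (f (a + j)) (f j)" using vL by (simp add: h_def)
  show ?thesis
  proof (cases "a = 1")
    case True
    have "u' 0 = u (a + j)" "u' 1 = u (a + j - 1)"
      using u'(4)[of 1] u'(5) True vL by (simp_all add: v_def)
    then show ?thesis using fr' by (intro exI[of _ "a + j"] exI[of _ u'] exI[of _ g] exI[of _ 0] exI[of _ 1]) simp
  next
    case False
    then have "u' (a - 1) = u (a + j)" "u' (a - 2) = u (a + j - 1)"
      using u'(4)[of a] u'(4)[of "a - 1"] a1 by (simp_all add: v_def algebra_simps)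
    then show ?thesis using fr' by (intro exI[of _ "a + j"] exI[of _ u'] exI[of _ g] exI[of _ "a - 1"] exI[of _ "a - 2"]) simp
  qed
qed


section \<open>Rigidity of the cycle\<close>

text \<open>If neither edge can be made spare, the four vertices involved have at least \<open>20\<close> neighbours off the cycle,
counted with multiplicity in both spare colours.  But the complementarity at distance \<open>s\<close> allows each of the two pairs
\<open>u i\<close>, \<open>u (i + s)\<close> only four neighbours among \<open>x\<close> and \<open>y\<close>, and at most four adjacencies to \<open>w\<close>, which
makes \<open>16\<close>.\<close>

lemma spare_one_of_two:
  assumes F: "frame u f w c d"
  shows "\<exists>j'\<in>{j, j + s}. \<exists>i u' f' a b. frame u' f' w (f i) (f j') \<and> u' a = u i \<and> u' b = u (i - 1) \<and> \<bar>a - b\<bar> = 1"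
proof (rule ccontr)
  assume neg: "\<not> ?thesis"
  have big: "5 \<le> outer c w (u j') + outer d w (u (j' + 1))" if "j' \<in> {j, j + s}" for j'
  proof (rule ccontr)
    assume "\<not> ?thesis"
    then have "outer c w (u j') + outer d w (u (j' + 1)) \<le> 4" by simp
    from frame_exchange[OF F this] show False using neg that(1) by blast
  qed
  have big2: "5 \<le> outer d w (u j') + outer c w (u (j' + 1))" if "j' \<in> {j, j + s}" for j'
  proof (rule ccontr)
    assume "\<not> ?thesis"
    then have "outer d w (u j') + outer c w (u (j' + 1)) \<le> 4" by simp
    from frame_exchange[OF frame_swap_colours[OF F] this] show False using neg that(1) by blast
  qed
  have rel: "E c x (u i) \<longleftrightarrow> \<not> E d y (u (i + s))" "E d x (u i) \<longleftrightarrow> \<not> E c y (u (i + s))"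
    "E c y (u i) \<longleftrightarrow> \<not> E d x (u (i + s))" "E d y (u i) \<longleftrightarrow> \<not> E c x (u (i + s))" for i
    by (rule frame_basic(2)[OF F], rule frame_basic(2)[OF frame_swap_colours[OF F]],
      rule unjoined_pair.frame_basic(2)[OF swapped frame_swap_pair[OF F]],
      rule unjoined_pair.frame_basic(2)[OF swapped frame_swap_pair[OF frame_swap_colours[OF F]]])
  have sum: "outer c w (u i) + outer d w (u i) + (outer c w (u (i + s)) + outer d w (u (i + s))) \<le> 8" for i
  proof -
    have b: "of_bool P \<le> (1::nat)" for P by simp
    have n: "of_bool P + of_bool Q = (1::nat)" if "P \<longleftrightarrow> \<not> Q" for P Q using that by (cases Q) simp_all
    have sy: "E q (u k) z \<longleftrightarrow> E q z (u k)" for q k z by (rule Esym_iff)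
    show ?thesis
      unfolding outer_def
      using n[OF rel(1)[of i]] n[OF rel(2)[of i]] n[OF rel(3)[of i]] n[OF rel(4)[of i]]
        b[of "E c (u i) w"] b[of "E d (u i) w"] b[of "E c (u (i + s)) w"] b[of "E d (u (i + s)) w"]
      unfolding sy[of _ _ x] sy[of _ _ y] by linarith
  qed
  have e: "j + s + 1 = j + 1 + s" by simp
  show False
    using big[of j] big[of "j + s"] big2[of j] big2[of "j + s"] sum[of j] sum[of "j + 1"] unfolding e by simp
qed

text \<open>Otherwise \<open>y\<close> is adjacent to \<open>u (p - 1 + s)\<close> in colour \<open>d\<close>, and a path runs from \<open>x\<close> to \<open>w\<close>, then in colour \<open>c\<close> to
\<open>u p\<close>, along the cycle, and in colour \<open>d\<close> to \<open>y\<close>.  Both spare colours are taken, so the first edge needs a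
colour of the cycle.  The edges at \<open>p - 1\<close> and at \<open>p - 1 + s\<close> are both left out, and one of them can be
made spare, so that \<open>x\<close> is adjacent to \<open>w\<close> in its colour.\<close>

lemma w_predecessor:
  assumes F: "frame u f w c d" and Ew: "E c w (u p)"
  shows "E c x (u (p - 1))"
proof (rule ccontr)
  assume "\<not> ?thesis"
  then have Ey: "E d y (u (p - 1 + s))" using frame_basic(2)[OF F, of "p - 1"] by blast
  note fr = frameD[OF F]
  define L where "L = int n - 3"
  have r: "rainbow_cycle L u f" using fr(1) by (simp add: L_def)
  have sL: "s < L" using sn by (simp add: L_def)
  obtain q j where j: "j \<in> {p - 1, p - 1 + s}" and q: "q = f j" "E q x w"
  proof -
    obtain j i u' f' where "j \<in> {p - 1, p - 1 + s}" "frame u' f' w (f i) (f j)"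
      using spare_one_of_two[OF F, of "p - 1"] by blast
    then show thesis using that[OF _ refl frame_spare(5)] by blast
  qed
  have fp: "rainbow_path L (\<lambda>i. u (i + (p - 1))) (\<lambda>i. f (i + (p - 1))) (V - {x, y})" by (rule rainbow_cycle_fpath[OF r fr(11)]) auto
  have wn: "w \<notin> (\<lambda>i. u (i + (p - 1))) ` {1..L}" using fr(15) by auto
  have fq: "f (i + (p - 1)) \<noteq> q" if "i \<in> {1..<s}" for i
  proof
    assume "f (i + (p - 1)) = q"
    then have "f (i + (p - 1)) = f j" using q by simp
    then show False
      using inj_onD[OF rainbow_cycle_inj(2)[OF r, of "p - 1"], of "i + (p - 1)" j] that j s1 sL by auto
  qed
  have "joined (nat (s + 1 - 1) + 3) x y"
  proof (rule rainbow_path_joined[OF rainbow_path_cons[OF fp _ wn fr(6)] xV yV xy, where c = q and d = d])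
    show "w \<in> V - {x, y}" using fr by simp
    show "c \<notin> (\<lambda>i. f (i + (p - 1))) ` {1..<L}" using fr(9) by auto
    show "E c w (u (1 + (p - 1)))" using Ew by simp
    show "1 \<le> (1::int)" "1 \<le> s + 1" "s + 1 \<le> L + 1" using s1 sL by auto
    show "q \<in> K" "d \<in> K" using rainbow_cycleD(5)[OF r] q fr by auto
    show "q \<noteq> d" using q fr(10) by auto
    show "q \<notin> insert_at 0 c (\<lambda>i. f (i + (p - 1))) ` {1..<s + 1}"
    proof
      assume "q \<in> insert_at 0 c (\<lambda>i. f (i + (p - 1))) ` {1..<s + 1}"
      then obtain i where i: "i \<in> {1..<s + 1}" "q = insert_at 0 c (\<lambda>i. f (i + (p - 1))) i" by blast
      show False
      proof (cases "i = 1")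
        case True
        then show False using i q fr(9) by (auto simp: insert_at_def)
      next
        case False
        then show False using i fq[of "i - 1"] by (auto simp: insert_at_def)
      qed
    qed
    show "d \<notin> insert_at 0 c (\<lambda>i. f (i + (p - 1))) ` {1..<s + 1}"
      using fr(8,10) by (auto simp: insert_at_def)
    show "E q x (insert_at 0 w (\<lambda>i. u (i + (p - 1))) 1)" using q by (simp add: insert_at_def)
    show "E d y (insert_at 0 w (\<lambda>i. u (i + (p - 1))) (s + 1))" using Ey s1 by (simp add: insert_at_def algebra_simps)
  qed
  then show False using unjoined by simp
qed

lemma w_successor:
  assumes F: "frame u f w c d" and Ew: "E c w (u p)"
  shows "E c x (u (p + 1))"
  using w_predecessor[OF frame_rev[OF F], of "- p"] Ew by (simp add: add.commute)

text \<open>The inclusions of the previous two lemmas are equalities since \<open>w\<close> has at least as many neighbours on the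
cycle as \<open>x\<close>.\<close>

lemma frame_alternating_w:
  assumes F: "frame u f w c d"
  shows "E c w (u p) \<longleftrightarrow> E c x (u (p - 1))" "E c w (u p) \<longleftrightarrow> E c x (u (p + 1))"
proof -
  define L where "L = int n - 3"
  note fr = frameD[OF F]
  have r: "rainbow_cycle L u f" using fr(1) by (simp add: L_def)
  have L: "1 \<le> L" using rainbow_cycleD(1)[OF r] .
  have per: "L dvd i - j \<Longrightarrow> E c x (u i) \<Longrightarrow> E c x (u j)" for i j using rainbow_cycleD(2)[OF r, of i j] by simp
  define W where "W = {p \<in> {0..<L}. E c w (u p)}"
  have "D \<le> card W + of_bool (E c w x) + of_bool (E c w y)"
    using frame_count[OF F fr(6,3), of 0] Eirr[of c w] unfolding W_def L_def by simp
  then have cW: "D - 2 \<le> card W" by (auto simp: of_bool_def split: if_splits)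
  have X: "card {i \<in> {0..<L}. E c x (u (i + a))} = D - 2" for a
  proof -
    have "card {i \<in> {0..<L}. E c x (u (i + a))} = card {i \<in> {0..<L}. E c x (u i)}"
      by (rule periodic_card[OF L]) (rule per)
    then show ?thesis using frame_basic(5)[OF F] unfolding L_def by simp
  qed
  have gen: "E c w (u p) \<longleftrightarrow> E c x (u (p + a))" if sub: "\<And>p. E c w (u p) \<Longrightarrow> E c x (u (p + a))" for a
  proof -
    have fin: "finite {i \<in> {0..<L}. E c x (u (i + a))}" by (rule finite_subset[of _ "{0..<L}"]) auto
    have W: "W \<subseteq> {i \<in> {0..<L}. E c x (u (i + a))}" using sub unfolding W_def by blast
    have eq: "W = {i \<in> {0..<L}. E c x (u (i + a))}"
      by (rule card_seteq[OF fin W]) (simp only: X cW)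
    obtain i where i: "i \<in> {0..<0 + L}" "L dvd p - i" using mod_window[OF L, of 0 p] by blast
    have "i \<in> W \<longleftrightarrow> i \<in> {i \<in> {0..<L}. E c x (u (i + a))}" by (subst eq) (rule refl)
    then have "E c w (u i) \<longleftrightarrow> E c x (u (i + a))" using i(1) by (simp add: W_def)
    moreover have "u p = u i" "u (p + a) = u (i + a)"
      using rainbow_cycleD(2)[OF r, of p i] rainbow_cycleD(2)[OF r, of "p + a" "i + a"] i(2) by auto
    ultimately show ?thesis by simp
  qed
  show "E c w (u p) \<longleftrightarrow> E c x (u (p - 1))"
    using gen[of "- 1", unfolded add_uminus_conv_diff, OF w_predecessor[OF F]] .
  show "E c w (u p) \<longleftrightarrow> E c x (u (p + 1))" by (rule gen[OF w_successor[OF F]])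
qed

text \<open>The neighbours of \<open>x\<close> are invariant under a shift by two.  They are neither all vertices of the cycle nor
none, hence every second one.\<close>

lemma frame_alternating:
  assumes F: "frame u f w c d"
  shows "E c x (u (p + 1)) \<longleftrightarrow> \<not> E c x (u p)" "E c y (u p) \<longleftrightarrow> E c x (u p)" "E c w (u p) \<longleftrightarrow> \<not> E c x (u p)"
proof -
  define P where "P p \<longleftrightarrow> E c x (u p)" for p
  have two: "P (p + 2) \<longleftrightarrow> P p" for p
    using frame_alternating_w[OF F, of "p + 1"] unfolding P_def by (simp add: add.commute)
  have "P (p + 1) \<longleftrightarrow> \<not> P p" for p
  proof (rule ccontr)
    assume "\<not> ?thesis"
    then have eq: "P (p + 1) \<longleftrightarrow> P p" by blast
    have all: "(P i \<longleftrightarrow> P p) \<and> (P (i + 1) \<longleftrightarrow> P p)" for i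
    proof (induction i rule: int_induct[where k = p])
      case (step1 i)
      then show ?case using two[of i] by (simp add: add.assoc)
    next
      case (step2 i)
      then show ?case using two[of "i - 1"] by (simp add: algebra_simps)
    qed (use eq in simp)
    have "{i \<in> {0..<int n - 3}. P i} = (if P p then {0..<int n - 3} else {})" using all by auto
    then have "card {i \<in> {0..<int n - 3}. P i} = (if P p then n - 3 else 0)" using n5 by (auto simp: nat_diff_distrib)
    then have "D - 2 = (if P p then n - 3 else 0)" using frame_basic(5)[OF F] unfolding P_def by metis
    then show False using degree_bounds n5 frame_basic(1)[OF F] by (simp split: if_splits)
  qed
  then show 1: "E c x (u (p + 1)) \<longleftrightarrow> \<not> E c x (u p)" for p unfolding P_def .
  show "E c w (u p) \<longleftrightarrow> \<not> E c x (u p)" using frame_alternating_w(2)[OF F] 1 by blast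
  show "E c y (u p) \<longleftrightarrow> E c x (u p)"
    using frame_alternating_w(1)[OF F, of "p + 1"]
      unjoined_pair.frame_alternating_w(1)[OF swapped frame_swap_pair[OF F], of "p + 1"] by simp
qed

text \<open>If \<open>s\<close> is even, the neighbours of \<open>x\<close> in the colours \<open>c\<close> and \<open>d\<close> are complementary, so \<open>x\<close> reaches each vertex of
the cycle in one of them.  An exchange makes the colour of the edge leaving some \<open>u i\<close> spare.  As the
neighbours of \<open>y\<close> in this colour alternate on the new cycle, \<open>y\<close> is adjacent in this colour to \<open>u i\<close> or to \<open>u (i - 1)\<close>, and the arc of
length \<open>s\<close> ending there avoids the edge.\<close>

lemma s_odd: "odd s"
proof
  assume ev: "even s"
  obtain u f w c d where F: "frame u f w c d" using frame_exists by blast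
  note fr = frameD[OF F]
  define L where "L = int n - 3"
  have r: "rainbow_cycle L u f" using fr(1) by (simp add: L_def)
  have "even L" using frame_basic(1)[OF F] by (simp add: L_def) presburger
  then have sL: "s + 2 \<le> L" using ev sn s1 unfolding L_def by presburger
  obtain i j u' f' a b where G: "frame u' f' w (f i) (f j)" and ab: "u' a = u i" "u' b = u (i - 1)" "\<bar>a - b\<bar> = 1"
    using spare_one_of_two[OF F, of 0] by blast
  have "a = b + 1 \<or> b = a + 1" using ab(3) by linarith
  then have "E (f i) y (u' a) \<longleftrightarrow> \<not> E (f i) y (u' b)"
    using frame_alternating(1,2)[OF G] by auto
  then obtain e where e: "e = i \<or> e = i - 1" "E (f i) y (u e)" using ab by metis
  have alt: "E d x (u (k + 1)) \<longleftrightarrow> \<not> E d x (u k)" for k by (rule frame_alternating(1)[OF frame_swap_colours[OF F]])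
  have "E d y (u e) \<longleftrightarrow> E d x (u e)" by (rule frame_alternating(2)[OF frame_swap_colours[OF F]])
  moreover have "E d x (u e) \<longleftrightarrow> E d x (u (e - s))"
    using alternating_parity[of "\<lambda>k. E d x (u k)" "e - s" e, OF alt] ev by simp
  moreover have "E c x (u (e - s)) \<longleftrightarrow> \<not> E d y (u e)" using frame_basic(2)[OF F, of "e - s"] by simp
  ultimately obtain q where q: "q = c \<or> q = d" "E q x (u (e - s))" by blast
  have "f i \<notin> f ` {e - s..<e - s + s}"
  proof
    assume "f i \<in> f ` {e - s..<e - s + s}"
    then obtain l where "l \<in> {e - s..<e}" "f i = f l" by auto
    then show False using inj_onD[OF rainbow_cycle_inj(2)[OF r, of "e - s"], of i l] sL e(1) s1 by auto
  qed
  then have "joined (nat s + 3) x y"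
    using joined_by_arc[OF r fr(11) xV yV xy, of s q "f i" "e - s"] q e(2) fr(6,7,9,10) rainbow_cycleD(5)[OF r, of i] s1 sL by auto
  then show False using unjoined by blast
qed

text \<open>A neighbour \<open>u i\<close> of \<open>x\<close> is replaced by \<open>w\<close>, which is adjacent to both of its neighbours on the cycle.  The two
edges that disappear give the new spare colours.\<close>

lemma frame_replace:
  assumes F: "frame u f w c d" and i: "E c x (u i)"
  defines "u' \<equiv> \<lambda>k. if (int n - 3) dvd k - i then w else u k"
  shows "\<exists>f'. frame u' f' (u i) (f (i - 1)) (f i)"
proof -
  note fr = frameD[OF F]
  define L where "L = int n - 3"
  have r: "rainbow_cycle L u f" using fr(1) by (simp add: L_def)
  have L: "2 \<le> L" using n5 by (simp add: L_def)
  note rD = rainbow_cycleD[OF r]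
  define f' where "f' k = (if L dvd k - (i - 1) then c else if L dvd k - i then d else f k)" for k
  have d1: "\<not> L dvd 1" "\<not> L dvd - 1" using L by auto
  have nd: "\<not> (L dvd k - (i - 1) \<and> L dvd k - i)" for k
  proof
    assume "L dvd k - (i - 1) \<and> L dvd k - i"
    then have "L dvd (k - (i - 1)) - (k - i)" using dvd_diff by blast
    then show False using d1 by simp
  qed
  have tr: "L dvd a - e \<Longrightarrow> L dvd b - e \<Longrightarrow> L dvd a - b" for a b e :: int
    using dvd_diff[of L "a - e" "b - e"] by simp
  have tr2: "L dvd a - b \<Longrightarrow> L dvd a - e \<longleftrightarrow> L dvd b - e" for a b e :: int
    using dvd_diff[of L "a - e" "a - b"] dvd_add[of L "b - e" "a - b"] by auto
  have odd_xs: "E d x (u k) \<longleftrightarrow> E c x (u k)" for k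
  proof -
    have "E d x (u (k + s)) \<longleftrightarrow> \<not> E d x (u k)"
      using alternating_parity[of "\<lambda>k. E d x (u k)" "k + s" k, OF frame_alternating(1)[OF frame_swap_colours[OF F]]] s_odd by simp
    then show ?thesis
      using frame_basic(2)[OF F, of k] frame_alternating(2)[OF frame_swap_colours[OF F], of "k + s"] by blast
  qed
  have Ew: "E c w (u (i - 1))" "E d w (u (i + 1))"
    using frame_alternating(1)[OF F, of "i - 1"] frame_alternating(3)[OF F, of "i - 1"]
      frame_alternating(1)[OF frame_swap_colours[OF F], of i] frame_alternating(3)[OF frame_swap_colours[OF F], of "i + 1"] i odd_xs[of i]
    by simp_all
  have r': "rainbow_cycle L u' f'"
    unfolding rainbow_cycle_def
  proof (intro conjI allI)
    show "1 \<le> L" using L by simp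
    show "u' a = u' b \<longleftrightarrow> L dvd a - b" for a b
    proof (cases "L dvd a - b")
      case True
      then have "L dvd a - i \<longleftrightarrow> L dvd b - i" "u a = u b" using tr2 rD(2) by blast+
      then show ?thesis using True unfolding u'_def L_def[symmetric] by simp
    next
      case False
      then have "\<not> (L dvd a - i \<and> L dvd b - i)" "u a \<noteq> u b" using tr rD(2) by blast+
      then have "u' a \<noteq> u' b"
        unfolding u'_def L_def[symmetric] using fr(15) fr(15)[symmetric] by presburger
      then show ?thesis using False by simp
    qed
    show "f' a = f' b \<longleftrightarrow> L dvd a - b" for a b
    proof (cases "L dvd a - b")
      case True
      then have "L dvd a - i \<longleftrightarrow> L dvd b - i" "L dvd a - (i - 1) \<longleftrightarrow> L dvd b - (i - 1)" "f a = f b"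
        using tr2 rD(3) by blast+
      then have "f' a = f' b" by (simp only: f'_def)
      then show ?thesis using True by simp
    next
      case False
      then have 1: "\<not> (L dvd a - i \<and> L dvd b - i)" "\<not> (L dvd a - (i - 1) \<and> L dvd b - (i - 1))" "f a \<noteq> f b"
        using tr rD(3) by blast+
      have 2: "f k \<noteq> c" "f k \<noteq> d" for k using fr(9,10) by auto
      have "f' a \<noteq> f' b"
        using 1 2[of a] 2[of b] fr(8) unfolding f'_def
        by (cases "L dvd a - (i - 1)"; cases "L dvd b - (i - 1)"; cases "L dvd a - i"; cases "L dvd b - i") metis+
      then show ?thesis using False by simp
    qed
    show "u' a \<in> V" for a unfolding u'_def using fr by simp
    show "f' a \<in> K" for a unfolding f'_def using fr rD(5) by simp
    show "E (f' a) (u' a) (u' (a + 1))" for a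
    proof -
      consider "L dvd a - (i - 1)" | "L dvd a - i" | "\<not> L dvd a - (i - 1)" "\<not> L dvd a - i" by blast
      then show ?thesis
      proof cases
        case 1
        then have "u a = u (i - 1)" "L dvd a + 1 - i" "\<not> L dvd a - i" using rD(2)[of a "i - 1"] nd[of a] by (auto simp: algebra_simps)
        then show ?thesis using 1 Esym[OF Ew(1)] unfolding f'_def u'_def L_def[symmetric] by simp
      next
        case 2
        then have a: "u (a + 1) = u (i + 1)" "\<not> L dvd a - (i - 1)" using rD(2)[of "a + 1" "i + 1"] nd[of a] by auto
        moreover have "\<not> L dvd a + 1 - i"
        proof
          assume "L dvd a + 1 - i"
          then have "L dvd (a + 1 - i) - (a - i)" using 2 dvd_diff by blast
          then show False using d1 by simp
        qed
        ultimately show ?thesis using 2 Ew(2) unfolding f'_def u'_def L_def[symmetric] by simp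
      next
        case 3
        then have "\<not> L dvd a + 1 - i" by (simp add: algebra_simps)
        then show ?thesis using 3 rD(6)[of a] unfolding f'_def u'_def L_def[symmetric] by simp
      qed
    qed
  qed
  have ru: "range u' = V - {x, y, u i}"
  proof
    show "range u' \<subseteq> V - {x, y, u i}"
      using fr(3-5) fr(12-15) rD(2) unfolding u'_def L_def[symmetric] by (auto split: if_splits)
    show "V - {x, y, u i} \<subseteq> range u'"
    proof
      fix z assume z: "z \<in> V - {x, y, u i}"
      show "z \<in> range u'"
      proof (cases "z = w")
        case True
        then have "z = u' i" by (simp add: u'_def)
        then show ?thesis by blast
      next
        case False
        then obtain k where k: "z = u k" using z fr(2) by blast
        then have "\<not> L dvd k - i" using z rD(2)[of k i] by auto
        then have "z = u' k" using k unfolding u'_def L_def by simp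
        then show ?thesis by blast
      qed
    qed
  qed
  have nf: "f j \<notin> range f'" if "j = i - 1 \<or> j = i" for j
  proof
    assume "f j \<in> range f'"
    then obtain k where k: "f j = f' k" by blast
    then show False using that fr(9,10) rD(3)[of j k] rD(3)[of k j] unfolding f'_def by (auto split: if_splits)
  qed
  have "f (i - 1) \<noteq> f i" using rD(3)[of "i - 1" i] d1 by simp
  then have "frame u' f' (u i) (f (i - 1)) (f i)"
    unfolding frame_def L_def[symmetric] using r' ru fr(12-14)[of i] rD(5) nf by blast
  then show ?thesis by blast
qed

text \<open>The colour of any edge of the cycle becomes spare when its end among the neighbours of \<open>x\<close> is replaced by
\<open>w\<close>.  The neighbours of \<open>x\<close> in that colour alternate on the new cycle, and only their parity is in question.
The wrong parity would give a path of the forbidden length.\<close>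

lemma frame_structure:
  assumes F: "frame u f w c d" and q: "q \<in> K"
  shows "E q x (u j) \<longleftrightarrow> E c x (u j)" "E q y (u j) \<longleftrightarrow> E c x (u j)" "E q x w" "E q y w" "E q x y"
proof -
  note fr = frameD[OF F]
  define L where "L = int n - 3"
  have r: "rainbow_cycle L u f" using fr(1) by (simp add: L_def)
  have sL: "s < L" using sn by (simp add: L_def)
  \<comment> \<open>For odd \<open>s\<close>, complementarity at distance \<open>s\<close> together with alternation makes the two spare colours agree.\<close>
  have agree: "E q' x (v k) \<longleftrightarrow> E p' x (v k)" if "frame v g w' p' q'" for v g w' p' q' k
  proof -
    note G = frame_swap_colours[OF that]
    have "E q' x (v (k + s)) \<longleftrightarrow> \<not> E q' x (v k)"
      using alternating_parity[of "\<lambda>k. E q' x (v k)" "k + s" k, OF frame_alternating(1)[OF G]] s_odd by simp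
    then show ?thesis using frame_basic(2)[OF that, of k] frame_alternating(2)[OF G, of "k + s"] by blast
  qed
  have "(E q x (u j) \<longleftrightarrow> E c x (u j)) \<and> (E q y (u j) \<longleftrightarrow> E c x (u j)) \<and> E q x w \<and> E q y w \<and> E q x y"
  proof (cases "q \<in> range f")
    case False
    have "card (range f) = n - 3" using rainbow_cycle_range(4)[OF r] by (simp add: L_def)
    moreover have fs: "finite (range f)" "range f \<subseteq> K" using rainbow_cycleD(5)[OF r] finK by (auto intro: finite_subset[of _ K])
    ultimately have "card (insert c (insert d (range f))) = card K" using fr(8-10) cardK n5 by simp
    then have "insert c (insert d (range f)) = K" using fs(2) fr(6,7) finK by (intro card_subset_eq) auto
    then have "q = c \<or> q = d" using q False by blast
    then show ?thesis
      using agree[OF F, of j] frame_alternating(2)[OF F, of j] frame_alternating(2)[OF frame_swap_colours[OF F], of j] frame_spare[OF F]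
      by blast
  next
    case True
    then obtain j0 where j0: "q = f j0" by blast
    define i where "i = (if E c x (u j0) then j0 else j0 + 1)"
    have i: "E c x (u i)" "q = f (i - 1) \<or> q = f i"
      using frame_alternating(1)[OF F, of j0] j0 by (auto simp: i_def)
    define v where "v = (\<lambda>k. if (int n - 3) dvd k - i then w else u k)"
    obtain g where G: "frame v g (u i) (f (i - 1)) (f i)" using frame_replace[OF F i(1)] unfolding v_def by blast
    have vk: "v k = u k" if "\<not> L dvd k - i" for k using that by (simp add: v_def L_def)
    have nd: "\<not> L dvd k" if "0 < \<bar>k\<bar>" "\<bar>k\<bar> < L" for k using that zdvd_imp_le[of L "\<bar>k\<bar>"] by auto
    have L2: "1 < L" using n5 by (simp add: L_def)
    have "\<not> E (f (i - 1)) x (u (i - 1))"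
    proof
      assume "E (f (i - 1)) x (u (i - 1))"
      moreover have "v (i - 1) = u (i - 1)" using vk[of "i - 1"] nd[of "- 1"] L2 by simp
      ultimately have "E (f (i - 1)) x (v (i - 1))" by simp
      moreover have "even (i + s - (i - 1))" using s_odd by simp
      ultimately have "E (f (i - 1)) x (v (i + s))"
        using alternating_parity[of "\<lambda>k. E (f (i - 1)) x (v k)" "i + s" "i - 1", OF frame_alternating(1)[OF G]] by simp
      moreover have "v (i + s) = u (i + s)" using vk[of "i + s"] nd[of s] s1 sL by simp
      ultimately have Ey: "E (f (i - 1)) y (u (i + s))" using frame_alternating(2)[OF G, of "i + s"] by simp
      have "f (i - 1) \<notin> f ` {i..<i + s}"
      proof
        assume "f (i - 1) \<in> f ` {i..<i + s}"
        then obtain l where "l \<in> {i..<i + s}" "f (i - 1) = f l" by auto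
        then show False using inj_onD[OF rainbow_cycle_inj(2)[OF r, of "i - 1"], of "i - 1" l] sL by auto
      qed
      then have "joined (nat s + 3) x y"
        using joined_by_arc[OF r fr(11) xV yV xy _ sL fr(6), of "f (i - 1)" i] i(1) Ey fr(9) rainbow_cycleD(5)[OF r, of "i - 1"] s1 by auto
      then show False using unjoined by blast
    qed
    then have n1: "\<not> E (f (i - 1)) x (v (i - 1))" using vk[of "i - 1"] nd[of "- 1"] L2 by simp
    have par1: "E (f (i - 1)) x (v k) \<longleftrightarrow> even (k - i)" for k
    proof -
      have "even (k - (i - 1)) \<longleftrightarrow> odd (k - i)" by presburger
      then show ?thesis
        using alternating_parity[of "\<lambda>k. E (f (i - 1)) x (v k)" k "i - 1", OF frame_alternating(1)[OF G]] n1 by simp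
    qed
    have parq: "E q x (v k) \<longleftrightarrow> even (k - i)" "E q y (v k) \<longleftrightarrow> even (k - i)" for k
      using par1[of k] agree[OF G, of k] i(2) frame_alternating(2)[OF G, of k]
        frame_alternating(2)[OF frame_swap_colours[OF G], of k] by auto
    have parc: "E c x (u k) \<longleftrightarrow> even (k - i)" for k
      using alternating_parity[of "\<lambda>k. E c x (u k)" k i, OF frame_alternating(1)[OF F]] i(1) by simp
    have sp: "E q x (u i)" "E q y (u i)" "E q x y" using frame_spare[OF G] i(2) by auto
    have w: "v i = w" by (simp add: v_def)
    have "E q x w" "E q y w" using parq[of i] w by simp_all
    moreover have "E q x (u j) \<longleftrightarrow> E c x (u j)" "E q y (u j) \<longleftrightarrow> E c x (u j)"
    proof -
      show "E q x (u j) \<longleftrightarrow> E c x (u j)"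
      proof (cases "L dvd j - i")
        case True
        then have "u j = u i" using rainbow_cycleD(2)[OF r] by blast
        then show ?thesis using sp i(1) by simp
      next
        case False
        then show ?thesis using parq(1)[of j] parc[of j] vk by simp
      qed
      show "E q y (u j) \<longleftrightarrow> E c x (u j)"
      proof (cases "L dvd j - i")
        case True
        then have "u j = u i" using rainbow_cycleD(2)[OF r] by blast
        then show ?thesis using sp i(1) by simp
      next
        case False
        then show ?thesis using parq(2)[of j] parc[of j] vk by simp
      qed
    qed
    ultimately show ?thesis using sp(3) by blast
  qed
  then show "E q x (u j) \<longleftrightarrow> E c x (u j)" "E q y (u j) \<longleftrightarrow> E c x (u j)" "E q x w" "E q y w" "E q x y" by blast+
qed


section \<open>The extremal collection\<close>

text \<open>By the degree bound, a vertex \<open>u j\<close> that is not adjacent to \<open>x\<close> has a neighbour \<open>u i0\<close> of the same kind in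
colour \<open>c\<close>.  Following the cycle up to \<open>u i0\<close>, then this chord to \<open>u j\<close> and the cycle backwards gives a spanning
path whose segments around the chord can be chosen to have \<open>s + 1\<close> vertices and to end in neighbours
of \<open>x\<close> and \<open>y\<close>, provided that \<open>s \<ge> 3\<close>.\<close>

lemma s_eq_one: "s = 1"
proof (rule ccontr)
  assume "s \<noteq> 1"
  then have s3: "3 \<le> s" using s_odd s1 by presburger
  obtain u f w c d where F: "frame u f w c d" using frame_exists by blast
  note fr = frameD[OF F]
  define L where "L = int n - 3"
  have r: "rainbow_cycle L u f" using fr(1) by (simp add: L_def)
  have L: "1 \<le> L" "s < L" "nat L = n - 3" using rainbow_cycleD(1)[OF r] sn by (auto simp: L_def)
  have nD2: "int n + 1 = 2 * int D" by (rule frame_basic(1)[OF F])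
  then have evL: "even L" by (simp add: L_def) presburger
  note alt = frame_alternating(1)[OF F]
  have "\<exists>j. \<not> E c x (u j)" using alt[of 0] by blast
  then obtain j where nj: "\<not> E c x (u j)" by blast
  have par: "E c x (u k) \<longleftrightarrow> odd (k - j)" for k
    using alternating_parity[of "\<lambda>k. E c x (u k)" k j, OF alt] nj by simp
  have "\<exists>i\<in>{j + 1..<j + L}. \<not> E c x (u i) \<and> E c (u j) (u i)"
  proof (rule ccontr)
    assume no: "\<not> ?thesis"
    let ?O = "{i \<in> {0..<L}. E c x (u i)}"
    have "{b. E c (u j) b} \<subseteq> insert w (u ` ?O)"
    proof
      fix b assume "b \<in> {b. E c (u j) b}"
      then have b: "E c (u j) b" by simp
      then have bV: "b \<in> V" by (rule EV2)
      have "b \<noteq> x" using Esym[OF b] nj by blast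
      moreover have "b \<noteq> y" using Esym[OF b] nj frame_alternating(2)[OF F, of j] by blast
      ultimately have "b = w \<or> b \<in> range u" using fr(2) bV by blast
      then show "b \<in> insert w (u ` ?O)"
      proof
        assume "b \<in> range u"
        then obtain k where k: "k \<in> {j..<j + L}" "b = u k" using rainbow_cycle_range(1)[OF r, of j] by blast
        have "k \<noteq> j" using b k(2) Eirr by blast
        then have "k \<in> {j + 1..<j + L}" using k(1) by auto
        then have Ek: "E c x (u k)" using no b k(2) by blast
        obtain i where i: "i \<in> {0..<0 + L}" "L dvd k - i" using mod_window[OF L(1), of 0 k] by blast
        then have "u k = u i" using rainbow_cycleD(2)[OF r] by blast
        then show ?thesis using Ek k(2) i(1) by auto
      qed simp
    qed
    moreover have finO: "finite ?O" by (rule finite_subset[of _ "{0..<L}"]) auto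
    ultimately have "card {b. E c (u j) b} \<le> card (insert w (u ` ?O))" by (intro card_mono) simp_all
    also have "\<dots> \<le> Suc (card (u ` ?O))" using finO by (simp add: card_insert_if)
    also have "card (u ` ?O) \<le> card ?O" by (rule card_image_le[OF finO])
    also have "card ?O = D - 2" using frame_basic(5)[OF F] by (simp add: L_def)
    finally show False using deg[OF fr(6) fr(12)[of j]] degree_bounds n5 by simp
  qed
  then obtain i0 where i0: "i0 \<in> {j + 1..<j + L}" "\<not> E c x (u i0)" "E c (u j) (u i0)" by blast
  define H where "H = i0 - j"
  have H: "1 \<le> H" "H < L" "even H" using i0(1,2) par[of i0] by (auto simp: H_def)
  then have H2: "2 \<le> H" "H + 2 \<le> L" using evL by presburger+
  define v where "v i = u (i + j)" for i
  define g where "g i = f (i + j)" for i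
  have r3: "rainbow_cycle L v g" unfolding v_def g_def by (rule rainbow_cycle_shift[OF r])
  have vL: "v L = u j" "v H = u i0" using rainbow_cycleD(2)[OF r, of "L + j" j] by (simp_all add: v_def H_def)
  define v2 where "v2 k = (if k \<le> H then v k else v (L + H + 1 - k))" for k
  define f2 where "f2 k = (if k < H then g k else if k = H then c else g (L + H - k))" for k
  have vinj: "v a = v b \<longleftrightarrow> a = b" if "a \<in> {1..L}" "b \<in> {1..L}" for a b
    using rainbow_cycleD(2)[OF r3, of a b] dvd_window[of a 1 L b] that by auto
  have ginj: "g a = g b \<longleftrightarrow> a = b" if "a \<in> {1..L}" "b \<in> {1..L}" for a b
    using rainbow_cycleD(3)[OF r3, of a b] dvd_window[of a 1 L b] that by auto
  have gc: "g a \<noteq> c" for a using fr(9) by (auto simp: g_def)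
  have fp: "rainbow_path L v2 f2 (V - {x, y})"
    unfolding rainbow_path_def
  proof (intro conjI ballI)
    show "1 \<le> L" "V - {x, y} \<subseteq> V" using L by auto
    show "inj_on v2 {1..L}"
    proof (rule inj_onI)
      fix a b assume ab: "a \<in> {1..L}" "b \<in> {1..L}" "v2 a = v2 b"
      define \<rho> where "\<rho> k = (if k \<le> H then k else L + H + 1 - k)" for k
      have "v2 k = v (\<rho> k)" for k by (simp add: v2_def \<rho>_def)
      moreover have "\<rho> a \<in> {1..L}" "\<rho> b \<in> {1..L}" using ab H by (auto simp: \<rho>_def)
      ultimately have "\<rho> a = \<rho> b" using ab(3) vinj by simp
      then show "a = b" using ab by (auto simp: \<rho>_def split: if_splits)
    qed
    show "v2 ` {1..L} \<subseteq> V - {x, y}" using fr(12-14) by (auto simp: v2_def v_def)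
    show "inj_on f2 {1..<L}"
    proof (rule inj_onI)
      fix a b assume ab: "a \<in> {1..<L}" "b \<in> {1..<L}" "f2 a = f2 b"
      define \<rho> where "\<rho> k = (if k < H then k else L + H - k)" for k
      have f2: "f2 k = (if k = H then c else g (\<rho> k))" for k by (simp add: f2_def \<rho>_def)
      have "a = H \<longleftrightarrow> b = H" using ab(3) gc[of "\<rho> a"] gc[of "\<rho> b"] unfolding f2 by (auto split: if_splits)
      moreover have "a = b" if "a \<noteq> H" "b \<noteq> H"
      proof -
        have "\<rho> a \<in> {1..L}" "\<rho> b \<in> {1..L}" using ab that H by (auto simp: \<rho>_def)
        moreover have "g (\<rho> a) = g (\<rho> b)" using ab(3) that unfolding f2 by simp
        ultimately have "\<rho> a = \<rho> b" using ginj by blast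
        then show ?thesis using ab that by (auto simp: \<rho>_def split: if_splits)
      qed
      ultimately show "a = b" by blast
    qed
    show "f2 ` {1..<L} \<subseteq> K" using rainbow_cycleD(5)[OF r3] fr(6) by (auto simp: f2_def)
    show "E (f2 k) (v2 k) (v2 (k + 1))" if "k \<in> {1..<L}" for k
    proof -
      consider "k < H" | "k = H" | "H < k" by linarith
      then show ?thesis
      proof cases
        case 1
        then show ?thesis using rainbow_cycleD(6)[OF r3, of k] by (simp add: f2_def v2_def)
      next
        case 2
        then show ?thesis using Esym[OF i0(3)] vL by (simp add: f2_def v2_def)
      next
        case 3
        have e: "L + H - k + 1 = L + H + 1 - k" by simp
        have "f2 k = g (L + H - k)" "v2 k = v (L + H + 1 - k)" "v2 (k + 1) = v (L + H - k)"
          using 3 by (simp_all add: f2_def v2_def)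
        then show ?thesis using Esym[OF rainbow_cycleD(6)[OF r3, of "L + H - k", unfolded e]] by simp
      qed
    qed
  qed
  \<comment> \<open>The segment has \<open>p\<close> edges before and \<open>q\<close> edges after the chord; both numbers are odd so that it ends in neighbours of \<open>x\<close> and \<open>y\<close>.\<close>
  define p where "p = min (H - 1) (s - 2)"
  define q where "q = s - 1 - p"
  have p: "odd p" "1 \<le> p" "p \<le> H - 1" using H H2 s_odd s3 by (auto simp: p_def min_def)
  have q: "odd q" "1 \<le> q" "q \<le> L - 1 - H"
    using p s_odd s3 H2 L(2) by (auto simp: q_def p_def min_def)
  have A: "E \<gamma> x (v2 (H - p))" if "\<gamma> \<in> K" for \<gamma>
    using frame_structure(1)[OF F that, of "H - p + j"] par[of "H - p + j"] p H by (simp add: v2_def v_def)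
  have B: "E \<gamma> y (v2 (H + 1 + q))" if "\<gamma> \<in> K" for \<gamma>
    using frame_structure(2)[OF F that, of "L - q + j"] par[of "L - q + j"] q evL by (simp add: v2_def v_def)
  have out: "g l \<notin> f2 ` {H - p..<H + 1 + q}" if "l = H \<or> l = L" for l
  proof
    assume "g l \<in> f2 ` {H - p..<H + 1 + q}"
    then obtain k where k: "k \<in> {H - p..<H + 1 + q}" "g l = f2 k" by blast
    show False
    proof (cases "k = H")
      case True
      then show False using k(2) gc by (simp add: f2_def)
    next
      case False
      then have "g l = g (if k < H then k else L + H - k)" using k(2) by (simp add: f2_def)
      moreover have "l \<in> {1..L}" "(if k < H then k else L + H - k) \<in> {1..L}" using that k(1) False p q H by auto
      ultimately have "l = (if k < H then k else L + H - k)" using ginj by blast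
      then show False using that k(1) False p q H by (auto split: if_splits)
    qed
  qed
  have "g H \<noteq> g L" using ginj[of H L] H by auto
  then have "joined (nat (H + 1 + q - (H - p)) + 3) x y"
    by (intro rainbow_path_joined[OF fp xV yV xy _ _ _ _ _ _ out out A B]) (use p q rainbow_cycleD(5)[OF r3] in auto)
  then show False using unjoined by (simp add: q_def)
qed

text \<open>The set \<open>A\<close> consists of the common neighbours of \<open>x\<close> and \<open>y\<close>.  It is independent in every colour, since an
edge inside would give a path on four vertices.  So the degree bound forces every vertex of \<open>A\<close> to be
adjacent to all vertices outside.\<close>

lemma extremal_structure:
  obtains A where "odd n" "A \<subseteq> V - {x, y}" "card A = n div 2"
    "\<And>q z. q \<in> K \<Longrightarrow> E q x z \<longleftrightarrow> z \<in> A \<or> z = y" "\<And>q z. q \<in> K \<Longrightarrow> E q y z \<longleftrightarrow> z \<in> A \<or> z = x"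
    "\<And>q a b. q \<in> K \<Longrightarrow> a \<in> A \<Longrightarrow> E q a b \<longleftrightarrow> b \<in> V - A"
proof -
  obtain u f w c d where F: "frame u f w c d" using frame_exists by blast
  note fr = frameD[OF F]
  have nD2: "int n + 1 = 2 * int D" by (rule frame_basic(1)[OF F])
  define A where "A = {z \<in> V - {x, y}. E c x z}"
  have AV: "A \<subseteq> V - {x, y}" unfolding A_def by blast
  have finA: "finite A" using AV finV finite_subset by blast
  have Nx: "E q x z \<longleftrightarrow> z \<in> A \<or> z = y" if q: "q \<in> K" for q z
  proof (cases "z \<in> V - {x, y, w}")
    case True
    then obtain j where "z = u j" using fr(2) by blast
    then show ?thesis using frame_structure(1)[OF F q, of j] True unfolding A_def by auto
  next
    case False
    then consider "z \<notin> V" | "z = x" | "z = y" | "z = w" by blast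
    then show ?thesis
      using EV2[of q x z] yV frame_structure(3,5)[OF F q] frame_structure(3)[OF F fr(6)] fr(3-5) Eirr[of q x] unfolding A_def
      by cases auto
  qed
  have Ny: "E q y z \<longleftrightarrow> z \<in> A \<or> z = x" if q: "q \<in> K" for q z
  proof (cases "z \<in> V - {x, y, w}")
    case True
    then obtain j where "z = u j" using fr(2) by blast
    then show ?thesis using frame_structure(2)[OF F q, of j] True unfolding A_def by auto
  next
    case False
    then consider "z \<notin> V" | "z = x" | "z = y" | "z = w" by blast
    then show ?thesis
      using EV2[of q y z] xV Esym[OF frame_structure(5)[OF F q]] frame_structure(4)[OF F q]
        frame_structure(3)[OF F fr(6)] fr(3-5) Eirr[of q y] unfolding A_def
      by cases auto
  qed
  have cA: "card A = D - 1"
  proof -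
    let ?O = "{i \<in> {0..<int n - 3}. E c x (u i)}"
    have "A = insert w (u ` ?O)"
    proof
      show "insert w (u ` ?O) \<subseteq> A"
        using fr(3-5) fr(12-14) frame_structure(3)[OF F fr(6)] unfolding A_def by auto
      show "A \<subseteq> insert w (u ` ?O)"
      proof
        fix z assume z: "z \<in> A"
        show "z \<in> insert w (u ` ?O)"
        proof (cases "z = w")
          case False
          then have "z \<in> range u" using z fr(2) unfolding A_def by auto
          then obtain i where "i \<in> {0..<0 + (int n - 3)}" "z = u i" using rainbow_cycle_range(1)[OF fr(1), of 0] by blast
          then show ?thesis using z unfolding A_def by auto
        qed simp
      qed
    qed
    moreover have "finite ?O" by (rule finite_subset[of _ "{0..<int n - 3}"]) auto
    moreover have "inj_on u ?O" by (rule inj_on_subset[OF rainbow_cycle_inj(1)[OF fr(1), of 0]]) auto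
    moreover have "w \<notin> u ` ?O" using fr(15) by auto
    ultimately have "card A = Suc (D - 2)" using frame_basic(5)[OF F] by (simp add: card_image)
    then show ?thesis using degree_bounds n5 by simp
  qed
  have ind: "\<not> E q a b" if "q \<in> K" "a \<in> A" "b \<in> A" for q a b
  proof
    assume Eab: "E q a b"
    have "2 \<le> card (K - {q})" using that(1) cardK n5 finK by simp
    then obtain \<gamma> \<delta> where g: "\<gamma> \<in> K" "\<delta> \<in> K" "\<gamma> \<noteq> \<delta>" "\<gamma> \<noteq> q" "\<delta> \<noteq> q" using two_elements by blast
    have ab: "a \<noteq> b" using Eab Eirr by blast
    have "joined 4 x y"
      by (rule joinedI[of "[x, a, b, y]" "[\<gamma>, q, \<delta>]"])
        (use g that AV xV yV xy ab Eab Nx[OF g(1), of a] Esym[of \<delta> y b] Ny[OF g(2), of b] in auto)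
    then show False using unjoined s_eq_one by simp
  qed
  have nb: "E q a b \<longleftrightarrow> b \<in> V - A" if q: "q \<in> K" and a: "a \<in> A" for q a b
  proof -
    have sub: "{b. E q a b} \<subseteq> V - A" using ind[OF q a] EV2 by blast
    have "card (V - A) = n - (D - 1)" using card_Diff_subset[of A V] AV finA cardV cA by auto
    then have "card (V - A) \<le> D" using nD2 by linarith
    also have "D \<le> card {b. E q a b}" using deg[OF q] a AV by blast
    finally have "{b. E q a b} = V - A" using card_seteq[OF _ sub] finV by blast
    then show ?thesis by blast
  qed
  show thesis
  proof (rule that[OF _ AV _ Nx Ny nb])
    show "odd n" using nD2 by presburger
    show "card A = n div 2" using cA D_def by simp
  qed
qed

end

context graph_system
begin

lemma joined_three:
  assumes xy: "x \<in> V" "y \<in> V" "x \<noteq> y" and n: "3 \<le> n"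
  shows "joined 3 x y"
proof -
  have "2 \<le> card K" using cardK n by simp
  then obtain c d where cd: "c \<in> K" "d \<in> K" "c \<noteq> d" using two_elements by blast
  have sub: "{b. E c x b} - {y} \<subseteq> V - {x, y}" "{b. E d y b} - {x} \<subseteq> V - {x, y}"
    using EV2[of c x] Eirr[of c x] EV2[of d y] Eirr[of d y] by auto
  have "D - 1 \<le> card ({b. E c x b} - {y})" "D - 1 \<le> card ({b. E d y b} - {x})"
    using deg[OF cd(1) xy(1)] deg[OF cd(2) xy(2)] finite_neighbours[of c x] finite_neighbours[of d y] by (auto simp: card_Diff_singleton_if)
  then have "card (V - {x, y}) < card ({b. E c x b} - {y}) + card ({b. E d y b} - {x})"
    using card_minus_pair[OF xy] degree_bounds n by linarith
  then obtain z where "z \<in> {b. E c x b} - {y}" "z \<in> {b. E d y b} - {x}"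
    using subsets_meet[OF _ sub] finV by blast
  then have z: "E c x z" "E d y z" "z \<noteq> x" "z \<noteq> y" "z \<in> V" using EV2 by auto
  show ?thesis
    by (rule joinedI[of "[x, z, y]" "[c, d]"]) (use z cd xy Esym[OF z(2)] in auto)
qed

lemma joined_or_extremal:
  assumes n: "3 \<le> n" and xy: "x \<in> V" "y \<in> V" "x \<noteq> y" and k: "3 \<le> k" "k \<le> n" and nj: "\<not> joined k x y"
  obtains A where "odd n" "A \<subseteq> V - {x, y}" "card A = n div 2"
    "\<And>q z. q \<in> K \<Longrightarrow> E q x z \<longleftrightarrow> z \<in> A \<or> z = y" "\<And>q z. q \<in> K \<Longrightarrow> E q y z \<longleftrightarrow> z \<in> A \<or> z = x"
    "\<And>q a b. q \<in> K \<Longrightarrow> a \<in> A \<Longrightarrow> E q a b \<longleftrightarrow> b \<in> V - A"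
proof -
  have k3: "k \<noteq> 3" using nj joined_three[OF xy n] by blast
  obtain k' where k': "4 \<le> k'" "k' \<le> n - 1" "\<not> joined k' x y"
  proof (cases "k = n")
    case True
    then have n4: "4 \<le> n" using k k3 by linarith
    have nj': "\<not> joined (n - 1) x y" using extend_to_hamilton[OF n4] nj True by blast
    have "n - 1 \<noteq> 3"
    proof
      assume "n - 1 = 3"
      then show False using nj' joined_three[OF xy n] by simp
    qed
    then show thesis using that[of "n - 1"] n4 nj' by simp
  next
    case False
    then show thesis using that[of k, OF _ _ nj] k k3 by linarith
  qed
  have "nat (int k' - 3) + 3 = k'" using k' by simp
  then have "\<not> joined (nat (int k' - 3) + 3) x y" using k'(3) by simp
  moreover have "5 \<le> n" "1 \<le> int k' - 3" "int k' - 3 \<le> int n - 4" using k' by linarith+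
  ultimately have "unjoined_pair_axioms V K E n x y (int k' - 3)"
    by (intro unjoined_pair_axioms.intro xy)
  then have "unjoined_pair V K E n D x y (int k' - 3)"
    by (intro unjoined_pair.intro graph_system_axioms)
  then show thesis by (rule unjoined_pair.extremal_structure) (rule that)
qed

end

section \<open>Rainbow paths of a family of graphs\<close>

definition colour_adj :: "nat set \<Rightarrow> (nat \<Rightarrow> 'a ugraph) \<Rightarrow> nat \<Rightarrow> 'a \<Rightarrow> 'a \<Rightarrow> bool" where
  "colour_adj K G c a b \<longleftrightarrow> c \<in> K \<and> {a, b} \<in> edges (G c)"

lemma degree_eq_neighbours:
  assumes "simple_graph G"
  shows "degree G v = card {u. {v, u} \<in> edges G}"
proof -
  have "{e \<in> edges G. v \<in> e} = (\<lambda>u. {v, u}) ` {u. {v, u} \<in> edges G}"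
  proof
    show "{e \<in> edges G. v \<in> e} \<subseteq> (\<lambda>u. {v, u}) ` {u. {v, u} \<in> edges G}"
    proof
      fix e assume e: "e \<in> {e \<in> edges G. v \<in> e}"
      then have "card e = 2" using assms by (auto simp: simple_graph_def)
      then obtain a b where "e = {a, b}" by (auto simp: card_2_iff)
      then have "e = {v, a} \<or> e = {v, b}" using e by auto
      then show "e \<in> (\<lambda>u. {v, u}) ` {u. {v, u} \<in> edges G}" using e by blast
    qed
  qed auto
  moreover have "inj_on (\<lambda>u. {v, u}) {u. {v, u} \<in> edges G}"
    by (auto simp: inj_on_def doubleton_eq_iff)
  ultimately show ?thesis unfolding degree_def by (simp add: card_image)
qed

lemma path_edges_inj:
  assumes "distinct xs"
  shows "inj_on (\<lambda>i. {xs ! i, xs ! Suc i}) {i. Suc i < length xs}"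
proof (rule inj_onI)
  fix i j assume ij: "i \<in> {i. Suc i < length xs}" "j \<in> {i. Suc i < length xs}"
    "{xs ! i, xs ! Suc i} = {xs ! j, xs ! Suc j}"
  then show "i = j"
    using assms by (auto simp: doubleton_eq_iff nth_eq_iff_index_eq)
qed

lemma path_graph_rainbow:
  assumes ch: "coloured_walk (colour_adj {1..s} G) xs cs" and d: "distinct xs" "distinct cs" and V: "set xs \<subseteq> V"
  shows "rainbow V s G (path_graph xs)"
proof -
  have len: "length xs = Suc (length cs)" by (rule walk_length[OF ch])
  define m where "m = (\<lambda>i. {xs ! i, xs ! Suc i})"
  define J where "J = {i. Suc i < length xs}"
  have E: "edges (path_graph xs) = m ` J" unfolding path_graph_def m_def J_def by auto
  have inj: "inj_on m J" unfolding m_def J_def by (rule path_edges_inj[OF d(1)])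
  have ad: "colour_adj {1..s} G (cs ! i) (xs ! i) (xs ! Suc i)" if "i \<in> J" for i
    using walk_nth[OF ch, of i] that len by (simp add: J_def)
  define \<phi> where "\<phi> e = cs ! inv_into J m e" for e
  have \<phi>: "\<phi> (m i) = cs ! i" if "i \<in> J" for i using inv_into_f_f[OF inj that] by (simp add: \<phi>_def)
  have inj\<phi>: "inj_on \<phi> (m ` J)"
  proof (rule inj_onI)
    fix e e' assume "e \<in> m ` J" "e' \<in> m ` J" "\<phi> e = \<phi> e'"
    then obtain i j where ij: "i \<in> J" "j \<in> J" "e = m i" "e' = m j" "cs ! i = cs ! j" using \<phi> by auto
    then have "i = j" using d(2) len by (simp add: J_def nth_eq_iff_index_eq)
    then show "e = e'" using ij by simp
  qed
  have im: "\<phi> ` m ` J \<subseteq> {1..s}" using \<phi> ad by (auto simp: colour_adj_def)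
  have "card (m ` J) = card (\<phi> ` m ` J)" using card_image[OF inj\<phi>] by simp
  also have "\<dots> \<le> card {1..s}" using im by (intro card_mono) auto
  finally have c: "card (m ` J) \<le> s" by simp
  have v: "verts (path_graph xs) = set xs" by (simp add: path_graph_def)
  have "simple_graph (path_graph xs)"
    unfolding simple_graph_def v E using d(1) by (auto simp: m_def J_def nth_eq_iff_index_eq)
  moreover have "\<forall>e\<in>m ` J. e \<in> edges (G (\<phi> e))" using \<phi> ad by (auto simp: colour_adj_def m_def)
  ultimately show ?thesis unfolding rainbow_def v E using V c inj\<phi> im by blast
qed

text \<open>In the extremal case, the graph on the complement of \<open>A\<close> has \<open>{x, y}\<close> as a component because
\<open>x\<close> and \<open>y\<close> see nothing but \<open>A\<close> and each other, and it has no isolated vertex because every degree exceeds the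
size of \<open>A\<close>.\<close>

theorem theorem1p4:
  fixes n :: nat and V :: "'a set" and G :: "nat \<Rightarrow> 'a ugraph"
  assumes "n \<ge> 3"
    and "finite V" and "card V = n"
    and "\<And>i. i \<in> {1..n - 1} \<Longrightarrow> simple_graph (G i)"
    and "\<And>i. i \<in> {1..n - 1} \<Longrightarrow> verts (G i) = V"
    and "\<And>i. i \<in> {1..n - 1} \<Longrightarrow> real (min_degree (G i)) \<ge> (real n + 1) / 2"
  shows "rainbow_panconnected V (n - 1) G \<or> is_F_collection n V (n - 1) G"
proof -
  define K where "K = {1..n - 1}"
  define E where "E = colour_adj K G"
  have sg: "simple_graph (G i)" "verts (G i) = V" if "i \<in> K" for i using assms(4,5) that by (auto simp: K_def)
  have E_def': "E c a b \<longleftrightarrow> c \<in> K \<and> {a, b} \<in> edges (G c)" for c a b by (simp add: E_def colour_adj_def)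
  interpret graph_system V K E n "n div 2 + 1"
  proof
    show "finite V" "card V = n" "finite K" "Suc (card K) = n" using assms(1-3) by (auto simp: K_def)
    show "E c b a" if "E c a b" for c a b using that by (simp add: E_def' insert_commute)
    show "\<not> E c a a" for c a
    proof
      assume "E c a a"
      then have "card {a, a} = 2" using sg(1)[of c] unfolding E_def' simple_graph_def by blast
      then show False by simp
    qed
    show "a \<in> V" if "E c a b" for c a b using sg[of c] that by (auto simp: E_def' simple_graph_def)
    show "n div 2 + 1 = n div 2 + 1" ..
    show "n div 2 + 1 \<le> card {b. E c a b}" if c: "c \<in> K" and a: "a \<in> V" for c a
    proof -
      have "min_degree (G c) \<le> degree (G c) a"
        unfolding min_degree_def using sg(2)[OF c] assms(2) a by simp
      moreover have "(real n + 1) / 2 \<le> real (min_degree (G c))" using assms(6)[of c] c by (simp add: K_def)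
      ultimately have "(real n + 1) / 2 \<le> real (degree (G c) a)" by linarith
      then have "real (n + 1) \<le> real (2 * degree (G c) a)" by simp
      then have "n + 1 \<le> 2 * degree (G c) a" by (simp only: of_nat_le_iff)
      then have "n div 2 + 1 \<le> degree (G c) a" by linarith
      moreover have "degree (G c) a = card {b. E c a b}"
        unfolding degree_eq_neighbours[OF sg(1)[OF c]] using c by (simp add: E_def')
      ultimately show ?thesis by simp
    qed
  qed
  show ?thesis
  proof (cases "\<forall>x\<in>V. \<forall>y\<in>V. x \<noteq> y \<longrightarrow> (\<forall>k. 3 \<le> k \<and> k \<le> n \<longrightarrow> joined k x y)")
    case True
    have "rainbow_panconnected V (n - 1) G"
      unfolding rainbow_panconnected_def
    proof (intro ballI impI allI)
      fix x y k
      assume xy: "x \<in> V" "y \<in> V" "x \<noteq> y" and k: "rainbow_dist V (n - 1) G x y + 1 \<le> enat k \<and> k \<le> card V"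
      show "\<exists>H. k_path k x y H \<and> rainbow V (n - 1) G H"
      proof (cases "3 \<le> k")
        case k3: True
        then have "joined k x y" using True xy k assms(3) by blast
        then obtain xs cs where xs: "coloured_walk E xs cs" "distinct xs" "distinct cs" "set xs \<subseteq> V"
          "length xs = k" "hd xs = x" "last xs = y" unfolding joined_def by blast
        then have "k_path k x y (path_graph xs)" unfolding k_path_def using k3 by (intro exI[of _ xs]) auto
        moreover have "rainbow V (n - 1) G (path_graph xs)"
          by (rule path_graph_rainbow[OF xs(1)[unfolded E_def K_def] xs(2-4)])
        ultimately show ?thesis by blast
      next
        case False
        define S where "S = {enat l | l. \<exists>H. k_path (l + 1) x y H \<and> rainbow V (n - 1) G H}"
        have S: "rainbow_dist V (n - 1) G x y = Inf S" unfolding rainbow_dist_def S_def ..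
        have "S \<noteq> {}"
        proof
          assume "S = {}"
          then show False using k S by (simp add: Inf_enat_def)
        qed
        then have "Inf S \<in> S" by (auto intro: wellorder_InfI)
        then obtain l H where l: "Inf S = enat l" "k_path (l + 1) x y H" "rainbow V (n - 1) G H"
          unfolding S_def by blast
        have "l + 1 \<le> k" using k unfolding S l(1) by (simp add: one_enat_def)
        moreover have "l \<noteq> 0"
        proof
          assume "l = 0"
          then obtain xs where "length xs = 1" "hd xs = x" "last xs = y" using l(2) unfolding k_path_def by auto
          then show False using xy(3) by (cases xs) auto
        qed
        ultimately have "l + 1 = k" using False by linarith
        then show ?thesis using l(2,3) by blast
      qed
    qed
    then show ?thesis ..
  next
    case False
    then obtain x y k where xy: "x \<in> V" "y \<in> V" "x \<noteq> y" and k: "3 \<le> k" "k \<le> n" "\<not> joined k x y" by blast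
    obtain A where A: "odd n" "A \<subseteq> V - {x, y}" "card A = n div 2"
      and Nx: "\<And>q z. q \<in> K \<Longrightarrow> E q x z \<longleftrightarrow> z \<in> A \<or> z = y" and Ny: "\<And>q z. q \<in> K \<Longrightarrow> E q y z \<longleftrightarrow> z \<in> A \<or> z = x"
      and NA: "\<And>q a b. q \<in> K \<Longrightarrow> a \<in> A \<Longrightarrow> E q a b \<longleftrightarrow> b \<in> V - A"
      by (rule joined_or_extremal[OF assms(1) xy k]) (rule that; assumption)
    define B where "B = V - A"
    have AV: "A \<subseteq> V" using A(2) by blast
    have fin: "finite A" "finite B" using finite_subset[OF AV assms(2)] assms(2) by (simp_all add: B_def)
    have part: "A \<inter> B = {}" "A \<union> B = V" using A(2) by (auto simp: B_def)
    have cB: "card B = n - n div 2" unfolding B_def using card_Diff_subset[OF fin(1) AV] A(3) assms(3) by simp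
    have xyB: "x \<in> B" "y \<in> B" "x \<notin> A" "y \<notin> A" using xy A(2) by (auto simp: B_def)
    have "\<exists>Q2. simple_graph Q2 \<and> verts Q2 = B \<and> min_degree Q2 \<ge> 1 \<and> single_edge_graph x y \<in> components Q2 \<and>
        G i = graph_join (empty_graph A) Q2" if i: "i \<in> K" for i
    proof (intro exI conjI)
      define Q where "Q = \<lparr>verts = B, edges = {e \<in> edges (G i). e \<subseteq> B}\<rparr>"
      note sgi = sg[OF i]
      have two: "e \<subseteq> V \<and> card e = 2" if "e \<in> edges (G i)" for e
        using sgi that by (auto simp: simple_graph_def)
      have Ei: "{a, b} \<in> edges (G i) \<longleftrightarrow> E i a b" for a b using i by (simp add: E_def')
      have EQ: "{a, b} \<in> edges Q \<longleftrightarrow> E i a b \<and> a \<in> B \<and> b \<in> B" for a b unfolding Q_def using Ei by auto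
      show sQ: "simple_graph Q" unfolding simple_graph_def Q_def using two fin by auto
      show vQ: "verts Q = B" by (simp add: Q_def)
      have dQ: "1 \<le> degree Q b" if b: "b \<in> B" for b
      proof -
        have "\<not> {z. E i b z} \<subseteq> A"
        proof
          assume "{z. E i b z} \<subseteq> A"
          then have "card {z. E i b z} \<le> n div 2" using card_mono[OF fin(1)] A(3) by metis
          then show False using deg[OF i, of b] b by (auto simp: B_def)
        qed
        then obtain z where z: "E i b z" "z \<notin> A" by blast
        then have "{b, z} \<in> edges Q" using EQ EV2[OF z(1)] b by (simp add: B_def)
        then have "z \<in> {u. {b, u} \<in> edges Q}" by simp
        moreover have "finite {u. {b, u} \<in> edges Q}" using EQ fin(2) by (auto intro: finite_subset[of _ B])
        ultimately show ?thesis
          unfolding degree_eq_neighbours[OF sQ] by (metis One_nat_def Suc_leI card_gt_0_iff empty_iff)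
      qed
      show "min_degree Q \<ge> 1"
        unfolding min_degree_def vQ using dQ fin(2) xyB(1) by (subst Min_ge_iff) auto
      have ax: "(x, b) \<in> adj_rel Q \<longleftrightarrow> b = y" "(y, b) \<in> adj_rel Q \<longleftrightarrow> b = x" for b
        unfolding adj_rel_def using EQ Nx[OF i] Ny[OF i] xyB by (auto simp: B_def)
      have "(x, b) \<in> (adj_rel Q)\<^sup>* \<Longrightarrow> b \<in> {x, y}" for b
        by (induction rule: rtrancl_induct) (use ax in auto)
      moreover have "(x, y) \<in> (adj_rel Q)\<^sup>*" using ax by blast
      ultimately have reach: "(adj_rel Q)\<^sup>* `` {x} = {x, y}" by auto
      have "induced_subgraph Q {x, y} = single_edge_graph x y"
      proof -
        have "{e \<in> edges Q. e \<subseteq> {x, y}} = {{x, y}}"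
        proof
          show "{e \<in> edges Q. e \<subseteq> {x, y}} \<subseteq> {{x, y}}"
          proof
            fix e assume e: "e \<in> {e \<in> edges Q. e \<subseteq> {x, y}}"
            then have "card e = card {x, y}" using two[of e] xy(3) by (simp add: Q_def)
            then show "e \<in> {{x, y}}" using card_subset_eq[of "{x, y}" e] e by simp
          qed
          show "{{x, y}} \<subseteq> {e \<in> edges Q. e \<subseteq> {x, y}}" using EQ[of x y] Nx[OF i, of y] xyB by simp
        qed
        moreover have "verts Q \<inter> {x, y} = {x, y}" using xyB by (auto simp: Q_def)
        ultimately show ?thesis unfolding induced_subgraph_def single_edge_graph_def by simp
      qed
      then show "single_edge_graph x y \<in> components Q"
        unfolding components_def vQ using reach xyB(1) by (metis (mono_tags, lifting) mem_Collect_eq)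
      have "edges (G i) = edges Q \<union> {{a, b} | a b. a \<in> A \<and> b \<in> B}"
      proof
        show "edges (G i) \<subseteq> edges Q \<union> {{a, b} | a b. a \<in> A \<and> b \<in> B}"
        proof
          fix e assume e: "e \<in> edges (G i)"
          obtain a b where ab: "e = {a, b}" using two[OF e] by (auto simp: card_2_iff)
          then have V: "a \<in> V" "b \<in> V" "E i a b" "E i b a" using two[OF e] Ei e Esym by auto
          consider "a \<in> A" | "b \<in> A" | "a \<in> B" "b \<in> B" using V part by blast
          then show "e \<in> edges Q \<union> {{a, b} | a b. a \<in> A \<and> b \<in> B}"
          proof cases
            case 1
            then have "b \<in> B" using NA[OF i 1, of b] V by (simp add: B_def)
            then show ?thesis using 1 ab by blast
          next
            case 2
            then have "a \<in> B" using NA[OF i 2, of a] V by (simp add: B_def)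
            moreover have "e = {b, a}" using ab by blast
            ultimately show ?thesis using 2 by blast
          next
            case 3
            then show ?thesis using e ab by (simp add: Q_def)
          qed
        qed
        show "edges Q \<union> {{a, b} | a b. a \<in> A \<and> b \<in> B} \<subseteq> edges (G i)"
          using NA[OF i] Ei by (auto simp: Q_def B_def)
      qed
      then show "G i = graph_join (empty_graph A) Q"
        using sgi(2) part vQ by (intro ugraph.equality) (auto simp: graph_join_def empty_graph_def)
    qed
    moreover have "card A = (n - 1) div 2" "card B = (n + 1) div 2" using A(1,3) cB by (auto elim!: oddE)
    ultimately have "is_F_collection n V (n - 1) G"
      unfolding is_F_collection_def K_def[symmetric] using A(1) fin part xy(3) by blast
    then show ?thesis ..
  qed
qed

end
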